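(* Let $\Gamma$ be a Fuchsian group of convergence type with finite-dimensional defect space $N$ (that is, let $\Gamma$ be admissible). Let $f\in L^\infty_\Gamma$. Then the distance of $f$ from $H^\infty_\Gamma$ (in the $L^\infty$ norm) is given by $$\|f+H^\infty_\Gamma\|=\sup_{\sigma\in\hat\Gamma}\|(I-P_{H^2_\sigma})M_fP_{H^2_\sigma}\|.$$
   Context: $\mathbb D$ is the open unit disk, $\mathbb T$ the unit circle with normalized Lebesgue measure $m$, $L^p=L^p(\mathbb T,m)$ and $H^p\subseteq L^p$ the Hardy spaces ($1\le p\le\infty$), whose elements are also regarded as analytic functions on $\mathbb D$. An automorphism is a M\"obius map of $\mathbb D$ onto $\mathbb D$ (it extends to $\mathbb T$); a Fuchsian group is a discrete group $\Gamma$ of automorphisms. $\Gamma$ acts on $L^p$ and $H^p$ by $f\mapsto f\circ\gamma$. The character group $\hat\Gamma$ is the set of homomorphisms $\Gamma\to\mathbb T$. For $X\in\{L^p,H^p\}$, $X_\Gamma=\{f\in X: f\circ\gamma=f\ \forall\gamma\in\Gamma\}$ and, for $\sigma\in\hat\Gamma$, $X_\sigma=\{f\in X: f\circ\gamma=\sigma(\gamma)f\ \forall\gamma\in\Gamma\}$; these are written $L^p_\Gamma,H^p_\Gamma,L^p_\sigma,H^p_\sigma$. $\Gamma$ is of convergence type if $\sum_{\zeta\in\Gamma(0)}(1-|\zeta|)<\infty$, where $\Gamma(0)$ is the orbit of $0$. Let $\Psi:L^p\to L^p_\Gamma$ be the conditional expectation onto the functions measurable with respect to the $\sigma$-algebra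 of $\Gamma$-invariant sets (measurable $E$ with $m(E\triangle\gamma^{-1}(E))=0$ for all $\gamma\in\Gamma$). Let $k_z(\zeta)=(1-\bar z\zeta)^{-1}$ be the Szeg\"o kernel, $v_\gamma=-i\,\Psi(k_{\gamma(0)}-\overline{k_{\gamma(0)}})\in L^\infty_\Gamma$ for $\gamma\in\Gamma$. The defect space is $N=\operatorname{span}\{v_\gamma:\gamma\in\Gamma\}$. $\Gamma$ is called admissible if it is Fuchsian of convergence type and $N$ is finite dimensional. $M_f$ is multiplication by $f$ on $L^2$, $I$ is the identity of $B(L^2)$, and $P_{\mathcal M}\in B(L^2)$ is the orthogonal projection onto the closed subspace $\mathcal M\subseteq L^2$. *)

theory Defs
  imports
    "HOL-Probability.Probability"
    "HOL-Algebra.Bij"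
begin

section \<open>Function spaces on the circle\<close>

text \<open>
  Elements of \<open>L\<^sup>p\<close> are represented by measurable functions on the unit circle; equality in
  \<open>L\<^sup>p\<close> is equality almost everywhere, and every notion below respects it.
\<close>

definition circle_measure :: "complex measure" where
  "circle_measure =
     distr (uniform_measure lborel {0..2 * pi}) (restrict_space borel (sphere 0 1)) cis"

definition Linf_norm :: "(complex \<Rightarrow> complex) \<Rightarrow> ereal" where
  "Linf_norm f = esssup circle_measure (\<lambda>z. ereal (cmod (f z)))"

definition Linf :: "(complex \<Rightarrow> complex) set" where
  "Linf = {f \<in> borel_measurable circle_measure. Linf_norm f < \<infinity>}"

definition L2 :: "(complex \<Rightarrow> complex) set" where
  "L2 = {f \<in> borel_measurable circle_measure. integrable circle_measure (\<lambda>z. (cmod (f z))\<^sup>2)}"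

definition L2_inner :: "(complex \<Rightarrow> complex) \<Rightarrow> (complex \<Rightarrow> complex) \<Rightarrow> complex" where
  "L2_inner f g = (LINT z|circle_measure. f z * cnj (g z))"

definition L2_norm :: "(complex \<Rightarrow> complex) \<Rightarrow> real" where
  "L2_norm f = sqrt (LINT z|circle_measure. (cmod (f z))\<^sup>2)"

text \<open>
  \<open>H\<^sup>p\<close> as a subspace of \<open>X = L\<^sup>p\<close>: all Fourier coefficients of negative index vanish.
  Note that \<open>cnj (z powi (-n)) = z ^ n\<close> on the circle.
\<close>

definition hardy :: "(complex \<Rightarrow> complex) set \<Rightarrow> (complex \<Rightarrow> complex) set" where
  "hardy X = {f \<in> X. \<forall>n\<ge>1. (LINT z|circle_measure. f z * z ^ n) = 0}"


section \<open>Operators on the Hilbert space\<close>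

text \<open>
  The projection is determined up to almost everywhere equality, and it exists when \<open>M\<close> is a
  closed subspace (modulo almost everywhere equality).
\<close>

definition orth_proj :: "(complex \<Rightarrow> complex) set \<Rightarrow> (complex \<Rightarrow> complex) \<Rightarrow> (complex \<Rightarrow> complex)" where
  "orth_proj M g = (SOME h. h \<in> M \<and> (\<forall>k\<in>M. L2_inner (\<lambda>z. g z - h z) k = 0))"

definition mult_op :: "(complex \<Rightarrow> complex) \<Rightarrow> (complex \<Rightarrow> complex) \<Rightarrow> (complex \<Rightarrow> complex)" where
  "mult_op f g = (\<lambda>z. f z * g z)"

definition compl_proj :: "(complex \<Rightarrow> complex) set \<Rightarrow> (complex \<Rightarrow> complex) \<Rightarrow> (complex \<Rightarrow> complex)" where
  "compl_proj M g = (\<lambda>z. g z - orth_proj M g z)"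

definition L2_opnorm :: "((complex \<Rightarrow> complex) \<Rightarrow> (complex \<Rightarrow> complex)) \<Rightarrow> ereal" where
  "L2_opnorm T = (SUP g \<in> {g \<in> L2. L2_norm g \<le> 1}. ereal (L2_norm (T g)))"


section \<open>Fuchsian groups\<close>

text \<open>
  A Moebius map of the disk onto itself is represented by its extension to the closed disk, made
  \<open>extensional\<close> there; so composition is the multiplication of \<open>BijGroup (cball 0 1)\<close>
  and poles outside the closed disk play no role.
\<close>

definition disk_automorphism :: "(complex \<Rightarrow> complex) \<Rightarrow> bool" where
  "disk_automorphism \<gamma> \<longleftrightarrow>
     \<gamma> \<in> extensional (cball 0 1) \<and> \<gamma> ` ball 0 1 = ball 0 1 \<and>
     (\<exists>a b c d. a * d - b * c \<noteq> 0 \<and>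
        (\<forall>z\<in>cball 0 1. c * z + d \<noteq> 0 \<and> \<gamma> z = (a * z + b) / (c * z + d)))"

text \<open>
  Discreteness refers to the topology of uniform convergence on the closed disk. On the group of
  automorphisms this is its usual topology.
\<close>

definition fuchsian :: "(complex \<Rightarrow> complex) set \<Rightarrow> bool" where
  "fuchsian \<Gamma> \<longleftrightarrow>
     subgroup \<Gamma> (BijGroup (cball 0 1)) \<and> (\<forall>\<gamma>\<in>\<Gamma>. disk_automorphism \<gamma>) \<and>
     (\<forall>\<gamma>\<in>\<Gamma>. \<exists>\<epsilon>>0. \<forall>\<delta>\<in>\<Gamma>. (\<forall>z\<in>cball 0 1. dist (\<delta> z) (\<gamma> z) < \<epsilon>) \<longrightarrow> \<delta> = \<gamma>)"

definition convergence_type :: "(complex \<Rightarrow> complex) set \<Rightarrow> bool" where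
  "convergence_type \<Gamma> \<longleftrightarrow> (\<lambda>\<zeta>. 1 - cmod \<zeta>) summable_on ((\<lambda>\<gamma>. \<gamma> 0) ` \<Gamma>)"

definition circle_group :: "complex monoid" where
  "circle_group = \<lparr>carrier = sphere 0 1, mult = (*), one = 1\<rparr>"

definition characters :: "(complex \<Rightarrow> complex) set \<Rightarrow> ((complex \<Rightarrow> complex) \<Rightarrow> complex) set" where
  "characters \<Gamma> = hom ((BijGroup (cball 0 1))\<lparr>carrier := \<Gamma>\<rparr>) circle_group"

definition invariant_space ::
    "(complex \<Rightarrow> complex) set \<Rightarrow> (complex \<Rightarrow> complex) set \<Rightarrow> (complex \<Rightarrow> complex) set" where
  "invariant_space X \<Gamma> = {f \<in> X. \<forall>\<gamma>\<in>\<Gamma>. AE z in circle_measure. f (\<gamma> z) = f z}"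

definition character_space ::
    "(complex \<Rightarrow> complex) set \<Rightarrow> (complex \<Rightarrow> complex) set \<Rightarrow> ((complex \<Rightarrow> complex) \<Rightarrow> complex)
      \<Rightarrow> (complex \<Rightarrow> complex) set" where
  "character_space X \<Gamma> \<sigma> = {f \<in> X. \<forall>\<gamma>\<in>\<Gamma>. AE z in circle_measure. f (\<gamma> z) = \<sigma> \<gamma> * f z}"


section \<open>The defect space\<close>

definition invariant_sets :: "(complex \<Rightarrow> complex) set \<Rightarrow> complex set set" where
  "invariant_sets \<Gamma> = {E \<in> sets circle_measure.
     \<forall>\<gamma>\<in>\<Gamma>. sym_diff E (\<gamma> -` E \<inter> sphere 0 1) \<in> null_sets circle_measure}"

text \<open>\<open>real_cond_exp\<close> uses only the \<open>\<sigma>\<close>-algebra of its second argument.\<close>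

definition cond_exp_inv ::
    "(complex \<Rightarrow> complex) set \<Rightarrow> (complex \<Rightarrow> complex) \<Rightarrow> (complex \<Rightarrow> complex)" where
  "cond_exp_inv \<Gamma> f = (\<lambda>z. Complex
     (real_cond_exp circle_measure (sigma (sphere 0 1) (invariant_sets \<Gamma>)) (\<lambda>\<zeta>. Re (f \<zeta>)) z)
     (real_cond_exp circle_measure (sigma (sphere 0 1) (invariant_sets \<Gamma>)) (\<lambda>\<zeta>. Im (f \<zeta>)) z))"

definition szego_kernel :: "complex \<Rightarrow> complex \<Rightarrow> complex" where
  "szego_kernel z \<zeta> = inverse (1 - cnj z * \<zeta>)"

definition defect_vector ::
    "(complex \<Rightarrow> complex) set \<Rightarrow> (complex \<Rightarrow> complex) \<Rightarrow> (complex \<Rightarrow> complex)" where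
  "defect_vector \<Gamma> \<gamma> = (\<lambda>z. - \<i> *
     cond_exp_inv \<Gamma> (\<lambda>\<zeta>. szego_kernel (\<gamma> 0) \<zeta> - cnj (szego_kernel (\<gamma> 0) \<zeta>)) z)"

text \<open>Complex linear span and finite dimensionality, both modulo almost everywhere equality.\<close>

definition ae_span :: "(complex \<Rightarrow> complex) set \<Rightarrow> (complex \<Rightarrow> complex) set" where
  "ae_span S = {g \<in> borel_measurable circle_measure.
     \<exists>F c. finite F \<and> F \<subseteq> S \<and> (AE z in circle_measure. g z = (\<Sum>b\<in>F. c b * b z))}"

definition ae_finite_dim :: "(complex \<Rightarrow> complex) set \<Rightarrow> bool" where
  "ae_finite_dim V \<longleftrightarrow> (\<exists>B. finite B \<and> B \<subseteq> V \<and> V \<subseteq> ae_span B)"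

definition defect_space :: "(complex \<Rightarrow> complex) set \<Rightarrow> (complex \<Rightarrow> complex) set" where
  "defect_space \<Gamma> = ae_span (defect_vector \<Gamma> ` \<Gamma>)"

definition admissible :: "(complex \<Rightarrow> complex) set \<Rightarrow> bool" where
  "admissible \<Gamma> \<longleftrightarrow>
     fuchsian \<Gamma> \<and> convergence_type \<Gamma> \<and> ae_finite_dim (defect_space \<Gamma>)"


section \<open>Well-definedness of the measure-theoretic notions\<close>

lemma space_circle_measure [simp]: "space circle_measure = sphere 0 1"
  by (simp add: circle_measure_def space_restrict_space)

lemma sets_circle_measure [simp]: "sets circle_measure = sets (restrict_space borel (sphere 0 1))"
  by (simp add: circle_measure_def)

lemma prob_space_circle_measure: "prob_space circle_measure"
proof -
  have "prob_space (uniform_measure lborel {0..2 * pi})"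
    by (rule prob_space_uniform_measure) auto
  moreover have "cis \<in> uniform_measure lborel {0..2 * pi} \<rightarrow>\<^sub>M restrict_space borel (sphere 0 1)"
    by (intro measurable_restrict_space2)
      (auto simp: measurable_cong_sets[OF sets_uniform_measure] intro!: borel_measurable_continuous_onI
        continuous_intros)
  ultimately show ?thesis
    unfolding circle_measure_def by (rule prob_space.prob_space_distr)
qed

lemma fuchsian_maps_sphere:
  assumes "fuchsian \<Gamma>" "\<gamma> \<in> \<Gamma>" "z \<in> sphere 0 1"
  shows "\<gamma> z \<in> sphere 0 1"
proof -
  have bij: "bij_betw \<gamma> (cball 0 1) (cball 0 1)"
    using assms(1,2) subgroup.subset[of \<Gamma> "BijGroup (cball 0 1)"]
    by (auto simp: fuchsian_def BijGroup_def Bij_def)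
  have ball: "\<gamma> ` ball 0 1 = ball 0 1"
    using assms(1,2) by (auto simp: fuchsian_def disk_automorphism_def)
  have z: "z \<in> cball 0 1" "z \<notin> ball 0 1" using assms(3) by auto
  have "\<gamma> z \<notin> ball 0 1"
  proof
    assume "\<gamma> z \<in> ball 0 1"
    then obtain w where w: "w \<in> ball 0 1" "\<gamma> z = \<gamma> w" using ball by (metis imageE)
    then have "z = w"
      using bij z(1) ball_subset_cball by (metis bij_betw_imp_inj_on inj_onD subsetD)
    with w(1) z(2) show False by simp
  qed
  moreover have "\<gamma> z \<in> cball 0 1" using bij z(1) by (rule bij_betwE[THEN bspec])
  ultimately show ?thesis by (simp add: order.antisym)
qed

lemma sigma_algebra_invariant_sets:
  assumes "fuchsian \<Gamma>"
  shows "sigma_algebra (sphere 0 1) (invariant_sets \<Gamma>)"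
  unfolding sigma_algebra_iff2
proof (intro conjI ballI allI impI)
  interpret prob_space circle_measure by (rule prob_space_circle_measure)
  show "invariant_sets \<Gamma> \<subseteq> Pow (sphere 0 1)"
    using sets.space_closed[of circle_measure] by (auto simp: invariant_sets_def)
  show "{} \<in> invariant_sets \<Gamma>"
    by (simp add: invariant_sets_def del: sets_circle_measure)
  fix E assume E: "E \<in> invariant_sets \<Gamma>"
  have "sym_diff (sphere 0 1 - E) (\<gamma> -` (sphere 0 1 - E) \<inter> sphere 0 1)
      = sym_diff E (\<gamma> -` E \<inter> sphere 0 1)" if "\<gamma> \<in> \<Gamma>" for \<gamma>
    using fuchsian_maps_sphere[OF assms that] E sets.sets_into_space[of E circle_measure]
    unfolding invariant_sets_def space_circle_measure by blast
  moreover have "sphere 0 1 - E \<in> sets circle_measure"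
    using E sets.compl_sets[of E circle_measure]
    unfolding invariant_sets_def space_circle_measure by blast
  ultimately show "sphere 0 1 - E \<in> invariant_sets \<Gamma>"
    using E unfolding invariant_sets_def by (simp del: sets_circle_measure)
next
  fix A :: "nat \<Rightarrow> complex set" assume "range A \<subseteq> invariant_sets \<Gamma>"
  then have A: "A i \<in> sets circle_measure"
    "\<gamma> \<in> \<Gamma> \<Longrightarrow> sym_diff (A i) (\<gamma> -` A i \<inter> sphere 0 1) \<in> null_sets circle_measure" for i \<gamma>
    unfolding invariant_sets_def by blast+
  show "\<Union> (range A) \<in> invariant_sets \<Gamma>"
    unfolding invariant_sets_def
  proof (intro CollectI conjI ballI)
    show UA: "\<Union> (range A) \<in> sets circle_measure"
      by (rule sets.countable_UN) (use A(1) in blast)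
    fix \<gamma> assume g: "\<gamma> \<in> \<Gamma>"
    let ?N = "\<Union>i. sym_diff (A i) (\<gamma> -` A i \<inter> sphere 0 1)"
    have N: "?N \<in> null_sets circle_measure" by (rule null_sets_UN) (rule A(2)[OF g])
    have pre: "\<gamma> -` A i \<inter> sphere 0 1 \<in> sets circle_measure" for i
    proof -
      have "\<gamma> -` A i \<inter> sphere 0 1 = sym_diff (A i) (sym_diff (A i) (\<gamma> -` A i \<inter> sphere 0 1))"
        by (simp only: set_eq_iff Un_iff Diff_iff) blast
      moreover have "\<dots> \<in> sets circle_measure"
        by (intro sets.Un sets.Diff A(1) null_setsD2[OF A(2)[OF g]])
      ultimately show ?thesis by (simp only:)
    qed
    have "(\<Union>i. \<gamma> -` A i \<inter> sphere 0 1) \<in> sets circle_measure"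
      by (rule sets.countable_UN) (use pre in blast)
    moreover have "\<gamma> -` \<Union> (range A) \<inter> sphere 0 1 = (\<Union>i. \<gamma> -` A i \<inter> sphere 0 1)" by blast
    ultimately have "\<gamma> -` \<Union> (range A) \<inter> sphere 0 1 \<in> sets circle_measure" by (simp only:)
    then have "sym_diff (\<Union> (range A)) (\<gamma> -` \<Union> (range A) \<inter> sphere 0 1) \<in> sets circle_measure"
      by (intro sets.Un sets.Diff UA)
    then show "sym_diff (\<Union> (range A)) (\<gamma> -` \<Union> (range A) \<inter> sphere 0 1) \<in> null_sets circle_measure"
      by (rule null_sets_subset[OF N]) blast
  qed
qed

lemma sets_sigma_invariant_sets:
  assumes "fuchsian \<Gamma>"
  shows "sets (sigma (sphere 0 1) (invariant_sets \<Gamma>)) = invariant_sets \<Gamma>"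
  by (rule sigma_algebra.sets_measure_of_eq[OF sigma_algebra_invariant_sets[OF assms]])

lemma sigma_finite_subalgebra_invariant_sets:
  assumes "fuchsian \<Gamma>"
  shows "sigma_finite_subalgebra circle_measure (sigma (sphere 0 1) (invariant_sets \<Gamma>))"
proof -
  interpret prob_space circle_measure by (rule prob_space_circle_measure)
  have "invariant_sets \<Gamma> \<subseteq> Pow (sphere 0 1)"
    using sigma_algebra_invariant_sets[OF assms] unfolding sigma_algebra_iff2 by (rule conjunct1)
  then have "subalgebra circle_measure (sigma (sphere 0 1) (invariant_sets \<Gamma>))"
    unfolding subalgebra_def sets_sigma_invariant_sets[OF assms]
    by (simp add: space_measure_of invariant_sets_def Collect_restrict del: sets_circle_measure)
  then have "finite_measure_subalgebra circle_measure (sigma (sphere 0 1) (invariant_sets \<Gamma>))"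
    by unfold_locales
  then show ?thesis by (rule finite_measure_subalgebra_is_sigma_finite)
qed

end

theory Submission
  imports Defs "HOL-Complex_Analysis.Cauchy_Integral_Formula"
begin

text \<open>The distance dominates every operator norm because adding \<open>h \<in> H\<^sup>\<infinity>\<^sub>\<Gamma>\<close> to \<open>f\<close> does not change
\<open>(I - P) M\<^sub>f P\<close>: multiplication by \<open>h\<close> maps \<open>H\<^sup>2\<^sub>\<sigma>\<close> into itself.

For the converse let \<open>D\<close> be the supremum. A function \<open>h\<close> with \<open>\<bar>f + h\<bar> \<le> D\<close> is found by a single
minimisation in \<open>H\<^sup>2\<^sub>\<Gamma>\<close>: let \<open>h\<close> minimise the \<open>L\<^sup>2\<close> norm of the distance of \<open>F = f + h\<close> from the disk
of radius \<open>D\<close>, and let \<open>w = (1 - D / \<bar>F\<bar>)\<^sup>+\<close>. The first variation says that \<open>w F\<close> is orthogonal to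
\<open>H\<^sup>2\<^sub>\<Gamma>\<close>, so \<open>h\<close> also minimises the weighted norm \<open>\<integral> \<bar>f + h\<bar>\<^sup>2 w\<close>. The weight is \<open>\<Gamma>\<close>-invariant,
because \<open>f\<close> and \<open>h\<close> are.

Weighted norms are controlled by the operator norms. If \<open>W = w + \<epsilon>\<close>, Szego's theorem gives \<open>q\<close> with
\<open>q, 1/q \<in> H\<^sup>\<infinity>\<close> and \<open>\<bar>q\<bar>\<^sup>2 = W\<close> (\<open>szego_factorization\<close>). As \<open>W\<close> is invariant, \<open>(q \<circ> \<gamma>) / q\<close> is unimodular
and lies in \<open>H\<^sup>\<infinity>\<close> together with its conjugate, hence is a constant \<open>\<sigma> \<gamma>\<close>, and \<open>\<sigma>\<close> is a character
(\<open>character_of_invariant_modulus\<close>). Then \<open>q H\<^sup>2\<^sub>\<Gamma> = H\<^sup>2\<^sub>\<sigma>\<close>, so that the minimum of \<open>\<integral> \<bar>f + k\<bar>\<^sup>2 W\<close> over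
\<open>k \<in> H\<^sup>2\<^sub>\<Gamma>\<close> is \<open>\<parallel>(I - P) (f q)\<parallel>\<^sup>2 \<le> D\<^sup>2 \<parallel>q\<parallel>\<^sup>2 = D\<^sup>2 \<integral> W\<close>. Letting \<open>\<epsilon>\<close> tend to \<open>0\<close> yields
\<open>\<integral> (\<bar>F\<bar>\<^sup>2 - D\<^sup>2) w \<le> 0\<close>. The integrand is nonnegative, and positive where \<open>\<bar>F\<bar> > D\<close>; so \<open>\<bar>F\<bar> \<le> D\<close>
almost everywhere.

Two analytic facts support this. Fourier coefficients determine a finite measure on the circle
(\<open>circle_measures_eqI\<close>), and \<open>m\<close> is transported by an automorphism \<open>\<gamma>\<close> to the Poisson measure of
\<open>\<gamma> 0\<close> (\<open>distr_inner_map\<close>). The latter makes composition with \<open>\<gamma>\<close> bounded on \<open>L\<^sup>2\<close>, and the former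
shows that \<open>H\<^sup>2\<close> is the smallest closed subspace that contains the monomials (\<open>hardy_L2_minimal\<close>).
Stability of \<open>H\<^sup>2\<close> under composition with \<open>\<gamma>\<close> and under multiplication by \<open>H\<^sup>\<infinity>\<close> then has to be checked
on monomials only.\<close>

section \<open>The Hilbert space \<open>L\<^sup>2\<close> of the circle\<close>

interpretation circle: prob_space circle_measure
  by (rule prob_space_circle_measure)

lemma L2_measurable: "f \<in> L2 \<Longrightarrow> f \<in> borel_measurable circle_measure"
  by (simp add: L2_def)

lemma L2_sq_integrable: "f \<in> L2 \<Longrightarrow> integrable circle_measure (\<lambda>z. (cmod (f z))\<^sup>2)"
  by (simp add: L2_def)

lemma L2_add: assumes "f \<in> L2" "g \<in> L2" shows "(\<lambda>z. f z + g z) \<in> L2"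
proof -
  note [measurable] = assms[THEN L2_measurable]
  have "(cmod (f z + g z))\<^sup>2 \<le> 2 * (cmod (f z))\<^sup>2 + 2 * (cmod (g z))\<^sup>2" for z
  proof -
    have "(cmod (f z + g z))\<^sup>2 \<le> (cmod (f z) + cmod (g z))\<^sup>2"
      by (intro power_mono norm_triangle_ineq) auto
    also have "\<dots> \<le> 2 * (cmod (f z))\<^sup>2 + 2 * (cmod (g z))\<^sup>2"
      using sum_squares_bound[of "cmod (f z)" "cmod (g z)"] by (simp add: power2_sum)
    finally show ?thesis .
  qed
  then have bd: "AE z in circle_measure. norm ((cmod (f z + g z))\<^sup>2)
      \<le> norm (2 * (cmod (f z))\<^sup>2 + 2 * (cmod (g z))\<^sup>2)"
    by (intro always_eventually allI) (simp only: real_norm_def abs_of_nonneg zero_le_power2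
        add_nonneg_nonneg mult_nonneg_nonneg zero_le_numeral)
  have "integrable circle_measure (\<lambda>z. 2 * (cmod (f z))\<^sup>2 + 2 * (cmod (g z))\<^sup>2)"
    using assms[THEN L2_sq_integrable] by simp
  then have "integrable circle_measure (\<lambda>z. (cmod (f z + g z))\<^sup>2)"
    by (rule Bochner_Integration.integrable_bound) (measurable, rule bd)
  then show ?thesis by (simp add: L2_def)
qed

lemma L2_bounded_mult:
  assumes "u \<in> borel_measurable circle_measure" "AE z in circle_measure. cmod (u z) \<le> B" "f \<in> L2"
  shows "(\<lambda>z. u z * f z) \<in> L2"
proof -
  note [measurable] = assms(1) assms(3)[THEN L2_measurable]
  have "integrable circle_measure (\<lambda>z. B\<^sup>2 * (cmod (f z))\<^sup>2)"
    using assms(3)[THEN L2_sq_integrable] by simp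
  then have "integrable circle_measure (\<lambda>z. (cmod (u z * f z))\<^sup>2)"
    by (rule Bochner_Integration.integrable_bound)
       (use assms(2) in \<open>auto simp: norm_mult power_mult_distrib intro!: mult_right_mono power_mono\<close>)
  then show ?thesis by (simp add: L2_def)
qed

lemma L2_scale: "f \<in> L2 \<Longrightarrow> (\<lambda>z. c * f z) \<in> L2"
  by (rule L2_bounded_mult[where B = "cmod c"]) auto

lemma L2_diff: "f \<in> L2 \<Longrightarrow> g \<in> L2 \<Longrightarrow> (\<lambda>z. f z - g z) \<in> L2"
  using L2_add[of f "\<lambda>z. -1 * g z"] L2_scale[of g "-1"] by simp

lemma L2_cnj: "f \<in> L2 \<Longrightarrow> (\<lambda>z. cnj (f z)) \<in> L2"
  unfolding L2_def by (auto intro: measurable_compose[OF _ borel_measurable_continuous_onI[of cnj]]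
      simp: continuous_intros)

lemma L2_const [simp]: "(\<lambda>z. c) \<in> L2"
  by (simp add: L2_def)

lemma L2_bounded:
  assumes "u \<in> borel_measurable circle_measure" "AE z in circle_measure. cmod (u z) \<le> B"
  shows "u \<in> L2"
  using L2_bounded_mult[OF assms L2_const[of 1]] by simp

lemma L2_mult_integrable:
  assumes "f \<in> L2" "g \<in> L2" shows "integrable circle_measure (\<lambda>z. f z * g z)"
proof -
  note [measurable] = assms[THEN L2_measurable]
  have "cmod (f z * g z) \<le> (cmod (f z))\<^sup>2 + (cmod (g z))\<^sup>2" for z
    using sum_squares_bound[of "cmod (f z)" "cmod (g z)"]
      mult_nonneg_nonneg[OF norm_ge_zero norm_ge_zero, of "f z" "g z"]
    unfolding norm_mult by linarith
  then have bd: "AE z in circle_measure. norm (f z * g z) \<le> norm ((cmod (f z))\<^sup>2 + (cmod (g z))\<^sup>2)"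
    by (intro always_eventually allI) simp
  have "integrable circle_measure (\<lambda>z. (cmod (f z))\<^sup>2 + (cmod (g z))\<^sup>2)"
    using assms[THEN L2_sq_integrable] by simp
  then show ?thesis
    by (rule Bochner_Integration.integrable_bound) (measurable, rule bd)
qed

lemma L2_integrable: "f \<in> L2 \<Longrightarrow> integrable circle_measure f"
  using L2_mult_integrable[of f "\<lambda>z. 1"] by simp

lemma L2_norm_nonneg [simp]: "0 \<le> L2_norm f"
  by (simp add: L2_norm_def)

lemma L2_norm_sq: "(L2_norm f)\<^sup>2 = (LINT z|circle_measure. (cmod (f z))\<^sup>2)"
  by (simp add: L2_norm_def)

lemma L2_norm_zero [simp]: "L2_norm (\<lambda>z. 0) = 0"
  by (simp add: L2_norm_def)

lemma L2_norm_cong: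
  assumes "f \<in> borel_measurable circle_measure" "g \<in> borel_measurable circle_measure"
    "AE z in circle_measure. cmod (f z) = cmod (g z)"
  shows "L2_norm f = L2_norm g"
  unfolding L2_norm_def using assms by (auto intro!: arg_cong[where f = sqrt] integral_cong_AE)

lemma L2_norm_scale: "L2_norm (\<lambda>z. c * f z) = cmod c * L2_norm f"
  by (simp add: L2_norm_def norm_mult power_mult_distrib real_sqrt_mult)

lemma L2_norm_minus_commute: "L2_norm (\<lambda>z. f z - g z) = L2_norm (\<lambda>z. g z - f z)"
  by (simp add: L2_norm_def norm_minus_commute)

lemma L2_norm_eq_0_iff:
  assumes "f \<in> L2" shows "L2_norm f = 0 \<longleftrightarrow> (AE z in circle_measure. f z = 0)"
  using integral_nonneg_eq_0_iff_AE[OF L2_sq_integrable[OF assms]] by (simp add: L2_norm_def)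

lemma L2_norm_mono:
  assumes "f \<in> borel_measurable circle_measure" "g \<in> L2"
    "AE z in circle_measure. cmod (f z) \<le> cmod (g z)"
  shows "f \<in> L2" "L2_norm f \<le> L2_norm g"
proof -
  note [measurable] = assms(1)
  have "integrable circle_measure (\<lambda>z. (cmod (f z))\<^sup>2)"
    by (rule Bochner_Integration.integrable_bound[OF L2_sq_integrable[OF assms(2)]])
       (use assms(3) in \<open>auto intro!: power_mono\<close>)
  then show "f \<in> L2" by (simp add: L2_def)
  then show "L2_norm f \<le> L2_norm g"
    unfolding L2_norm_def using assms
    by (auto intro!: integral_mono_AE L2_sq_integrable power_mono)
qed

lemma L2_norm_add_sq:
  assumes "f \<in> L2" "g \<in> L2"
  shows "(L2_norm (\<lambda>z. f z + g z))\<^sup>2 = (L2_norm f)\<^sup>2 + 2 * Re (L2_inner f g) + (L2_norm g)\<^sup>2"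
proof -
  have i: "integrable circle_measure (\<lambda>z. f z * cnj (g z))"
    using assms by (intro L2_mult_integrable L2_cnj)
  have "(\<lambda>z. (cmod (f z + g z))\<^sup>2)
      = (\<lambda>z. (cmod (f z))\<^sup>2 + 2 * Re (f z * cnj (g z)) + (cmod (g z))\<^sup>2)"
    unfolding cmod_power2 by (simp add: fun_eq_iff power2_eq_square algebra_simps)
  moreover have "integrable circle_measure (\<lambda>z. 2 * Re (f z * cnj (g z)))"
    by (intro integrable_mult_right integrable_Re i)
  moreover have "(LINT z|circle_measure. 2 * Re (f z * cnj (g z))) = 2 * Re (L2_inner f g)"
    using integral_Re[OF i] unfolding L2_inner_def by (simp only: integral_mult_right_zero)
  ultimately show ?thesis
    using assms[THEN L2_sq_integrable]
    by (simp only: L2_norm_sq Bochner_Integration.integral_add Bochner_Integration.integrable_add)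
qed

lemma L2_inner_scale_right: "L2_inner f (\<lambda>z. c * g z) = cnj c * L2_inner f g"
proof -
  have "(\<lambda>z. f z * cnj (c * g z)) = (\<lambda>z. cnj c * (f z * cnj (g z)))"
    by (simp add: fun_eq_iff)
  then show ?thesis unfolding L2_inner_def by simp
qed

lemma L2_inner_diff_left:
  assumes "f \<in> L2" "g \<in> L2" "k \<in> L2"
  shows "L2_inner (\<lambda>z. f z - g z) k = L2_inner f k - L2_inner g k"
  unfolding L2_inner_def using assms
  by (subst Bochner_Integration.integral_diff[symmetric])
     (auto intro!: L2_mult_integrable L2_cnj simp: algebra_simps)

text \<open>The first variation in complex form: a real quadratic polynomial in \<open>t\<close> that vanishes at \<open>0\<close> and
  is nonnegative everywhere has no linear part. Every orthogonality relation below that comes from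
  a minimum is an instance.\<close>

lemma linear_part_eq_0:
  fixes a :: complex
  assumes "\<And>t. 0 \<le> 2 * Re (cnj t * a) + (cmod t)\<^sup>2 * c"
  shows "a = 0"
proof (rule ccontr)
  assume "a \<noteq> 0"
  define s where "s = 1 / (\<bar>c\<bar> + 1)"
  have s: "s > 0" "s * \<bar>c\<bar> < 1" by (auto simp: s_def field_simps)
  have "cnj (of_real (-s) * a) * a = of_real (- s * (cmod a)\<^sup>2)"
    using complex_norm_square[of a] by (simp add: mult_ac)
  then have "0 \<le> 2 * (- s * (cmod a)\<^sup>2) + (s * cmod a)\<^sup>2 * c"
    using assms[of "of_real (-s) * a"] s
    by (metis Re_complex_of_real abs_of_pos norm_minus_cancel norm_mult norm_of_real of_real_minus)
  also have "\<dots> \<le> 2 * (- s * (cmod a)\<^sup>2) + s * (cmod a)\<^sup>2 * (s * \<bar>c\<bar>)"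
    using mult_left_mono[OF abs_ge_self[of c] zero_le_power2[of "s * cmod a"]]
    by (simp only: power2_eq_square mult_ac)
  also have "\<dots> \<le> 2 * (- s * (cmod a)\<^sup>2) + s * (cmod a)\<^sup>2 * 1"
    using s by (intro add_left_mono mult_left_mono) auto
  also have "\<dots> < 0" using s \<open>a \<noteq> 0\<close> by simp
  finally show False by simp
qed

lemma L2_Cauchy_Schwarz:
  assumes "f \<in> L2" "g \<in> L2" shows "cmod (L2_inner f g) \<le> L2_norm f * L2_norm g"
proof -
  define a where "a = L2_inner f g"
  have pos: "0 \<le> (L2_norm f)\<^sup>2 + 2 * Re (cnj t * a) + (cmod t)\<^sup>2 * (L2_norm g)\<^sup>2" for t
    using L2_norm_add_sq[OF assms(1) L2_scale[OF assms(2)], of t]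
    by (simp add: a_def L2_inner_scale_right L2_norm_scale power_mult_distrib)
       (metis zero_le_power2)
  show ?thesis
  proof (cases "L2_norm g = 0")
    case True
    have "(\<lambda>z. f z * cnj (g z)) \<in> borel_measurable circle_measure"
      using assms by (intro borel_measurable_integrable L2_mult_integrable L2_cnj)
    then have "L2_inner f g = (LINT z|circle_measure. 0)"
      unfolding L2_inner_def using True L2_norm_eq_0_iff[OF assms(2)]
      by (intro integral_cong_AE) auto
    then show ?thesis by simp
  next
    case False
    define s where "s = (L2_norm g)\<^sup>2"
    have s: "s > 0" using False by (simp add: s_def)
    have 1: "cnj (- a / of_real s) * a = of_real (- ((cmod a)\<^sup>2 / s))"
      using complex_norm_square[of a] by (simp add: mult_ac)
    have 2: "(cmod (- a / of_real s))\<^sup>2 * s = (cmod a)\<^sup>2 / s"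
      using s by (simp add: norm_divide power_divide power2_eq_square)
    have "(cmod a)\<^sup>2 / s \<le> (L2_norm f)\<^sup>2"
      using pos[of "- a / of_real s"] unfolding 1 s_def[symmetric] 2 by simp
    then have "(cmod a)\<^sup>2 \<le> (L2_norm f * L2_norm g)\<^sup>2"
      using s by (simp add: field_simps power_mult_distrib s_def)
    then show ?thesis unfolding a_def by (rule power2_le_imp_le) simp
  qed
qed

lemma L2_norm_triangle:
  assumes "f \<in> L2" "g \<in> L2" shows "L2_norm (\<lambda>z. f z + g z) \<le> L2_norm f + L2_norm g"
proof (rule power2_le_imp_le)
  have "Re (L2_inner f g) \<le> L2_norm f * L2_norm g"
    using L2_Cauchy_Schwarz[OF assms] complex_Re_le_cmod[of "L2_inner f g"] by linarith
  then show "(L2_norm (\<lambda>z. f z + g z))\<^sup>2 \<le> (L2_norm f + L2_norm g)\<^sup>2"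
    unfolding L2_norm_add_sq[OF assms] power2_sum by simp
qed simp

lemma L2_norm_triangle_diff:
  assumes "f \<in> L2" "g \<in> L2" "h \<in> L2"
  shows "L2_norm (\<lambda>z. f z - h z) \<le> L2_norm (\<lambda>z. f z - g z) + L2_norm (\<lambda>z. g z - h z)"
  using L2_norm_triangle[OF L2_diff[OF assms(1,2)] L2_diff[OF assms(2,3)]] by simp

lemma L2_norm_le_diff:
  assumes "f \<in> L2" "g \<in> L2" shows "\<bar>L2_norm f - L2_norm g\<bar> \<le> L2_norm (\<lambda>z. f z - g z)"
  using L2_norm_triangle[OF L2_diff[OF assms] assms(2)]
    L2_norm_triangle[OF L2_diff[OF assms(2,1)] assms(1)]
  by (simp add: L2_norm_minus_commute[of g f])

lemma L2_parallelogram: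
  assumes "f \<in> L2" "g \<in> L2"
  shows "(L2_norm (\<lambda>z. f z - g z))\<^sup>2
    = 2 * (L2_norm f)\<^sup>2 + 2 * (L2_norm g)\<^sup>2 - 4 * (L2_norm (\<lambda>z. (f z + g z) / 2))\<^sup>2"
proof -
  have "L2_norm (\<lambda>z. (f z + g z) / 2) = L2_norm (\<lambda>z. f z + g z) / 2"
    using L2_norm_scale[of "1/2" "\<lambda>z. f z + g z"] by simp
  then have "4 * (L2_norm (\<lambda>z. (f z + g z) / 2))\<^sup>2 = (L2_norm (\<lambda>z. f z + g z))\<^sup>2"
    by (simp only: power_divide) simp
  moreover have "L2_inner f (\<lambda>z. -1 * g z) = - L2_inner f g"
    by (subst L2_inner_scale_right) simp
  ultimately show ?thesis
    using L2_norm_add_sq[OF assms] L2_norm_add_sq[OF assms(1) L2_scale[OF assms(2)], of "-1"]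
      L2_norm_scale[of "-1" g]
    by simp
qed

lemma integral_norm_le_L2_norm:
  assumes "f \<in> L2" shows "(LINT z|circle_measure. cmod (f z)) \<le> L2_norm f"
proof -
  have "(\<lambda>z. complex_of_real (cmod (f z))) \<in> L2"
    using assms by (auto simp: L2_def)
  from L2_Cauchy_Schwarz[OF this L2_const[of 1]]
  have "cmod (LINT z|circle_measure. complex_of_real (cmod (f z))) \<le> L2_norm f"
    by (simp add: L2_inner_def L2_norm_def circle.prob_space[unfolded space_circle_measure])
  then show ?thesis by simp
qed

section \<open>Completeness and convex minimisation\<close>

text \<open>The Riesz--Fischer theorem. The limit is the pointwise limit of a subsequence, and Fatou's lemma
  turns pointwise into norm convergence.\<close>

lemma L2_Cauchy_imp_convergent:
  assumes x: "\<And>n. x n \<in> L2"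
    and Cauchy: "\<And>e. e > 0 \<Longrightarrow> \<exists>N. \<forall>m\<ge>N. \<forall>n\<ge>N. L2_norm (\<lambda>z. x m z - x n z) < e"
  obtains y where "y \<in> L2" "(\<lambda>n. L2_norm (\<lambda>z. x n z - y z)) \<longlonglongrightarrow> 0"
proof -
  note [measurable] = x[THEN L2_measurable]
  \<comment> \<open>A rapidly converging subsequence is absolutely summable almost everywhere.\<close>
  obtain N where N: "\<And>k m n. m \<ge> N k \<Longrightarrow> n \<ge> N k \<Longrightarrow> L2_norm (\<lambda>z. x m z - x n z) < (1/2::real) ^ k"
    using Cauchy[of "(1/2) ^ k" for k] by (metis zero_less_divide_1_iff zero_less_numeral zero_less_power)
  define r where "r k = (\<Sum>i\<le>k. N i)" for k
  have rN: "N k \<le> r j" if "k \<le> j" for k j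
    unfolding r_def using member_le_sum[of k "{..j}" N] that by simp
  define d where "d k z = cmod (x (r (Suc k)) z - x (r k) z)" for k z
  have [measurable]: "d k \<in> borel_measurable circle_measure" for k
    unfolding d_def by measurable
  have "(\<integral>\<^sup>+z. ennreal (d k z) \<partial>circle_measure) \<le> ennreal ((1/2) ^ k)" for k
  proof -
    have L: "(\<lambda>z. x (r (Suc k)) z - x (r k) z) \<in> L2" by (intro L2_diff x)
    have "(\<integral>\<^sup>+z. ennreal (d k z) \<partial>circle_measure) = ennreal (LINT z|circle_measure. d k z)"
      unfolding d_def by (intro nn_integral_eq_integral integrable_norm L2_integrable L) simp
    also have "\<dots> \<le> ennreal ((1/2) ^ k)"
      unfolding d_def using integral_norm_le_L2_norm[OF L] N[OF rN[of k "Suc k"] rN[of k k]]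
      by (intro ennreal_leI) simp
    finally show ?thesis .
  qed
  then have "(\<Sum>k. \<integral>\<^sup>+z. ennreal (d k z) \<partial>circle_measure) \<le> (\<Sum>k. ennreal ((1/2) ^ k))"
    by (intro suminf_le) auto
  also have "\<dots> < \<infinity>"
    by (subst suminf_ennreal2) auto
  finally have "(\<integral>\<^sup>+z. (\<Sum>k. ennreal (d k z)) \<partial>circle_measure) \<noteq> \<infinity>"
    by (subst nn_integral_suminf) auto
  then have "AE z in circle_measure. (\<Sum>k. ennreal (d k z)) \<noteq> \<infinity>"
    by (intro nn_integral_PInf_AE) auto
  then have conv: "AE z in circle_measure. convergent (\<lambda>k. x (r k) z)"
  proof eventually_elim
    case (elim z)
    have "summable (\<lambda>k. d k z)"
      using elim by (intro summable_suminf_not_top) (auto simp: d_def)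
    then have "summable (\<lambda>k. x (r (Suc k)) z - x (r k) z)"
      unfolding d_def by (rule summable_norm_cancel)
    then have "convergent (\<lambda>n. \<Sum>k<n. x (r (Suc k)) z - x (r k) z)"
      by (simp add: summable_iff_convergent)
    then have "convergent (\<lambda>n. x (r n) z - x (r 0) z)"
      using sum_lessThan_telescope[of "\<lambda>k. x (r k) z"] by simp
    then show ?case
      using convergent_add[OF _ convergent_const, of _ "x (r 0) z"] by fastforce
  qed
  define y where "y z = lim (\<lambda>k. x (r k) z)" for z
  have [measurable]: "y \<in> borel_measurable circle_measure"
    unfolding y_def by measurable
  have lim: "AE z in circle_measure. (\<lambda>k. x (r k) z) \<longlonglongrightarrow> y z"
    using conv unfolding y_def by eventually_elim (simp add: convergent_LIMSEQ_iff)
  have bound: "(\<lambda>z. x n z - y z) \<in> L2 \<and> L2_norm (\<lambda>z. x n z - y z) \<le> (1/2) ^ k" if "n \<ge> N k" for n k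
  proof -
    have "(\<integral>\<^sup>+z. ennreal ((cmod (x n z - y z))\<^sup>2) \<partial>circle_measure)
        = (\<integral>\<^sup>+z. liminf (\<lambda>j. ennreal ((cmod (x n z - x (r j) z))\<^sup>2)) \<partial>circle_measure)"
    proof (rule nn_integral_cong_AE, use lim in eventually_elim)
      case (elim z)
      have "(\<lambda>j. ennreal ((cmod (x n z - x (r j) z))\<^sup>2)) \<longlonglongrightarrow> ennreal ((cmod (x n z - y z))\<^sup>2)"
        by (intro tendsto_ennrealI tendsto_intros elim)
      from lim_imp_Liminf[OF _ this] show ?case by simp
    qed
    also have "\<dots> \<le> liminf (\<lambda>j. \<integral>\<^sup>+z. ennreal ((cmod (x n z - x (r j) z))\<^sup>2) \<partial>circle_measure)"
      by (rule nn_integral_liminf) simp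
    also have "\<dots> \<le> ennreal (((1/2) ^ k)\<^sup>2)"
    proof (rule Liminf_le)
      have "(\<integral>\<^sup>+z. ennreal ((cmod (x n z - x (r j) z))\<^sup>2) \<partial>circle_measure) \<le> ennreal (((1/2) ^ k)\<^sup>2)"
        if "j \<ge> k" for j
      proof -
        have "(\<integral>\<^sup>+z. ennreal ((cmod (x n z - x (r j) z))\<^sup>2) \<partial>circle_measure)
            = ennreal ((L2_norm (\<lambda>z. x n z - x (r j) z))\<^sup>2)"
          unfolding L2_norm_sq by (intro nn_integral_eq_integral L2_sq_integrable L2_diff x) simp
        also have "\<dots> \<le> ennreal (((1/2) ^ k)\<^sup>2)"
          using N[OF \<open>n \<ge> N k\<close> rN[OF that]] by (intro ennreal_leI power_mono) auto
        finally show ?thesis .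
      qed
      then show "eventually (\<lambda>j. (\<integral>\<^sup>+z. ennreal ((cmod (x n z - x (r j) z))\<^sup>2) \<partial>circle_measure)
          \<le> ennreal (((1/2) ^ k)\<^sup>2)) sequentially"
        by (auto simp: eventually_sequentially)
    qed simp
    finally have le: "(\<integral>\<^sup>+z. ennreal ((cmod (x n z - y z))\<^sup>2) \<partial>circle_measure) \<le> ennreal (((1/2) ^ k)\<^sup>2)" .
    then have i: "integrable circle_measure (\<lambda>z. (cmod (x n z - y z))\<^sup>2)"
      by (intro integrableI_bounded) (auto intro: le_less_trans)
    have "ennreal (LINT z|circle_measure. (cmod (x n z - y z))\<^sup>2) \<le> ennreal (((1/2) ^ k)\<^sup>2)"
      using le nn_integral_eq_integral[OF i] by simp
    then have "(L2_norm (\<lambda>z. x n z - y z))\<^sup>2 \<le> ((1/2) ^ k)\<^sup>2"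
      by (simp only: L2_norm_sq) (simp add: ennreal_le_iff)
    then show ?thesis using i by (auto simp: L2_def intro: power2_le_imp_le)
  qed
  have "y \<in> L2"
    using L2_diff[OF x[of "N 0"], of "\<lambda>z. x (N 0) z - y z"] bound[of 0 "N 0"] by simp
  moreover have "(\<lambda>n. L2_norm (\<lambda>z. x n z - y z)) \<longlonglongrightarrow> 0"
  proof (rule LIMSEQ_I)
    fix e :: real assume "e > 0"
    then obtain k where "(1/2) ^ k < e" using real_arch_pow_inv[of e "1/2"] by auto
    then show "\<exists>no. \<forall>n\<ge>no. norm (L2_norm (\<lambda>z. x n z - y z) - 0) < e"
      using bound[of k] by (intro exI[of _ "N k"]) fastforce
  qed
  ultimately show thesis by (rule that)
qed

text \<open>Closedness for the seminorm of \<open>L\<^sup>2\<close>. Such a set is saturated under almost everywhere equality in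
  \<open>L\<^sup>2\<close>, because a constant sequence converges to every function in its class.\<close>

definition L2_closed :: "(complex \<Rightarrow> complex) set \<Rightarrow> bool" where
  "L2_closed K \<longleftrightarrow> K \<subseteq> L2 \<and>
     (\<forall>x y. (\<forall>n. x n \<in> K) \<longrightarrow> y \<in> L2 \<longrightarrow> (\<lambda>n. L2_norm (\<lambda>z. x n z - y z)) \<longlonglongrightarrow> 0 \<longrightarrow> y \<in> K)"

text \<open>For closed sets this is equivalent to convexity, and midpoints are what the parallelogram law
  uses.\<close>

definition midpoint_convex :: "(complex \<Rightarrow> complex) set \<Rightarrow> bool" where
  "midpoint_convex K \<longleftrightarrow> (\<forall>x\<in>K. \<forall>y\<in>K. (\<lambda>z. (x z + y z) / 2) \<in> K)"

lemma L2_closedD: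
  assumes "L2_closed K"
  shows "x \<in> K \<Longrightarrow> x \<in> L2"
    and "(\<And>n. X n \<in> K) \<Longrightarrow> y \<in> L2 \<Longrightarrow> (\<lambda>n. L2_norm (\<lambda>z. X n z - y z)) \<longlonglongrightarrow> 0 \<Longrightarrow> y \<in> K"
proof -
  note closed = assms[unfolded L2_closed_def]
  show "x \<in> K \<Longrightarrow> x \<in> L2" using closed[THEN conjunct1] by (rule subsetD)
  show "(\<And>n. X n \<in> K) \<Longrightarrow> y \<in> L2 \<Longrightarrow> (\<lambda>n. L2_norm (\<lambda>z. X n z - y z)) \<longlonglongrightarrow> 0 \<Longrightarrow> y \<in> K"
    using closed[THEN conjunct2, rule_format, of X y] .
qed

text \<open>This replaces weak compactness of bounded closed convex sets. Almost minimal elements \<open>x n \<in> K n\<close>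
  form a Cauchy sequence: for \<open>m \<ge> n\<close> the midpoint of \<open>x n\<close> and \<open>x m\<close> is in \<open>K n\<close>, hence not much
  shorter than \<open>x n\<close>, and the parallelogram law bounds their distance.\<close>

lemma nested_L2_closed_convex:
  fixes K :: "nat \<Rightarrow> (complex \<Rightarrow> complex) set"
  assumes closed: "\<And>n. L2_closed (K n)" and convex: "\<And>n. midpoint_convex (K n)"
    and nonempty: "\<And>n. K n \<noteq> {}" and decseq: "\<And>m n. m \<le> n \<Longrightarrow> K n \<subseteq> K m"
    and bounded: "\<And>x. x \<in> K 0 \<Longrightarrow> L2_norm x \<le> R"
  obtains y where "\<And>n. y \<in> K n"
proof -
  have KL: "x \<in> K n \<Longrightarrow> x \<in> L2" for x n using closed by (auto simp: L2_closed_def)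
  \<comment> \<open>The squared distances from the origin increase and are bounded, hence converge.\<close>
  define s where "s n = (INF x\<in>K n. (L2_norm x)\<^sup>2)" for n
  have bdd: "bdd_below ((\<lambda>x. (L2_norm x)\<^sup>2) ` K n)" for n
    by (rule bdd_belowI[of _ 0]) auto
  have s_le: "s n \<le> (L2_norm x)\<^sup>2" if "x \<in> K n" for x n
    unfolding s_def by (rule cINF_lower[OF bdd that])
  have mono: "s m \<le> s n" if "m \<le> n" for m n
    unfolding s_def using decseq[OF that] by (intro cINF_superset_mono nonempty bdd) auto
  have upper: "s n \<le> R\<^sup>2" for n
  proof -
    obtain x where "x \<in> K n" using nonempty by blast
    then have "(L2_norm x)\<^sup>2 \<le> R\<^sup>2"
      using decseq[of 0 n] by (intro power_mono bounded) auto
    then show ?thesis using s_le[OF \<open>x \<in> K n\<close>] by simp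
  qed
  have "\<exists>x\<in>K n. (L2_norm x)\<^sup>2 < s n + 1 / Suc n" for n
    using cINF_less_iff[OF nonempty[of n] bdd, of "s n + 1 / Suc n"] by (simp add: s_def)
  then obtain x where x: "\<And>n. x n \<in> K n" "\<And>n. (L2_norm (x n))\<^sup>2 < s n + 1 / Suc n" by metis
  have gap: "(L2_norm (\<lambda>z. x n z - x m z))\<^sup>2 \<le> 2 * (s m - s n) + 4 * (1 / real (Suc n))" if "n \<le> m" for m n
  proof -
    have "(\<lambda>z. (x n z + x m z) / 2) \<in> K n"
      using convex x(1) decseq[OF that] unfolding midpoint_convex_def by blast
    then have "s n \<le> (L2_norm (\<lambda>z. (x n z + x m z) / 2))\<^sup>2" by (rule s_le)
    moreover have "1 / real (Suc m) \<le> 1 / real (Suc n)"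
      using that by (simp add: frac_le)
    moreover have "G \<le> 2 * (q - p) + 4 * a"
      if "p \<le> M" "b \<le> a" "G = 2 * A + 2 * B - 4 * M" "A < p + a" "B < q + b"
      for G A B M a b p q :: real using that by argo
    ultimately show ?thesis
      using L2_parallelogram[OF KL[OF x(1)] KL[OF x(1)], of n m] x(2)[of n] x(2)[of m] by blast
  qed
  have "incseq s" using mono by (simp add: incseq_def)
  then have "convergent s" using upper by (metis incseq_convergent convergentI)
  then have Cs: "Cauchy s" by (rule convergent_Cauchy)
  have C: "\<exists>N. \<forall>m\<ge>N. \<forall>n\<ge>N. L2_norm (\<lambda>z. x m z - x n z) < e" if e: "e > 0" for e
  proof -
    have e2: "e\<^sup>2 / 4 > 0" "e\<^sup>2 / 8 > 0" using e by auto
    obtain N1 where N1: "\<forall>m\<ge>N1. \<forall>n\<ge>N1. norm (s m - s n) < e\<^sup>2 / 4"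
      using CauchyD[OF Cs e2(1)] by blast
    obtain N2 where N2: "1 / real (Suc N2) < e\<^sup>2 / 8"
      using nat_approx_posE[OF e2(2)] by blast
    have "L2_norm (\<lambda>z. x n z - x m z) < e" if "n \<ge> max N1 N2" "n \<le> m" for m n
    proof (rule power2_less_imp_less)
      have "1 / real (Suc n) \<le> 1 / real (Suc N2)" using that by (simp add: frac_le)
      moreover have "s m - s n < e\<^sup>2 / 4"
        using N1[rule_format, of m n] that abs_ge_self[of "s m - s n"]
        unfolding real_norm_def by (meson le_less_trans le_trans max.boundedE)
      moreover have "G < E"
        if "a \<le> b" "q < E / 4" "b < E / 8" "G \<le> 2 * q + 4 * a" for a b q E G :: real
        using that by argo
      ultimately show "(L2_norm (\<lambda>z. x n z - x m z))\<^sup>2 < e\<^sup>2"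
        using gap[OF that(2)] N2 by blast
    qed (use e in simp)
    then show ?thesis
      by (metis L2_norm_minus_commute linorder_le_cases)
  qed
  obtain y where y: "y \<in> L2" "(\<lambda>n. L2_norm (\<lambda>z. x n z - y z)) \<longlonglongrightarrow> 0"
    using L2_Cauchy_imp_convergent[OF KL[OF x(1)] C] by blast
  have "y \<in> K n" for n
  proof (rule L2_closedD(2)[OF closed _ y(1)])
    show "x (k + n) \<in> K n" for k using x(1) decseq[of n] by (meson le_add2 subsetD)
    show "(\<lambda>k. L2_norm (\<lambda>z. x (k + n) z - y z)) \<longlonglongrightarrow> 0"
      using LIMSEQ_ignore_initial_segment[OF y(2)] .
  qed
  then show thesis by (rule that)
qed

text \<open>The sublevel sets \<open>{x \<in> C. \<Phi> x \<le> I + 1 / (n + 1)}\<close> are nested, closed, convex and bounded, and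
  a common point of them is a minimiser.\<close>

lemma L2_minimiser_exists:
  assumes closed: "L2_closed C" and convex: "midpoint_convex C" and "C \<noteq> {}"
    and nonneg: "\<And>x. 0 \<le> \<Phi> x"
    and mid: "\<And>x y. x \<in> C \<Longrightarrow> y \<in> C \<Longrightarrow> \<Phi> (\<lambda>z. (x z + y z) / 2) \<le> (\<Phi> x + \<Phi> y) / 2"
    and lipschitz: "\<And>x y. x \<in> L2 \<Longrightarrow> y \<in> L2 \<Longrightarrow> \<Phi> x - \<Phi> y \<le> c * L2_norm (\<lambda>z. x z - y z)"
    and coercive: "\<And>x. x \<in> C \<Longrightarrow> L2_norm x \<le> a + b * \<Phi> x" and "0 \<le> b"
  shows "\<exists>x\<in>C. \<forall>y\<in>C. \<Phi> x \<le> (\<Phi> y :: real)"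
proof -
  define I where "I = (INF x\<in>C. \<Phi> x)"
  have bdd: "bdd_below (\<Phi> ` C)" by (rule bdd_belowI[of _ 0]) (auto simp: nonneg)
  define K where "K n = {x \<in> C. \<Phi> x \<le> I + 1 / Suc n}" for n
  have "L2_closed (K n)" for n
    unfolding L2_closed_def
  proof (intro conjI allI impI)
    show "K n \<subseteq> L2" using closed by (auto simp: K_def L2_closed_def)
    fix x y assume x: "\<forall>i. x i \<in> K n" and y: "y \<in> L2" "(\<lambda>i. L2_norm (\<lambda>z. x i z - y z)) \<longlonglongrightarrow> 0"
    have "y \<in> C" by (rule L2_closedD(2)[OF closed _ y]) (use x in \<open>simp add: K_def\<close>)
    have "(\<lambda>i. (I + 1 / Suc n) + c * L2_norm (\<lambda>z. x i z - y z)) \<longlonglongrightarrow> (I + 1 / Suc n) + c * 0"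
      by (intro tendsto_intros y)
    moreover have "\<Phi> y \<le> (I + 1 / Suc n) + c * L2_norm (\<lambda>z. x i z - y z)" for i
    proof -
      have "x i \<in> C" "\<Phi> (x i) \<le> I + 1 / Suc n" using x by (auto simp: K_def)
      then have "\<Phi> y - \<Phi> (x i) \<le> c * L2_norm (\<lambda>z. x i z - y z)"
        using lipschitz[of y "x i"] y(1) closed
        by (auto simp: L2_closed_def L2_norm_minus_commute[of y])
      then show ?thesis using \<open>\<Phi> (x i) \<le> I + 1 / Suc n\<close> by linarith
    qed
    ultimately have "\<Phi> y \<le> I + 1 / Suc n" using LIMSEQ_le_const by fastforce
    then show "y \<in> K n" using \<open>y \<in> C\<close> by (simp add: K_def)
  qed
  moreover have "midpoint_convex (K n)" for n
    unfolding midpoint_convex_def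
  proof (intro ballI)
    fix x y assume "x \<in> K n" "y \<in> K n"
    then show "(\<lambda>z. (x z + y z) / 2) \<in> K n"
      using mid[of x y] convex unfolding K_def midpoint_convex_def by fastforce
  qed
  moreover have "K n \<noteq> {}" for n
    using cINF_less_iff[OF \<open>C \<noteq> {}\<close> bdd, of "I + 1 / Suc n"]
    by (auto simp: I_def K_def dest: less_imp_le)
  moreover have "K n \<subseteq> K m" if "m \<le> n" for m n
  proof -
    have "1 / real (Suc n) \<le> 1 / real (Suc m)" using that by (simp add: frac_le)
    then show ?thesis unfolding K_def by auto
  qed
  moreover have "L2_norm x \<le> a + b * (I + 1)" if "x \<in> K 0" for x
    using coercive[of x] mult_left_mono[OF _ \<open>0 \<le> b\<close>, of "\<Phi> x" "I + 1"] that
    by (simp add: K_def)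
  ultimately obtain x where x: "\<And>n. x \<in> K n" using nested_L2_closed_convex[of K] by metis
  have "\<Phi> x \<le> I"
  proof (rule field_le_epsilon)
    fix e :: real assume "e > 0"
    then obtain n where "1 / real (Suc n) < e" using nat_approx_posE by metis
    then show "\<Phi> x \<le> I + e" using x[of n] by (simp add: K_def)
  qed
  moreover have "I \<le> \<Phi> y" if "y \<in> C" for y unfolding I_def by (rule cINF_lower[OF bdd that])
  moreover have "x \<in> C" using x[of 0] by (simp add: K_def)
  ultimately show ?thesis by (meson order_trans)
qed

section \<open>Closed subspaces and orthogonal projection\<close>

definition L2_subspace :: "(complex \<Rightarrow> complex) set \<Rightarrow> bool" where
  "L2_subspace M \<longleftrightarrow> L2_closed M \<and> (\<lambda>z. 0) \<in> M \<and>
     (\<forall>x\<in>M. \<forall>y\<in>M. (\<lambda>z. x z + y z) \<in> M) \<and> (\<forall>x\<in>M. \<forall>c. (\<lambda>z. c * x z) \<in> M)"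

lemma L2_subspaceD:
  assumes "L2_subspace M"
  shows "L2_closed M" "M \<subseteq> L2" "(\<lambda>z. 0) \<in> M"
    "x \<in> M \<Longrightarrow> y \<in> M \<Longrightarrow> (\<lambda>z. x z + y z) \<in> M" "x \<in> M \<Longrightarrow> (\<lambda>z. c * x z) \<in> M"
    "x \<in> M \<Longrightarrow> y \<in> M \<Longrightarrow> (\<lambda>z. x z - y z) \<in> M"
proof -
  note M = assms[unfolded L2_subspace_def]
  show "L2_closed M" "M \<subseteq> L2" "(\<lambda>z. 0) \<in> M" using M by (auto simp: L2_closed_def)
  show add: "x \<in> M \<Longrightarrow> y \<in> M \<Longrightarrow> (\<lambda>z. x z + y z) \<in> M" for x y using M by blast
  show scale: "x \<in> M \<Longrightarrow> (\<lambda>z. c * x z) \<in> M" for x c using M by blast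
  show "x \<in> M \<Longrightarrow> y \<in> M \<Longrightarrow> (\<lambda>z. x z - y z) \<in> M" using add[of x "\<lambda>z. -1 * y z"] scale[of y "-1"] by simp
qed

lemma L2_subspace_midpoint_convex: "L2_subspace M \<Longrightarrow> midpoint_convex M"
  unfolding midpoint_convex_def
proof (intro ballI)
  fix x y assume "L2_subspace M" "x \<in> M" "y \<in> M"
  then show "(\<lambda>z. (x z + y z) / 2) \<in> M"
    using L2_subspaceD(5)[of M "\<lambda>z. x z + y z" "1/2"] L2_subspaceD(4)[of M x y] by simp
qed

lemma L2_projection_exists:
  assumes M: "L2_subspace M" and g: "g \<in> L2"
  shows "\<exists>h. h \<in> M \<and> (\<forall>k\<in>M. L2_inner (\<lambda>z. g z - h z) k = 0)"
proof -
  have M_L2: "x \<in> M \<Longrightarrow> x \<in> L2" for x using L2_subspaceD(2)[OF M] by blast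
  define \<Phi> where "\<Phi> x = L2_norm (\<lambda>z. g z - x z)" for x
  have mid: "\<Phi> (\<lambda>z. (x z + y z) / 2) \<le> (\<Phi> x + \<Phi> y) / 2" if "x \<in> M" "y \<in> M" for x y
  proof -
    have "\<Phi> (\<lambda>z. (x z + y z) / 2) = L2_norm (\<lambda>z. 1/2 * ((g z - x z) + (g z - y z)))"
      unfolding \<Phi>_def by (rule arg_cong[where f = L2_norm]) (simp add: field_simps)
    also have "\<dots> = L2_norm (\<lambda>z. (g z - x z) + (g z - y z)) / 2"
      using L2_norm_scale[of "1/2"] by simp
    also have "\<dots> \<le> (\<Phi> x + \<Phi> y) / 2"
      unfolding \<Phi>_def using L2_norm_triangle[OF L2_diff L2_diff, of g x g y] g that[THEN M_L2] by simp
    finally show ?thesis .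
  qed
  have lip: "\<Phi> x - \<Phi> y \<le> 1 * L2_norm (\<lambda>z. x z - y z)" if "x \<in> L2" "y \<in> L2" for x y
    using L2_norm_triangle_diff[OF g that(2,1)] L2_norm_minus_commute[of y x] by (simp add: \<Phi>_def)
  have coer: "L2_norm x \<le> L2_norm g + 1 * \<Phi> x" if "x \<in> M" for x
    using L2_norm_le_diff[OF g M_L2[OF that]] by (simp add: \<Phi>_def)
  have nonempty: "M \<noteq> {}" using L2_subspaceD(3)[OF M] by blast
  have nonneg: "0 \<le> \<Phi> x" for x by (simp add: \<Phi>_def)
  obtain h where h: "h \<in> M" "\<And>y. y \<in> M \<Longrightarrow> \<Phi> h \<le> \<Phi> y"
    using L2_minimiser_exists[OF L2_subspaceD(1)[OF M] L2_subspace_midpoint_convex[OF M]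
          nonempty nonneg mid lip coer zero_le_one] by blast
  have "L2_inner (\<lambda>z. g z - h z) k = 0" if k: "k \<in> M" for k
  proof (rule linear_part_eq_0)
    fix t :: complex
    have "(\<lambda>z. h z - t * k z) \<in> M" using M h(1) k by (intro L2_subspaceD)
    from h(2)[OF this] have "(\<Phi> h)\<^sup>2 \<le> (L2_norm (\<lambda>z. (g z - h z) + t * k z))\<^sup>2"
      unfolding \<Phi>_def by (intro power_mono) (simp_all add: algebra_simps)
    also have "\<dots> = (\<Phi> h)\<^sup>2 + 2 * Re (L2_inner (\<lambda>z. g z - h z) (\<lambda>z. t * k z)) + (L2_norm (\<lambda>z. t * k z))\<^sup>2"
      unfolding \<Phi>_def using g M_L2[OF h(1)] M_L2[OF k] by (intro L2_norm_add_sq L2_diff L2_scale)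
    finally show "0 \<le> 2 * Re (cnj t * L2_inner (\<lambda>z. g z - h z) k) + (cmod t)\<^sup>2 * (L2_norm k)\<^sup>2"
      by (simp add: L2_inner_scale_right L2_norm_scale power_mult_distrib)
  qed
  with h(1) show ?thesis by blast
qed

lemma orth_proj:
  assumes M: "L2_subspace M" and g: "g \<in> L2"
  shows orth_proj_mem: "orth_proj M g \<in> M"
    and orth_proj_orth: "k \<in> M \<Longrightarrow> L2_inner (\<lambda>z. g z - orth_proj M g z) k = 0"
  using someI_ex[OF L2_projection_exists[OF assms]] unfolding orth_proj_def by blast+

lemma orth_proj_pythagoras:
  assumes M: "L2_subspace M" and g: "g \<in> L2" and k: "k \<in> M"
  shows "(L2_norm (\<lambda>z. g z - k z))\<^sup>2
    = (L2_norm (compl_proj M g))\<^sup>2 + (L2_norm (\<lambda>z. orth_proj M g z - k z))\<^sup>2"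
proof -
  let ?p = "orth_proj M g"
  have p: "?p \<in> M" "(\<lambda>z. ?p z - k z) \<in> M" using orth_proj_mem[OF M g] k L2_subspaceD(6)[OF M] by auto
  then have L: "?p \<in> L2" "(\<lambda>z. ?p z - k z) \<in> L2" using L2_subspaceD(2)[OF M] by auto
  show ?thesis
    using L2_norm_add_sq[OF L2_diff[OF g L(1)] L(2)] orth_proj_orth[OF M g p(2)]
    by (simp add: compl_proj_def)
qed

lemma compl_proj_le:
  assumes "L2_subspace M" "g \<in> L2" "k \<in> M"
  shows "L2_norm (compl_proj M g) \<le> L2_norm (\<lambda>z. g z - k z)"
  by (rule power2_le_imp_le) (simp_all only: orth_proj_pythagoras[OF assms] L2_norm_nonneg
      zero_le_power2 le_add_same_cancel1)

lemma orth_proj_norm_le: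
  assumes M: "L2_subspace M" and g: "g \<in> L2"
  shows "L2_norm (orth_proj M g) \<le> L2_norm g"
proof (rule power2_le_imp_le)
  show "(L2_norm (orth_proj M g))\<^sup>2 \<le> (L2_norm g)\<^sup>2"
    using orth_proj_pythagoras[OF assms L2_subspaceD(3)[OF M]] by simp
qed simp

lemma orth_proj_of_mem:
  assumes M: "L2_subspace M" and g: "g \<in> M"
  shows "AE z in circle_measure. orth_proj M g z = g z"
proof -
  have L: "g \<in> L2" using g L2_subspaceD(2)[OF M] by auto
  have "(L2_norm (\<lambda>z. orth_proj M g z - g z))\<^sup>2 = 0"
    using orth_proj_pythagoras[OF M L g] zero_le_power2[of "L2_norm (compl_proj M g)"]
      zero_le_power2[of "L2_norm (\<lambda>z. orth_proj M g z - g z)"]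
    by simp
  then have "L2_norm (\<lambda>z. orth_proj M g z - g z) = 0" by simp
  moreover have "(\<lambda>z. orth_proj M g z - g z) \<in> L2"
    using orth_proj_mem[OF M L] L L2_subspaceD(2)[OF M] by (intro L2_diff) auto
  ultimately show ?thesis by (simp add: L2_norm_eq_0_iff)
qed

section \<open>Fourier coefficients determine measures on the circle\<close>

lemma measurable_continuous_on_sphere:
  assumes "continuous_on (sphere 0 1) g" "sets \<mu> = sets circle_measure"
  shows "g \<in> borel_measurable \<mu>"
  using borel_measurable_continuous_on_restrict[OF assms(1)] assms(2)
  by (simp cong: measurable_cong_sets)

lemma integrable_continuous_on_sphere:
  fixes g :: "complex \<Rightarrow> 'b::{banach, second_countable_topology}"
  assumes "continuous_on (sphere 0 1) g" "finite_measure \<mu>" "sets \<mu> = sets circle_measure"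
  shows "integrable \<mu> g"
proof -
  have "bounded (g ` sphere 0 1)"
    using assms(1) by (intro compact_imp_bounded compact_continuous_image) auto
  then obtain B where B: "\<forall>z\<in>sphere 0 1. norm (g z) \<le> B" by (auto simp: bounded_iff)
  have "space \<mu> = sphere 0 1" using sets_eq_imp_space_eq[OF assms(3)] by simp
  then show ?thesis
    using B by (intro finite_measure.integrable_const_bound[OF assms(2), of _ B]
        measurable_continuous_on_sphere assms) (auto intro!: AE_I2)
qed

text \<open>The factors \<open>z ^ n * cnj z ^ m\<close> make the property stable under multiplication of \<open>g\<close> by
  \<open>Re z\<close> and \<open>Im z\<close>, so that an induction over polynomial functions of the plane goes through.\<close>

definition equal_moments :: "complex measure \<Rightarrow> complex measure \<Rightarrow> (complex \<Rightarrow> complex) \<Rightarrow> bool" where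
  "equal_moments \<mu> \<nu> g \<longleftrightarrow>
     (\<forall>n m. (LINT z|\<mu>. g z * (z ^ n * cnj z ^ m)) = (LINT z|\<nu>. g z * (z ^ n * cnj z ^ m)))"

lemma equal_moments_polynomial:
  assumes fin: "finite_measure \<mu>" "finite_measure \<nu>"
    and sets: "sets \<mu> = sets circle_measure" "sets \<nu> = sets circle_measure"
    and p: "real_polynomial_function (p :: complex \<Rightarrow> real)"
    and "continuous_on (sphere 0 1) g" "equal_moments \<mu> \<nu> g"
  shows "equal_moments \<mu> \<nu> (\<lambda>z. complex_of_real (p z) * g z)"
  using p assms(6,7)
proof (induction arbitrary: g)
  case (linear f)
  \<comment> \<open>A real linear functional on the plane is a combination of \<open>z\<close> and \<open>cnj z\<close>.\<close>
  define a b where "a = (complex_of_real (f 1) - \<i> * of_real (f \<i>)) / 2"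
    and "b = (complex_of_real (f 1) + \<i> * of_real (f \<i>)) / 2"
  have fz: "complex_of_real (f z) = a * z + b * cnj z" for z
  proof -
    have "f z = f (Re z *\<^sub>R 1 + Im z *\<^sub>R \<i>)" by (rule arg_cong[where f = f]) (simp add: complex_eq_iff)
    also have "\<dots> = Re z * f 1 + Im z * f \<i>"
      using linear(1) by (simp add: linear_simps)
    finally show ?thesis by (simp add: a_def b_def complex_eq_iff field_simps)
  qed
  show ?case
    unfolding equal_moments_def
  proof (intro allI)
    fix n m
    have i: "integrable M (\<lambda>z. g z * (z ^ k * cnj z ^ l))"
      if "finite_measure M" "sets M = sets circle_measure" for M k l
      by (intro integrable_continuous_on_sphere that continuous_intros linear)
    have eq: "(LINT z|M. complex_of_real (f z) * g z * (z ^ n * cnj z ^ m))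
        = a * (LINT z|M. g z * (z ^ Suc n * cnj z ^ m)) + b * (LINT z|M. g z * (z ^ n * cnj z ^ Suc m))"
      if "finite_measure M" "sets M = sets circle_measure" for M
    proof -
      have "(\<lambda>z. complex_of_real (f z) * g z * (z ^ n * cnj z ^ m))
          = (\<lambda>z. a * (g z * (z ^ Suc n * cnj z ^ m)) + b * (g z * (z ^ n * cnj z ^ Suc m)))"
        unfolding fz by (simp add: fun_eq_iff algebra_simps)
      then show ?thesis
        using i[OF that, of "Suc n" m] i[OF that, of n "Suc m"]
        by (simp only: Bochner_Integration.integral_add integrable_mult_right integral_mult_right_zero)
    qed
    show "(LINT z|\<mu>. complex_of_real (f z) * g z * (z ^ n * cnj z ^ m))
        = (LINT z|\<nu>. complex_of_real (f z) * g z * (z ^ n * cnj z ^ m))"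
      unfolding eq[OF fin(1) sets(1)] eq[OF fin(2) sets(2)]
      using linear(3) unfolding equal_moments_def by (simp only:)
  qed
next
  case (const c)
  then show ?case by (simp add: equal_moments_def mult.assoc)
next
  case (add p q)
  have cont: "continuous_on (sphere 0 1) p" "continuous_on (sphere 0 1) q"
    using add(1,2) continuous_real_polymonial_function continuous_at_imp_continuous_on by blast+
  show ?case
    unfolding equal_moments_def
  proof (intro allI)
    fix n m
    have eq: "(LINT z|M. complex_of_real (p z + q z) * g z * (z ^ n * cnj z ^ m))
        = (LINT z|M. (complex_of_real (p z) * g z) * (z ^ n * cnj z ^ m))
        + (LINT z|M. (complex_of_real (q z) * g z) * (z ^ n * cnj z ^ m))"
      if "finite_measure M" "sets M = sets circle_measure" for M
    proof -
      have "(\<lambda>z. complex_of_real (p z + q z) * g z * (z ^ n * cnj z ^ m))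
        = (\<lambda>z. (complex_of_real (p z) * g z) * (z ^ n * cnj z ^ m)
            + (complex_of_real (q z) * g z) * (z ^ n * cnj z ^ m))"
        by (simp add: fun_eq_iff algebra_simps)
      moreover have "integrable M (\<lambda>z. (complex_of_real (p z) * g z) * (z ^ n * cnj z ^ m))"
        "integrable M (\<lambda>z. (complex_of_real (q z) * g z) * (z ^ n * cnj z ^ m))"
        by (intro integrable_continuous_on_sphere that continuous_intros add cont)+
      ultimately show ?thesis by (simp only: Bochner_Integration.integral_add)
    qed
    show "(LINT z|\<mu>. complex_of_real (p z + q z) * g z * (z ^ n * cnj z ^ m))
        = (LINT z|\<nu>. complex_of_real (p z + q z) * g z * (z ^ n * cnj z ^ m))"
      unfolding eq[OF fin(1) sets(1)] eq[OF fin(2) sets(2)]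
      using add(3)[OF add(5,6)] add(4)[OF add(5,6)] unfolding equal_moments_def by (simp only:)
  qed
next
  case (mult p q)
  have "continuous_on (sphere 0 1) q"
    using mult(2) continuous_real_polymonial_function continuous_at_imp_continuous_on by blast
  then have "continuous_on (sphere 0 1) (\<lambda>z. complex_of_real (q z) * g z)"
    by (intro continuous_intros mult)
  from mult(3)[OF this mult(4)[OF mult(5,6)]] show ?case by (simp add: mult.assoc)
qed

text \<open>By the Stone--Weierstrass theorem real polynomials in \<open>Re z\<close> and \<open>Im z\<close> are uniformly dense in the
  continuous functions. Only nonnegative powers occur in the hypothesis, because on the circle
  \<open>z ^ n * cnj z ^ m\<close> is a power of \<open>z\<close> or the conjugate of one.\<close>

lemma integral_continuous_eq_if_moments_eq:
  assumes fin: "finite_measure \<mu>" "finite_measure \<nu>"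
    and sets: "sets \<mu> = sets circle_measure" "sets \<nu> = sets circle_measure"
    and moments: "\<And>n. (LINT z|\<mu>. z ^ n) = (LINT z|\<nu>. z ^ n)"
    and \<phi>: "continuous_on (sphere 0 1) \<phi>"
  shows "(LINT z|\<mu>. \<phi> z :: real) = (LINT z|\<nu>. \<phi> z)"
proof -
  have space: "space \<mu> = sphere 0 1" "space \<nu> = sphere 0 1"
    using sets[THEN sets_eq_imp_space_eq] by simp_all
  have one: "equal_moments \<mu> \<nu> (\<lambda>z. 1)"
    unfolding equal_moments_def
  proof (intro allI)
    fix n m :: nat
    have red: "1 * (z ^ n * cnj z ^ m) = (if m \<le> n then z ^ (n - m) else cnj (z ^ (m - n)))"
      if "z \<in> sphere 0 1" for z :: complex
    proof -
      have "z * cnj z = 1" using that by (simp add: complex_norm_square[symmetric])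
      then have 1: "z ^ k * cnj z ^ k = 1" for k by (simp flip: power_mult_distrib)
      show ?thesis
      proof (cases "m \<le> n")
        case True
        then have "z ^ n = z ^ (n - m) * z ^ m" by (simp flip: power_add)
        then show ?thesis using True 1[of m] by (simp add: mult.assoc)
      next
        case False
        then have "cnj z ^ m = cnj z ^ (m - n) * cnj z ^ n" by (simp flip: power_add)
        then show ?thesis using False 1[of n] by (simp add: mult.left_commute)
      qed
    qed
    have "(LINT z|M. 1 * (z ^ n * cnj z ^ m))
        = (if m \<le> n then LINT z|M. z ^ (n - m) else cnj (LINT z|M. z ^ (m - n)))"
      if "space M = sphere 0 1" for M :: "complex measure"
    proof -
      have "(LINT z|M. 1 * (z ^ n * cnj z ^ m))
          = (LINT z|M. (if m \<le> n then z ^ (n - m) else cnj (z ^ (m - n))))"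
        using red that by (intro Bochner_Integration.integral_cong) auto
      then show ?thesis
        by (cases "m \<le> n") (simp_all add: Bochner_Integration.integral_cnj[of M "\<lambda>z. z ^ (m - n)", unfolded complex_cnj_power])
    qed
    then show "(LINT z|\<mu>. 1 * (z ^ n * cnj z ^ m)) = (LINT z|\<nu>. 1 * (z ^ n * cnj z ^ m))"
      using moments space by (simp only:)
  qed
  have poly: "(LINT z|\<mu>. g z) = (LINT z|\<nu>. g z)" if "real_polynomial_function g" for g
  proof -
    have "equal_moments \<mu> \<nu> (\<lambda>z. complex_of_real (g z) * 1)"
      by (rule equal_moments_polynomial[OF fin sets that continuous_on_const one])
    then have "(LINT z|\<mu>. complex_of_real (g z) * 1 * (z ^ 0 * cnj z ^ 0))
        = (LINT z|\<nu>. complex_of_real (g z) * 1 * (z ^ 0 * cnj z ^ 0))"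
      unfolding equal_moments_def by blast
    then show ?thesis by simp
  qed
  define S where "S = measure \<mu> (space \<mu>) + measure \<nu> (space \<nu>)"
  have "\<bar>(LINT z|\<mu>. \<phi> z) - (LINT z|\<nu>. \<phi> z)\<bar> \<le> e * S" if e: "e > 0" for e
  proof -
    obtain g where g: "real_polynomial_function g" "\<And>x. x \<in> sphere 0 1 \<Longrightarrow> \<bar>\<phi> x - g x\<bar> < e"
      using Stone_Weierstrass_real_polynomial_function[OF compact_sphere \<phi> e] by blast
    have cg: "continuous_on (sphere 0 1) g"
      using g(1) continuous_real_polymonial_function continuous_at_imp_continuous_on by blast
    have "\<bar>(LINT z|M. \<phi> z) - (LINT z|M. g z)\<bar> \<le> e * measure M (space M)"
      if M: "finite_measure M" "sets M = sets circle_measure" "space M = sphere 0 1" for M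
    proof -
      have i: "integrable M \<phi>" "integrable M g"
        by (intro integrable_continuous_on_sphere M \<phi> cg)+
      have "\<bar>(LINT z|M. \<phi> z) - (LINT z|M. g z)\<bar> = \<bar>LINT z|M. \<phi> z - g z\<bar>"
        using i by simp
      also have "\<dots> \<le> (LINT z|M. \<bar>\<phi> z - g z\<bar>)" by (rule integral_abs_bound)
      also have "\<dots> \<le> (LINT z|M. e)"
        using i g(2) M(3)
        by (intro integral_mono integrable_abs Bochner_Integration.integrable_diff
            finite_measure.integrable_const[OF M(1)]) (auto intro: less_imp_le)
      finally show ?thesis by (simp add: mult.commute)
    qed
    from this[OF fin(1) sets(1) space(1)] this[OF fin(2) sets(2) space(2)]
    show ?thesis using poly[OF g(1)] by (simp add: S_def algebra_simps abs_le_iff)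
  qed
  then have "(LINT z|\<mu>. \<phi> z) - (LINT z|\<nu>. \<phi> z) = 0"
  proof -
    assume *: "\<And>e. e > 0 \<Longrightarrow> \<bar>(LINT z|\<mu>. \<phi> z) - (LINT z|\<nu>. \<phi> z)\<bar> \<le> e * S"
    have S: "S \<ge> 0" by (simp add: S_def)
    have "\<bar>(LINT z|\<mu>. \<phi> z) - (LINT z|\<nu>. \<phi> z)\<bar> \<le> 0 + d" if "d > 0" for d
    proof -
      have "\<bar>(LINT z|\<mu>. \<phi> z) - (LINT z|\<nu>. \<phi> z)\<bar> \<le> d / (S + 1) * S"
        using that S by (intro *) simp
      also have "\<dots> \<le> d" using that S by (simp add: field_simps)
      finally show ?thesis by simp
    qed
    then have "\<bar>(LINT z|\<mu>. \<phi> z) - (LINT z|\<nu>. \<phi> z)\<bar> \<le> 0" by (rule field_le_epsilon)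
    then show ?thesis by simp
  qed
  then show ?thesis by simp
qed

text \<open>The indicator of a closed set is a decreasing limit of continuous functions, and the closed sets
  are a generator of the Borel sets that is stable under intersection.\<close>

lemma circle_measures_eqI:
  assumes fin: "finite_measure \<mu>" "finite_measure \<nu>"
    and sets: "sets \<mu> = sets circle_measure" "sets \<nu> = sets circle_measure"
    and moments: "\<And>n. (LINT z|\<mu>. z ^ n) = (LINT z|\<nu>. z ^ n)"
  shows "\<mu> = \<nu>"
proof -
  have space: "space \<mu> = sphere 0 1" "space \<nu> = sphere 0 1"
    using sets[THEN sets_eq_imp_space_eq] by simp_all
  have id: "(\<lambda>z. z) \<in> measurable M borel" if "sets M = sets circle_measure" for M :: "complex measure"
    by (rule measurable_continuous_on_sphere[OF continuous_on_id that])
  have closed_eq: "measure \<mu> (K \<inter> sphere 0 1) = measure \<nu> (K \<inter> sphere 0 1)"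
    if K: "closed K" "K \<noteq> {}" for K
  proof -
    define \<phi> where "\<phi> n z = max 0 (1 - real n * infdist z K)" for n z
    have cont: "continuous_on (sphere 0 1) (\<phi> n)" for n
      unfolding \<phi>_def by (intro continuous_intros)
    have lim: "(\<lambda>n. \<phi> n z) \<longlonglongrightarrow> indicator K z" for z
    proof (cases "z \<in> K")
      case True
      then show ?thesis by (simp add: \<phi>_def)
    next
      case False
      then have d: "infdist z K > 0"
        using K in_closed_iff_infdist_zero[of K z] infdist_nonneg[of z K] by (auto simp: less_le)
      obtain N where N: "1 < real N * infdist z K" using reals_Archimedean3[OF d] by blast
      have "\<phi> n z = 0" if "n \<ge> N" for n
      proof -
        have "real N * infdist z K \<le> real n * infdist z K" using d that by simp
        then show ?thesis using N by (simp add: \<phi>_def)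
      qed
      then show ?thesis using False by (auto intro!: tendsto_eventually eventually_sequentiallyI)
    qed
    have conv: "(\<lambda>n. LINT z|M. \<phi> n z) \<longlonglongrightarrow> measure M (K \<inter> sphere 0 1)"
      if M: "finite_measure M" "sets M = sets circle_measure" "space M = sphere 0 1" for M
    proof -
      have "(\<lambda>n. LINT z|M. \<phi> n z) \<longlonglongrightarrow> (LINT z|M. indicator K z)"
      proof (rule integral_dominated_convergence[where w = "\<lambda>_. 1"])
        show "indicat_real K \<in> borel_measurable M"
          by (rule measurable_compose[OF id[OF M(2)]]) (use K in simp)
        show "\<phi> n \<in> borel_measurable M" for n
          by (rule measurable_continuous_on_sphere[OF cont M(2)])
        show "integrable M (\<lambda>_. 1 :: real)" by (rule finite_measure.integrable_const[OF M(1)])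
        show "AE x in M. norm (\<phi> n x) \<le> 1" for n
          by (intro AE_I2) (simp add: \<phi>_def infdist_nonneg)
      qed (use lim in simp)
      moreover have "(LINT z|M. indicator K z) = measure M (K \<inter> sphere 0 1)"
        using M(3) by simp
      ultimately show ?thesis by simp
    qed
    have "(\<lambda>n. LINT z|\<mu>. \<phi> n z) = (\<lambda>n. LINT z|\<nu>. \<phi> n z)"
      using integral_continuous_eq_if_moments_eq[OF fin sets moments cont] by simp
    then show ?thesis
      using conv[OF fin(1) sets(1) space(1)] conv[OF fin(2) sets(2) space(2)] LIMSEQ_unique by metis
  qed
  have "distr \<mu> borel (\<lambda>z. z) = distr \<nu> borel (\<lambda>z. z)"
  proof (rule measure_eqI_generator_eq[of "Collect closed" UNIV _ _ "\<lambda>_. UNIV"])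
    show "Int_stable (Collect closed :: complex set set)" by (auto simp: Int_stable_def)
    show "emeasure (distr \<mu> borel (\<lambda>z. z)) X = emeasure (distr \<nu> borel (\<lambda>z. z)) X"
      if "X \<in> Collect closed" for X
      using that closed_eq[of X] id[OF sets(1)] id[OF sets(2)] space
        finite_measure.emeasure_eq_measure[OF fin(1)] finite_measure.emeasure_eq_measure[OF fin(2)]
      by (cases "X = {}") (auto simp: emeasure_distr)
    show "sets (distr \<mu> borel (\<lambda>z. z)) = sigma_sets UNIV (Collect closed)"
      "sets (distr \<nu> borel (\<lambda>z. z)) = sigma_sets UNIV (Collect closed)"
      by (simp_all add: borel_eq_closed)
    show "emeasure (distr \<mu> borel (\<lambda>z. z)) UNIV \<noteq> \<infinity>"
      using id[OF sets(1)] finite_measure.emeasure_finite[OF fin(1)] by (simp add: emeasure_distr)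
  qed auto
  note eq = this
  show ?thesis
  proof (rule measure_eqI)
    fix A assume A: "A \<in> sets \<mu>"
    then have "A \<in> sets borel" "A \<subseteq> sphere 0 1"
      using sets(1) by (auto simp: sets_restrict_space_iff)
    then show "emeasure \<mu> A = emeasure \<nu> A"
      using arg_cong[OF eq, of "\<lambda>M. emeasure M A"] id[OF sets(1)] id[OF sets(2)] space
      by (simp add: emeasure_distr Int_absorb2)
  qed (use sets in simp)
qed

lemma finite_measure_circle_density:
  assumes "integrable circle_measure v" "\<And>z. 0 \<le> v z"
  shows "finite_measure (density circle_measure (\<lambda>z. ennreal (v z)))"
proof (rule finite_measureI)
  have "(\<integral>\<^sup>+z. ennreal (v z) \<partial>circle_measure) \<noteq> \<infinity>"
    using nn_integral_eq_integral[OF assms(1)] assms(2) by simp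
  moreover have "(\<integral>\<^sup>+z. ennreal (v z) * indicator (space circle_measure) z \<partial>circle_measure)
      = (\<integral>\<^sup>+z. ennreal (v z) \<partial>circle_measure)"
    by (intro nn_integral_cong) simp
  moreover have "v \<in> borel_measurable circle_measure" using assms(1) by simp
  ultimately show "emeasure (density circle_measure (\<lambda>z. ennreal (v z)))
      (space (density circle_measure (\<lambda>z. ennreal (v z)))) \<noteq> \<infinity>"
    unfolding space_density
    by (subst emeasure_density) (auto simp del: space_circle_measure sets_circle_measure)
qed

text \<open>The positive and the negative part of \<open>u\<close> are densities of measures with equal moments.\<close>

lemma real_fourier_unique:
  fixes u :: "complex \<Rightarrow> real"
  assumes u: "integrable circle_measure u"
    and zero: "\<And>n. (LINT z|circle_measure. of_real (u z) * z ^ n) = 0"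
  shows "AE z in circle_measure. u z = 0"
proof -
  have [measurable]: "u \<in> borel_measurable circle_measure" using u by simp
  have meas_pow [measurable]: "(\<lambda>z. z ^ n) \<in> borel_measurable circle_measure" for n
    by (rule measurable_continuous_on_sphere) (auto intro!: continuous_intros)
  define p q where "p z = max 0 (u z)" and "q z = max 0 (- u z)" for z
  have [measurable]: "p \<in> borel_measurable circle_measure" "q \<in> borel_measurable circle_measure"
    unfolding p_def q_def by measurable
  have ip: "integrable circle_measure p" "integrable circle_measure q"
    by (rule Bochner_Integration.integrable_bound[OF u]; auto intro!: AE_I2 simp: p_def q_def)+
  have nn: "0 \<le> p z" "0 \<le> q z" for z by (simp_all add: p_def q_def)
  note fin = finite_measure_circle_density
  have "density circle_measure (\<lambda>z. ennreal (p z)) = density circle_measure (\<lambda>z. ennreal (q z))"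
  proof (rule circle_measures_eqI)
    fix n
    have i: "integrable circle_measure (\<lambda>z. of_real (v z) * z ^ n)"
      if "integrable circle_measure v" for v :: "complex \<Rightarrow> real"
    proof (rule Bochner_Integration.integrable_bound[OF that])
      show "(\<lambda>z. of_real (v z) * z ^ n) \<in> borel_measurable circle_measure"
        using that by simp
      show "AE z in circle_measure. norm (of_real (v z) * z ^ n) \<le> norm (v z)"
        by (rule AE_I2) (simp add: norm_mult norm_power)
    qed
    have d: "(LINT z|density circle_measure (\<lambda>z. ennreal (v z)). z ^ n)
        = (LINT z|circle_measure. of_real (v z) * z ^ n)"
      if "integrable circle_measure v" "\<And>z. 0 \<le> v z" for v
      using that by (subst integral_density) (auto simp: scaleR_conv_of_real)
    have "(LINT z|circle_measure. of_real (p z) * z ^ n) - (LINT z|circle_measure. of_real (q z) * z ^ n)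
        = (LINT z|circle_measure. of_real (p z) * z ^ n - of_real (q z) * z ^ n)"
      using i[OF ip(1)] i[OF ip(2)] by simp
    also have "\<dots> = (LINT z|circle_measure. of_real (u z) * z ^ n)"
      by (intro Bochner_Integration.integral_cong) (auto simp: p_def q_def max_def)
    finally show "(LINT z|density circle_measure (\<lambda>z. ennreal (p z)). z ^ n)
        = (LINT z|density circle_measure (\<lambda>z. ennreal (q z)). z ^ n)"
      using zero d[OF ip(1) nn(1)] d[OF ip(2) nn(2)] by simp
  qed (use fin ip nn in auto)
  then have "AE z in circle_measure. ennreal (p z) = ennreal (q z)"
    by (subst (asm) circle.density_unique_iff) auto
  then show ?thesis
    by eventually_elim (auto simp: p_def q_def max_def split: if_splits)
qed

lemma fourier_unique:
  assumes f: "integrable circle_measure f"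
    and zero: "\<And>n. (LINT z|circle_measure. f z * z ^ n) = 0"
      "\<And>n. (LINT z|circle_measure. f z * cnj z ^ n) = 0"
  shows "AE z in circle_measure. f z = 0"
proof -
  have [measurable]: "f \<in> borel_measurable circle_measure" using f by simp
  have meas_pow [measurable]: "(\<lambda>z. z ^ n) \<in> borel_measurable circle_measure" for n
    by (rule measurable_continuous_on_sphere) (auto intro!: continuous_intros)
  have [measurable]: "(\<lambda>z. cnj (f z)) \<in> borel_measurable circle_measure"
    by (rule measurable_compose[of f, OF _ borel_measurable_continuous_onI]) (auto intro!: continuous_intros)
  have i: "integrable circle_measure (\<lambda>z. f z * z ^ n)"
    "integrable circle_measure (\<lambda>z. cnj (f z) * z ^ n)" for n
    by (rule Bochner_Integration.integrable_bound[OF f];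
        auto intro!: AE_I2 simp: norm_mult norm_power)+
  have cz: "(LINT z|circle_measure. cnj (f z) * z ^ n) = 0" for n
  proof -
    have "(LINT z|circle_measure. cnj (f z) * z ^ n) = (LINT z|circle_measure. cnj (f z * cnj z ^ n))"
      by simp
    also have "\<dots> = cnj (LINT z|circle_measure. f z * cnj z ^ n)" by (rule Bochner_Integration.integral_cnj)
    finally show ?thesis using zero(2) by simp
  qed
  have re: "AE z in circle_measure. Re (f z) = 0"
  proof (rule real_fourier_unique)
    show "integrable circle_measure (\<lambda>z. Re (f z))" using f by simp
    fix n
    have "(\<lambda>z. complex_of_real (Re (f z)) * z ^ n) = (\<lambda>z. 1/2 * (f z * z ^ n + cnj (f z) * z ^ n))"
      by (simp add: fun_eq_iff complex_add_cnj flip: distrib_right)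
    then show "(LINT z|circle_measure. complex_of_real (Re (f z)) * z ^ n) = 0"
      using i zero(1) cz by (simp only: Bochner_Integration.integral_add integral_mult_right_zero) simp
  qed
  have im: "AE z in circle_measure. Im (f z) = 0"
  proof (rule real_fourier_unique)
    show "integrable circle_measure (\<lambda>z. Im (f z))" using f by simp
    fix n
    have "complex_of_real (Im w) * y = - \<i> / 2 * (w * y - cnj w * y)" for w y
      by (simp add: complex_eq_iff)
    then have "(\<lambda>z. complex_of_real (Im (f z)) * z ^ n) = (\<lambda>z. - \<i> / 2 * (f z * z ^ n - cnj (f z) * z ^ n))"
      by (simp only:)
    then show "(LINT z|circle_measure. complex_of_real (Im (f z)) * z ^ n) = 0"
      using i zero(1) cz by (simp only: Bochner_Integration.integral_diff integral_mult_right_zero) simp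
  qed
  from re im show ?thesis by eventually_elim (simp add: complex_eq_iff)
qed

section \<open>Integral formulas on the circle\<close>

lemma circle_integral_continuous:
  assumes "continuous_on (sphere 0 1) F"
  shows "(LINT z|circle_measure. F z) = (1 / (2 * pi)) *\<^sub>R integral {0..2 * pi} (\<lambda>t. F (cis t) :: complex)"
proof -
  let ?A = "{0..2 * pi}"
  have [measurable]: "cis \<in> uniform_measure lborel ?A \<rightarrow>\<^sub>M restrict_space borel (sphere 0 1)"
    by (intro measurable_restrict_space2)
      (auto simp: measurable_cong_sets[OF sets_uniform_measure] intro!: borel_measurable_continuous_onI
        continuous_intros)
  have F: "F \<in> borel_measurable (restrict_space borel (sphere 0 1))"
    by (rule borel_measurable_continuous_on_restrict[OF assms])
  have cF: "continuous_on UNIV (\<lambda>t. F (cis t))"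
    by (rule continuous_on_compose2[OF assms]) (auto intro!: continuous_intros)
  then have [measurable]: "(\<lambda>t. F (cis t)) \<in> borel_measurable borel"
    by (rule borel_measurable_continuous_onI)
  have U: "uniform_measure lborel ?A = density lborel (\<lambda>t. ennreal (indicator ?A t / (2 * pi)))"
    unfolding uniform_measure_def
    by (intro density_cong) (auto simp: divide_ennreal[symmetric] split: split_indicator)
  have "(LINT z|circle_measure. F z) = (LINT t|uniform_measure lborel ?A. F (cis t))"
    unfolding circle_measure_def by (rule integral_distr) (use F in auto)
  also have "\<dots> = (LINT t|lborel. (indicator ?A t / (2 * pi)) *\<^sub>R F (cis t))"
    unfolding U by (rule integral_density) auto
  also have "\<dots> = (1 / (2 * pi)) *\<^sub>R (LINT t:?A|lborel. F (cis t))"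
    unfolding set_lebesgue_integral_def by (simp flip: integral_scaleR_right)
  also have "(LINT t:?A|lborel. F (cis t)) = integral ?A (\<lambda>t. F (cis t))"
    by (intro set_borel_integral_eq_integral(2) borel_integrable_atLeastAtMost'
        continuous_on_subset[OF cF]) auto
  finally show ?thesis .
qed

text \<open>Cauchy's formula with \<open>d\<zeta> = 2 \<pi> \<i> \<zeta> dm\<close> on the circle.\<close>

lemma cauchy_circle:
  assumes cont: "continuous_on (cball 0 1) \<phi>" and hol: "\<phi> holomorphic_on ball 0 1" and a: "cmod a < 1"
  shows "(LINT z|circle_measure. \<phi> z * (z / (z - a))) = \<phi> a"
proof -
  have ne: "z - a \<noteq> 0" if "z \<in> sphere 0 1" for z using that a by auto
  have "((\<lambda>u. \<phi> u / (u - a)) has_contour_integral (2 * of_real pi * \<i> * \<phi> a)) (circlepath 0 1)"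
    using Cauchy_integral_circlepath[OF cont hol, of a] a by simp
  then have "((\<lambda>t. \<phi> (cis t) / (cis t - a) * \<i> * cis t) has_integral 2 * of_real pi * \<i> * \<phi> a) {0..2 * pi}"
    unfolding circlepath_def by (subst (asm) has_contour_integral_part_circlepath_iff) auto
  then have "((\<lambda>t. - \<i> * (\<phi> (cis t) / (cis t - a) * \<i> * cis t)) has_integral
      (- \<i> * (2 * of_real pi * \<i> * \<phi> a))) {0..2 * pi}"
    by (rule has_integral_mult_right)
  moreover have "- \<i> * (x * \<i> * y) = x * y" for x y by (simp add: complex_eq_iff)
  then have "(\<lambda>t. - \<i> * (\<phi> (cis t) / (cis t - a) * \<i> * cis t)) = (\<lambda>t. \<phi> (cis t) * (cis t / (cis t - a)))"
    by (simp only:) (simp add: fun_eq_iff)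
  moreover have "- \<i> * (2 * of_real pi * \<i> * \<phi> a) = of_real (2 * pi) * \<phi> a" by simp
  ultimately have "integral {0..2 * pi} (\<lambda>t. \<phi> (cis t) * (cis t / (cis t - a))) = of_real (2 * pi) * \<phi> a"
    by (metis integral_unique)
  moreover have "continuous_on (sphere 0 1) (\<lambda>z. \<phi> z * (z / (z - a)))"
    using ne by (intro continuous_intros continuous_on_subset[OF cont]) auto
  ultimately show ?thesis
    by (simp add: circle_integral_continuous scaleR_conv_of_real)
qed

lemma mean_value_circle:
  assumes "continuous_on (cball 0 1) \<phi>" "\<phi> holomorphic_on ball 0 1"
  shows "(LINT z|circle_measure. \<phi> z) = \<phi> 0"
proof -
  have "(LINT z|circle_measure. \<phi> z) = (LINT z|circle_measure. \<phi> z * (z / (z - 0)))"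
    by (intro Bochner_Integration.integral_cong) auto
  then show ?thesis using cauchy_circle[OF assms, of 0] by simp
qed

section \<open>Composition with automorphisms\<close>

text \<open>Inner functions that extend continuously to the closed disk.\<close>

definition inner_map :: "(complex \<Rightarrow> complex) \<Rightarrow> bool" where
  "inner_map \<gamma> \<longleftrightarrow> continuous_on (cball 0 1) \<gamma> \<and> \<gamma> holomorphic_on ball 0 1 \<and>
     \<gamma> ` ball 0 1 \<subseteq> ball 0 1 \<and> \<gamma> ` sphere 0 1 \<subseteq> sphere 0 1"

lemma fuchsian_inner_map:
  assumes "fuchsian \<Gamma>" "\<gamma> \<in> \<Gamma>" shows "inner_map \<gamma>"
proof -
  have "disk_automorphism \<gamma>" using assms by (auto simp: fuchsian_def)
  then obtain a b c d where ball: "\<gamma> ` ball 0 1 = ball 0 1"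
    and \<gamma>: "\<And>z. z \<in> cball 0 1 \<Longrightarrow> c * z + d \<noteq> 0 \<and> \<gamma> z = (a * z + b) / (c * z + d)"
    unfolding disk_automorphism_def by blast
  have "continuous_on (cball 0 1) (\<lambda>z. (a * z + b) / (c * z + d))"
    using \<gamma> by (intro continuous_intros) blast
  then have 1: "continuous_on (cball 0 1) \<gamma>"
    by (rule continuous_on_eq) (simp add: \<gamma>)
  have "c * z + d \<noteq> 0" if "z \<in> ball 0 1" for z using \<gamma>[of z] that by auto
  then have "(\<lambda>z. (a * z + b) / (c * z + d)) holomorphic_on ball 0 1"
    by (intro holomorphic_intros) blast
  then have 2: "\<gamma> holomorphic_on ball 0 1"
    by (rule holomorphic_transform) (use \<gamma> in force)
  show ?thesis
    unfolding inner_map_def using 1 2 ball fuchsian_maps_sphere[OF assms] by blast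
qed

lemma inner_map_measurable:
  assumes "inner_map \<gamma>" shows "\<gamma> \<in> circle_measure \<rightarrow>\<^sub>M circle_measure"
proof -
  have "continuous_on (sphere 0 1) \<gamma>"
    using assms by (auto simp: inner_map_def elim: continuous_on_subset)
  then have "\<gamma> \<in> restrict_space borel (sphere 0 1) \<rightarrow>\<^sub>M restrict_space borel (sphere 0 1)"
    using assms by (intro measurable_restrict_space2 borel_measurable_continuous_on_restrict)
      (auto simp: inner_map_def space_restrict_space)
  then show ?thesis by (simp cong: measurable_cong_sets)
qed

definition poisson_kernel :: "complex \<Rightarrow> complex \<Rightarrow> real" where
  "poisson_kernel a z = (1 - (cmod a)\<^sup>2) / (cmod (z - a))\<^sup>2"

lemma poisson_kernel_nonneg: "cmod a < 1 \<Longrightarrow> 0 \<le> poisson_kernel a z"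
  using power_mono[of "cmod a" 1 2] by (simp add: poisson_kernel_def)

lemma poisson_kernel_le:
  assumes "cmod a < 1" "z \<in> sphere 0 1"
  shows "poisson_kernel a z \<le> (1 + cmod a) / (1 - cmod a)"
proof -
  have "1 - cmod a \<le> cmod (z - a)" using norm_triangle_ineq2[of z a] assms(2) by simp
  then have "(1 - cmod a)\<^sup>2 \<le> (cmod (z - a))\<^sup>2" using assms(1) by (intro power_mono) auto
  then have "poisson_kernel a z \<le> (1 - (cmod a)\<^sup>2) / (1 - cmod a)\<^sup>2"
    unfolding poisson_kernel_def using assms(1) power_mono[of "cmod a" 1 2]
    by (intro divide_left_mono mult_pos_pos) auto
  also have "\<dots> = (1 + cmod a) / (1 - cmod a)"
    using assms(1) by (simp add: power2_eq_square divide_simps) (simp add: algebra_simps)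
  finally show ?thesis .
qed

text \<open>The decomposition of the Poisson kernel into an analytic and an antianalytic part; its moments
  can be read off from it.\<close>

lemma poisson_kernel_eq:
  assumes a: "cmod a < 1" and z: "z \<in> sphere 0 1"
  shows "complex_of_real (poisson_kernel a z) = z / (z - a) + 1 / (1 - cnj a * z) - 1"
proof -
  have zz: "z * cnj z = 1" using z by (simp add: complex_norm_square[symmetric])
  have n1: "z - a \<noteq> 0" using a z by auto
  then have n2: "cnj z - cnj a \<noteq> 0" by (metis complex_cnj_diff complex_cnj_zero_iff)
  have z0: "z \<noteq> 0" using z by auto
  have "z * (cnj z - cnj a) = 1 - cnj a * z" using zz by (simp add: algebra_simps)
  then have n3: "1 - cnj a * z \<noteq> 0" and e: "cnj z - cnj a = (1 - cnj a * z) / z"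
    using n2 z0 mult_eq_0_iff[of z "cnj z - cnj a"] nonzero_mult_div_cancel_left[OF z0] by metis+
  have "complex_of_real (poisson_kernel a z) = (1 - a * cnj a) / ((z - a) * (cnj z - cnj a))"
    unfolding poisson_kernel_def by (simp only: of_real_divide of_real_diff
        complex_norm_square complex_cnj_diff of_real_1)
  also have "\<dots> = (1 - a * cnj a) * z / ((z - a) * (1 - cnj a * z))"
    unfolding e using z0 by simp
  also have "\<dots> = z / (z - a) + 1 / (1 - cnj a * z) - 1"
    using n1 n3 by (simp add: divide_simps) (simp add: algebra_simps)
  finally show ?thesis .
qed

lemma poisson_kernel_continuous:
  assumes "cmod a < 1" shows "continuous_on (sphere 0 1) (poisson_kernel a)"
  unfolding poisson_kernel_def using assms by (intro continuous_intros) auto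

lemma poisson_kernel_moment:
  assumes a: "cmod a < 1"
  shows "(LINT z|circle_measure. of_real (poisson_kernel a z) * z ^ n) = a ^ n"
proof -
  have n1: "z - a \<noteq> 0" if "z \<in> sphere 0 1" for z using a that by auto
  have n2: "1 - cnj a * z \<noteq> 0" if "z \<in> cball 0 1" for z
  proof
    assume "1 - cnj a * z = 0"
    then have "cmod (cnj a * z) = 1" by (metis eq_iff_diff_eq_0 norm_one)
    moreover have "cmod (cnj a * z) \<le> cmod a * 1"
      unfolding norm_mult using that by (intro mult_mono) auto
    ultimately show False using a by simp
  qed
  have c: "continuous_on (sphere 0 1) (\<lambda>z. z ^ n * (z / (z - a)))"
    "continuous_on (sphere 0 1) (\<lambda>z. z ^ n / (1 - cnj a * z))"
    "continuous_on (sphere 0 1) (\<lambda>z. z ^ n :: complex)"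
    using n1 n2 by (auto intro!: continuous_intros)
  have fm: "finite_measure circle_measure" by unfold_locales
  note i = c[THEN integrable_continuous_on_sphere[OF _ fm refl]]
  have "(LINT z|circle_measure. of_real (poisson_kernel a z) * z ^ n)
      = (LINT z|circle_measure. z ^ n * (z / (z - a)) + z ^ n / (1 - cnj a * z) - z ^ n)"
    by (intro Bochner_Integration.integral_cong) (auto simp: poisson_kernel_eq[OF a] algebra_simps)
  also have "\<dots> = (LINT z|circle_measure. z ^ n * (z / (z - a)))
      + (LINT z|circle_measure. z ^ n / (1 - cnj a * z)) - (LINT z|circle_measure. z ^ n)"
    using i by simp
  also have "(LINT z|circle_measure. z ^ n * (z / (z - a))) = a ^ n"
    by (rule cauchy_circle) (use a in \<open>auto intro!: continuous_intros holomorphic_intros\<close>)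
  also have "(LINT z|circle_measure. z ^ n / (1 - cnj a * z)) = 0 ^ n / (1 - cnj a * 0)"
    using n2 by (intro mean_value_circle continuous_intros holomorphic_intros) auto
  also have "(LINT z|circle_measure. z ^ n) = (0 :: complex) ^ n"
    by (intro mean_value_circle continuous_intros holomorphic_intros)
  finally show ?thesis by simp
qed

text \<open>Both sides have \<open>n\<close>-th moment \<open>\<gamma> 0 ^ n\<close>: on the left by the mean value property of \<open>\<gamma> ^ n\<close>, on
  the right by the reproducing property of the Poisson kernel.\<close>

lemma distr_inner_map:
  assumes \<gamma>: "inner_map \<gamma>"
  shows "distr circle_measure circle_measure \<gamma>
    = density circle_measure (\<lambda>z. ennreal (poisson_kernel (\<gamma> 0) z))"
proof (rule circle_measures_eqI)
  note [measurable] = inner_map_measurable[OF \<gamma>]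
  have \<gamma>0: "cmod (\<gamma> 0) < 1" using \<gamma> by (auto simp: inner_map_def image_subset_iff)
  have fm: "finite_measure circle_measure" by unfold_locales
  have ip: "integrable circle_measure (poisson_kernel (\<gamma> 0))"
    by (rule integrable_continuous_on_sphere[OF poisson_kernel_continuous[OF \<gamma>0] fm refl])
  have powm: "(\<lambda>z. z ^ n) \<in> borel_measurable circle_measure" for n
    by (rule measurable_continuous_on_sphere) (auto intro!: continuous_intros)
  show "finite_measure (distr circle_measure circle_measure \<gamma>)"
    by (rule finite_measure.finite_measure_distr[OF fm]) measurable
  show "finite_measure (density circle_measure (\<lambda>z. ennreal (poisson_kernel (\<gamma> 0) z)))"
    by (rule finite_measure_circle_density[OF ip poisson_kernel_nonneg[OF \<gamma>0]])
  fix n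
  have "(LINT z|distr circle_measure circle_measure \<gamma>. z ^ n) = (LINT z|circle_measure. \<gamma> z ^ n)"
    by (rule integral_distr) (use powm in measurable)
  also have "\<dots> = \<gamma> 0 ^ n"
    using \<gamma> by (intro mean_value_circle continuous_intros holomorphic_intros) (auto simp: inner_map_def)
  also have "\<dots> = (LINT z|density circle_measure (\<lambda>z. ennreal (poisson_kernel (\<gamma> 0) z)). z ^ n)"
    using powm ip poisson_kernel_nonneg[OF \<gamma>0]
    by (subst integral_density) (auto simp: scaleR_conv_of_real poisson_kernel_moment[OF \<gamma>0])
  finally show "(LINT z|distr circle_measure circle_measure \<gamma>. z ^ n)
      = (LINT z|density circle_measure (\<lambda>z. ennreal (poisson_kernel (\<gamma> 0) z)). z ^ n)" .
qed simp_all

lemma AE_inner_map: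
  assumes \<gamma>: "inner_map \<gamma>" and Q: "AE z in circle_measure. Q z"
  shows "AE z in circle_measure. Q (\<gamma> z)"
proof (rule AE_distrD[OF inner_map_measurable[OF \<gamma>]])
  have \<gamma>0: "cmod (\<gamma> 0) < 1" using \<gamma> by (auto simp: inner_map_def image_subset_iff)
  have [measurable]: "poisson_kernel (\<gamma> 0) \<in> borel_measurable circle_measure"
    by (rule measurable_continuous_on_sphere[OF poisson_kernel_continuous[OF \<gamma>0] refl])
  show "AE z in distr circle_measure circle_measure \<gamma>. Q z"
    unfolding distr_inner_map[OF \<gamma>] by (subst AE_density) (use Q in auto)
qed

text \<open>The density of the transported measure, a Poisson kernel, is bounded on the circle.\<close>

lemma L2_inner_map:
  assumes \<gamma>: "inner_map \<gamma>"
  obtains C where "0 \<le> C" "\<And>f. f \<in> L2 \<Longrightarrow> (\<lambda>z. f (\<gamma> z)) \<in> L2"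
    "\<And>f. f \<in> L2 \<Longrightarrow> L2_norm (\<lambda>z. f (\<gamma> z)) \<le> C * L2_norm f"
proof -
  note m\<gamma> [measurable] = inner_map_measurable[OF \<gamma>]
  have \<gamma>0: "cmod (\<gamma> 0) < 1" using \<gamma> by (auto simp: inner_map_def image_subset_iff)
  define C where "C = (1 + cmod (\<gamma> 0)) / (1 - cmod (\<gamma> 0))"
  have C: "C \<ge> 0" using \<gamma>0 by (simp add: C_def)
  have [measurable]: "poisson_kernel (\<gamma> 0) \<in> borel_measurable circle_measure"
    by (rule measurable_continuous_on_sphere[OF poisson_kernel_continuous[OF \<gamma>0] refl])
  have main: "(\<lambda>z. f (\<gamma> z)) \<in> L2 \<and> L2_norm (\<lambda>z. f (\<gamma> z)) \<le> sqrt C * L2_norm f" if f: "f \<in> L2" for f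
  proof -
    note [measurable] = L2_measurable[OF f]
    have "(\<integral>\<^sup>+z. ennreal ((cmod (f (\<gamma> z)))\<^sup>2) \<partial>circle_measure)
        = (\<integral>\<^sup>+z. ennreal ((cmod (f z))\<^sup>2) \<partial>distr circle_measure circle_measure \<gamma>)"
      by (rule nn_integral_distr[symmetric]) measurable
    also have "\<dots> = (\<integral>\<^sup>+z. ennreal (poisson_kernel (\<gamma> 0) z) * ennreal ((cmod (f z))\<^sup>2) \<partial>circle_measure)"
      unfolding distr_inner_map[OF \<gamma>] by (rule nn_integral_density) measurable
    also have "\<dots> \<le> (\<integral>\<^sup>+z. ennreal C * ennreal ((cmod (f z))\<^sup>2) \<partial>circle_measure)"
      using poisson_kernel_le[OF \<gamma>0]
      by (intro nn_integral_mono mult_right_mono ennreal_leI) (auto simp: C_def)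
    also have "\<dots> = ennreal C * (\<integral>\<^sup>+z. ennreal ((cmod (f z))\<^sup>2) \<partial>circle_measure)"
      by (rule nn_integral_cmult) measurable
    also have "(\<integral>\<^sup>+z. ennreal ((cmod (f z))\<^sup>2) \<partial>circle_measure) = ennreal ((L2_norm f)\<^sup>2)"
      unfolding L2_norm_sq by (intro nn_integral_eq_integral L2_sq_integrable f) simp
    also have "ennreal C * \<dots> = ennreal (C * (L2_norm f)\<^sup>2)" using C by (simp add: ennreal_mult)
    finally have le: "(\<integral>\<^sup>+z. ennreal ((cmod (f (\<gamma> z)))\<^sup>2) \<partial>circle_measure) \<le> ennreal (C * (L2_norm f)\<^sup>2)" .
    then have i: "integrable circle_measure (\<lambda>z. (cmod (f (\<gamma> z)))\<^sup>2)"
      by (intro integrableI_bounded) (auto intro: le_less_trans)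
    have "ennreal ((L2_norm (\<lambda>z. f (\<gamma> z)))\<^sup>2) \<le> ennreal (C * (L2_norm f)\<^sup>2)"
      using le nn_integral_eq_integral[OF i] by (simp add: L2_norm_sq)
    then have "(L2_norm (\<lambda>z. f (\<gamma> z)))\<^sup>2 \<le> (sqrt C * L2_norm f)\<^sup>2"
      using C by (simp add: ennreal_le_iff power_mult_distrib)
    then have "L2_norm (\<lambda>z. f (\<gamma> z)) \<le> sqrt C * L2_norm f"
      by (rule power2_le_imp_le) (simp add: C)
    then show ?thesis using i by (simp add: L2_def)
  qed
  show thesis by (rule that[of "sqrt C"]) (use main C in auto)
qed

section \<open>Hardy spaces\<close>

lemma L2_subspace_inter:
  assumes "\<And>i. i \<in> I \<Longrightarrow> L2_subspace (M i)"
  shows "L2_subspace {f \<in> L2. \<forall>i\<in>I. f \<in> M i}"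
  unfolding L2_subspace_def L2_closed_def
proof (intro conjI allI ballI impI)
  fix x y assume "\<forall>n::nat. x n \<in> {f \<in> L2. \<forall>i\<in>I. f \<in> M i}" "y \<in> L2"
    "(\<lambda>n. L2_norm (\<lambda>z. x n z - y z)) \<longlonglongrightarrow> 0"
  then show "y \<in> {f \<in> L2. \<forall>i\<in>I. f \<in> M i}"
    using L2_closedD(2)[OF L2_subspaceD(1)[OF assms], of _ x y] by simp
qed (use assms L2_subspaceD(3-5) in \<open>auto intro!: L2_add L2_scale\<close>)

lemma L2_subspace_preimage:
  assumes M: "L2_subspace M" and TL: "\<And>x. x \<in> L2 \<Longrightarrow> T x \<in> L2"
    and add: "\<And>x y. T (\<lambda>z. x z + y z) = (\<lambda>z. T x z + T y z)"
    and scale: "\<And>c x. T (\<lambda>z. c * x z) = (\<lambda>z. c * T x z)"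
    and bound: "\<And>x. x \<in> L2 \<Longrightarrow> L2_norm (T x) \<le> C * L2_norm x"
  shows "L2_subspace {x \<in> L2. T x \<in> M}"
  unfolding L2_subspace_def L2_closed_def
proof (intro conjI allI ballI impI)
  fix x y assume x: "\<forall>n::nat. x n \<in> {x \<in> L2. T x \<in> M}" and y: "y \<in> L2"
    and lim: "(\<lambda>n. L2_norm (\<lambda>z. x n z - y z)) \<longlonglongrightarrow> 0"
  have diff: "T (\<lambda>z. x n z - y z) = (\<lambda>z. T (x n) z - T y z)" for n
    using add[of "x n" "\<lambda>z. -1 * y z"] scale[of "-1" y] by simp
  have "(\<lambda>n. L2_norm (\<lambda>z. T (x n) z - T y z)) \<longlonglongrightarrow> 0"
  proof (rule Lim_null_comparison)
    show "\<forall>\<^sub>F n in sequentially. norm (L2_norm (\<lambda>z. T (x n) z - T y z)) \<le> C * L2_norm (\<lambda>z. x n z - y z)"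
      using bound[OF L2_diff] x y by (intro always_eventually allI) (simp flip: diff)
    show "(\<lambda>n. C * L2_norm (\<lambda>z. x n z - y z)) \<longlonglongrightarrow> 0"
      using tendsto_mult_left[OF lim, of C] by simp
  qed
  then have "T y \<in> M"
    using L2_closedD(2)[OF L2_subspaceD(1)[OF M], of "\<lambda>n. T (x n)" "T y"] x TL[OF y] by simp
  then show "y \<in> {x \<in> L2. T x \<in> M}" using y by simp
next
  have "T (\<lambda>z. 0) = (\<lambda>z. 0)" using scale[of 0 "\<lambda>z. 0"] by simp
  then show "(\<lambda>z. 0) \<in> {x \<in> L2. T x \<in> M}" using L2_subspaceD(3)[OF M] by simp
qed (use L2_subspaceD(4,5)[OF M] in \<open>auto intro!: L2_add L2_scale simp: add scale\<close>)

lemma L2_inner_add_left: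
  assumes "f \<in> L2" "g \<in> L2" "k \<in> L2"
  shows "L2_inner (\<lambda>z. f z + g z) k = L2_inner f k + L2_inner g k"
  unfolding L2_inner_def using L2_mult_integrable[OF assms(1) L2_cnj[OF assms(3)]]
    L2_mult_integrable[OF assms(2) L2_cnj[OF assms(3)]] by (simp add: distrib_right)

lemma L2_inner_scale_left: "L2_inner (\<lambda>z. c * f z) k = c * L2_inner f k"
  unfolding L2_inner_def by (simp add: mult.assoc)

lemma L2_subspace_orthogonal:
  assumes k: "k \<in> L2" shows "L2_subspace {f \<in> L2. L2_inner f k = 0}"
  unfolding L2_subspace_def L2_closed_def
proof (intro conjI allI ballI impI)
  fix x y assume x: "\<forall>n::nat. x n \<in> {f \<in> L2. L2_inner f k = 0}" and y: "y \<in> L2"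
    and lim: "(\<lambda>n. L2_norm (\<lambda>z. x n z - y z)) \<longlonglongrightarrow> 0"
  have "cmod (L2_inner y k) \<le> L2_norm (\<lambda>z. x n z - y z) * L2_norm k" for n
    using L2_Cauchy_Schwarz[OF L2_diff[of "x n" y] k] L2_inner_diff_left[of "x n" y k] x y k by simp
  moreover have "(\<lambda>n. L2_norm (\<lambda>z. x n z - y z) * L2_norm k) \<longlonglongrightarrow> 0"
    using tendsto_mult_right[OF lim, of "L2_norm k"] by simp
  ultimately have "cmod (L2_inner y k) \<le> 0" by (intro LIMSEQ_le_const) auto
  then show "y \<in> {f \<in> L2. L2_inner f k = 0}" using y by simp
next
  show "(\<lambda>z. 0) \<in> {f \<in> L2. L2_inner f k = 0}" by (simp add: L2_inner_def)
qed (use k in \<open>auto intro!: L2_add L2_scale simp: L2_inner_add_left L2_inner_scale_left\<close>)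

lemma L2_subspace_null: "L2_subspace {f \<in> L2. AE z in circle_measure. f z = 0}"
  unfolding L2_subspace_def L2_closed_def
proof (intro conjI allI ballI impI)
  fix x y assume x: "\<forall>n::nat. x n \<in> {f \<in> L2. AE z in circle_measure. f z = 0}" and y: "y \<in> L2"
    and lim: "(\<lambda>n. L2_norm (\<lambda>z. x n z - y z)) \<longlonglongrightarrow> 0"
  have xL: "x n \<in> L2" "L2_norm (x n) = 0" for n
    using x L2_norm_eq_0_iff[of "x n"] by auto
  have "L2_norm y \<le> L2_norm (\<lambda>z. x n z - y z)" for n
    using L2_norm_le_diff[OF xL(1)[of n] y] xL(2)[of n] by simp
  then have "L2_norm y \<le> 0" by (intro LIMSEQ_le_const[OF lim]) auto
  then have "L2_norm y = 0" by (simp add: antisym)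
  then show "y \<in> {f \<in> L2. AE z in circle_measure. f z = 0}"
    using y L2_norm_eq_0_iff[OF y] by simp
next
  fix x y assume xy: "x \<in> {f \<in> L2. AE z in circle_measure. f z = 0}"
    "y \<in> {f \<in> L2. AE z in circle_measure. f z = 0}"
  then have "AE z in circle_measure. x z + y z = 0" by auto
  then show "(\<lambda>z. x z + y z) \<in> {f \<in> L2. AE z in circle_measure. f z = 0}"
    using xy by (simp add: L2_add)
qed (auto intro!: L2_scale)

lemma circle_power_measurable [measurable]: "(\<lambda>z. z ^ n) \<in> borel_measurable circle_measure"
  by (rule measurable_continuous_on_sphere) (auto intro!: continuous_intros)

lemma circle_power_L2: "(\<lambda>z. z ^ n) \<in> L2" "(\<lambda>z. cnj z ^ n) \<in> L2"
proof -
  show "(\<lambda>z. z ^ n) \<in> L2"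
    by (rule L2_bounded[where B = 1]) (auto intro!: AE_I2 simp: norm_power)
  from L2_cnj[OF this] show "(\<lambda>z. cnj z ^ n) \<in> L2" by simp
qed

lemma circle_power_integral: "n \<ge> 1 \<Longrightarrow> (LINT z|circle_measure. z ^ n) = 0"
  using mean_value_circle[of "\<lambda>z. z ^ n"] by (simp add: continuous_intros holomorphic_intros power_0_left)

lemma L2_subspace_hardy: "L2_subspace (hardy L2)"
proof -
  have "hardy L2 = {f \<in> L2. \<forall>n\<in>{1..}. f \<in> {f \<in> L2. L2_inner f (\<lambda>z. cnj z ^ n) = 0}}"
    by (auto simp: hardy_def L2_inner_def)
  then show ?thesis
    by (simp only:) (intro L2_subspace_inter L2_subspace_orthogonal circle_power_L2)
qed

lemma hardy_L2_power: "(\<lambda>z. z ^ j) \<in> hardy L2"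
  by (simp add: hardy_def circle_power_L2 circle_power_integral flip: power_add)

lemma L2_closed_AE:
  assumes "L2_closed K" "h \<in> K" "g \<in> L2" "AE z in circle_measure. g z = h z"
  shows "g \<in> K"
proof (rule L2_closedD(2)[OF assms(1) assms(2) assms(3)])
  have "h \<in> L2" using assms L2_closedD(1) by blast
  then have "L2_norm (\<lambda>z. h z - g z) = 0"
    using assms(3,4) by (subst L2_norm_eq_0_iff) (auto intro!: L2_diff)
  then show "(\<lambda>n. L2_norm (\<lambda>z. h z - g z)) \<longlonglongrightarrow> 0" by simp
qed

text \<open>Let \<open>h\<close> be the projection of \<open>g \<in> H\<^sup>2\<close> onto \<open>V \<inter> H\<^sup>2\<close>. The remainder \<open>g - h\<close> is orthogonal to the
  monomials because they lie in \<open>V \<inter> H\<^sup>2\<close>, and to their conjugates because it is in \<open>H\<^sup>2\<close>; so all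
  its Fourier coefficients vanish.\<close>

lemma hardy_L2_minimal:
  assumes V: "L2_subspace V" and powers: "\<And>j. (\<lambda>z. z ^ j) \<in> V"
  shows "hardy L2 \<subseteq> V"
proof
  fix g assume g: "g \<in> hardy L2"
  then have gL: "g \<in> L2" by (simp add: hardy_def)
  define M where "M = {f \<in> L2. \<forall>i\<in>UNIV. f \<in> (if i then V else hardy L2)}"
  have M: "L2_subspace M"
    unfolding M_def using V L2_subspace_hardy by (intro L2_subspace_inter) auto
  have M_iff: "x \<in> M \<longleftrightarrow> x \<in> V \<and> x \<in> hardy L2" for x
    by (auto simp: M_def UNIV_bool hardy_def)
  define h where "h = orth_proj M g"
  have h: "h \<in> V" "h \<in> hardy L2" using orth_proj_mem[OF M gL] by (auto simp: h_def M_iff)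
  have r: "(\<lambda>z. g z - h z) \<in> hardy L2" by (rule L2_subspaceD(6)[OF L2_subspace_hardy g h(2)])
  have "L2_inner (\<lambda>z. g z - h z) (\<lambda>z. z ^ j) = 0" for j
    unfolding h_def using powers hardy_L2_power by (intro orth_proj_orth[OF M gL]) (simp add: M_iff)
  then have c: "(LINT z|circle_measure. (g z - h z) * cnj z ^ j) = 0" for j
    by (simp add: L2_inner_def)
  have "AE z in circle_measure. g z - h z = 0"
  proof (rule fourier_unique)
    show "integrable circle_measure (\<lambda>z. g z - h z)"
      using r by (intro L2_integrable) (simp add: hardy_def)
    show "(LINT z|circle_measure. (g z - h z) * z ^ n) = 0" for n
      using r c[of 0] by (cases n) (auto simp: hardy_def)
  qed (rule c)
  then have "AE z in circle_measure. g z = h z" by simp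
  then show "g \<in> V" by (rule L2_closed_AE[OF L2_subspaceD(1)[OF V] h(1) gL])
qed

lemma Linf_norm_AE_bound:
  assumes "Linf_norm f \<le> ereal B" shows "AE z in circle_measure. cmod (f z) \<le> B"
proof (rule eventually_mono[OF esssup_AE])
  fix z assume "ereal (cmod (f z)) \<le> esssup circle_measure (\<lambda>z. ereal (cmod (f z)))"
  then have "ereal (cmod (f z)) \<le> ereal B"
    using assms unfolding Linf_norm_def by (rule order_trans)
  then show "cmod (f z) \<le> B" by simp
qed

lemma Linf_iff:
  "f \<in> Linf \<longleftrightarrow> f \<in> borel_measurable circle_measure \<and> (\<exists>B. AE z in circle_measure. cmod (f z) \<le> B)"
proof (cases "f \<in> borel_measurable circle_measure")
  case True
  then have m: "(\<lambda>z. ereal (cmod (f z))) \<in> borel_measurable circle_measure" by measurable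
  have "Linf_norm f < \<infinity> \<longleftrightarrow> (\<exists>B. AE z in circle_measure. cmod (f z) \<le> B)"
  proof
    assume "Linf_norm f < \<infinity>"
    then obtain B :: real where "Linf_norm f \<le> ereal B"
      by (cases "Linf_norm f") (auto intro: that[of 0])
    then show "\<exists>B. AE z in circle_measure. cmod (f z) \<le> B" using Linf_norm_AE_bound by blast
  next
    assume "\<exists>B. AE z in circle_measure. cmod (f z) \<le> B"
    then obtain B where "AE z in circle_measure. ereal (cmod (f z)) \<le> ereal B" by auto
    then have "Linf_norm f \<le> ereal B" unfolding Linf_norm_def by (rule esssup_I[OF m])
    then show "Linf_norm f < \<infinity>" by (rule le_less_trans) simp
  qed
  then show ?thesis using True by (simp add: Linf_def)
qed (simp add: Linf_def)

lemma Linf_norm_leI: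
  assumes "f \<in> borel_measurable circle_measure" "AE z in circle_measure. cmod (f z) \<le> B"
  shows "Linf_norm f \<le> ereal B"
  unfolding Linf_norm_def by (rule esssup_I) (use assms in auto)

lemma Linf_subset_L2: "f \<in> Linf \<Longrightarrow> f \<in> L2"
  by (auto simp: Linf_iff intro: L2_bounded)

lemma L2_subspace_mult_preimage:
  assumes M: "L2_subspace M" and f: "f \<in> Linf"
  shows "L2_subspace {g \<in> L2. (\<lambda>z. f z * g z) \<in> M}"
proof -
  obtain B where fB: "f \<in> borel_measurable circle_measure" "AE z in circle_measure. cmod (f z) \<le> B"
    using f by (auto simp: Linf_iff)
  have L: "(\<lambda>z. f z * x z) \<in> L2" if "x \<in> L2" for x
    by (rule L2_bounded_mult[OF fB that])
  have "L2_norm (\<lambda>z. f z * x z) \<le> \<bar>B\<bar> * L2_norm x" if x: "x \<in> L2" for x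
  proof -
    have "L2_norm (\<lambda>z. f z * x z) \<le> L2_norm (\<lambda>z. complex_of_real B * x z)"
    proof (rule L2_norm_mono(2)[OF L2_measurable[OF L[OF x]] L2_scale[OF x]])
      show "AE z in circle_measure. cmod (f z * x z) \<le> cmod (complex_of_real B * x z)"
        using fB(2) by eventually_elim (auto simp: norm_mult intro!: mult_right_mono)
    qed
    then show ?thesis by (simp add: L2_norm_scale)
  qed
  then show ?thesis
    using L by (intro L2_subspace_preimage[OF M, where C = "\<bar>B\<bar>"]) (auto simp: algebra_simps)
qed

text \<open>On monomials the claim is immediate, and the functions that \<open>f\<close> multiplies into \<open>H\<^sup>2\<close> form a closed
  subspace.\<close>

lemma hardy_mult:
  assumes f: "f \<in> hardy Linf" and g: "g \<in> hardy L2"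
  shows "(\<lambda>z. f z * g z) \<in> hardy L2"
proof -
  have fi: "f \<in> Linf" using f by (simp add: hardy_def)
  have "hardy L2 \<subseteq> {g \<in> L2. (\<lambda>z. f z * g z) \<in> hardy L2}"
  proof (rule hardy_L2_minimal[OF L2_subspace_mult_preimage[OF L2_subspace_hardy fi]])
    fix j
    have "(\<lambda>z. f z * z ^ j) \<in> L2"
      using fi circle_power_L2(1) by (auto simp: Linf_iff intro: L2_bounded_mult)
    then show "(\<lambda>z. z ^ j) \<in> {g \<in> L2. (\<lambda>z. f z * g z) \<in> hardy L2}"
      using f by (simp add: hardy_def circle_power_L2 mult.assoc flip: power_add)
  qed
  then show ?thesis using g by blast
qed

lemma hardy_Linf_eq: "hardy Linf = hardy L2 \<inter> Linf"
  using Linf_subset_L2 by (auto simp: hardy_def)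

lemma Linf_mult: "f \<in> Linf \<Longrightarrow> g \<in> Linf \<Longrightarrow> (\<lambda>z. f z * g z) \<in> Linf"
proof -
  assume fg: "f \<in> Linf" "g \<in> Linf"
  then obtain A B where A: "AE z in circle_measure. cmod (f z) \<le> A"
    and B: "AE z in circle_measure. cmod (g z) \<le> B" by (auto simp: Linf_iff)
  have "AE z in circle_measure. cmod (f z * g z) \<le> \<bar>A\<bar> * \<bar>B\<bar>"
    using A B by eventually_elim (auto simp: norm_mult intro!: mult_mono)
  then show ?thesis using fg by (auto simp: Linf_iff)
qed

lemma Linf_inner_map:
  assumes \<gamma>: "inner_map \<gamma>" and f: "f \<in> Linf"
  shows "(\<lambda>z. f (\<gamma> z)) \<in> Linf"
proof -
  obtain B where B: "AE z in circle_measure. cmod (f z) \<le> B" using f by (auto simp: Linf_iff)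
  have "(\<lambda>z. f (\<gamma> z)) \<in> borel_measurable circle_measure"
    using f by (intro measurable_compose[OF inner_map_measurable[OF \<gamma>]]) (simp add: Linf_iff)
  moreover have "AE z in circle_measure. cmod (f (\<gamma> z)) \<le> B"
    by (rule AE_inner_map[OF \<gamma> B])
  ultimately show ?thesis by (auto simp: Linf_iff)
qed

text \<open>By the mean value property \<open>\<integral> \<gamma> ^ j * z ^ n = 0\<close> for \<open>n \<ge> 1\<close>, which settles the monomials.\<close>

lemma hardy_inner_map:
  assumes \<gamma>: "inner_map \<gamma>" and g: "g \<in> hardy L2"
  shows "(\<lambda>z. g (\<gamma> z)) \<in> hardy L2"
proof -
  obtain C where C: "\<And>f. f \<in> L2 \<Longrightarrow> (\<lambda>z. f (\<gamma> z)) \<in> L2"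
    "\<And>f. f \<in> L2 \<Longrightarrow> L2_norm (\<lambda>z. f (\<gamma> z)) \<le> C * L2_norm f"
    using L2_inner_map[OF \<gamma>] by metis
  have "L2_subspace {g \<in> L2. (\<lambda>z. g (\<gamma> z)) \<in> hardy L2}"
    using C by (intro L2_subspace_preimage[OF L2_subspace_hardy]) auto
  then have "hardy L2 \<subseteq> {g \<in> L2. (\<lambda>z. g (\<gamma> z)) \<in> hardy L2}"
  proof (rule hardy_L2_minimal)
    fix j
    have "(LINT z|circle_measure. \<gamma> z ^ j * z ^ n) = \<gamma> 0 ^ j * 0 ^ n" for n
      using \<gamma> by (intro mean_value_circle continuous_intros holomorphic_intros) (auto simp: inner_map_def)
    then show "(\<lambda>z. z ^ j) \<in> {g \<in> L2. (\<lambda>z. g (\<gamma> z)) \<in> hardy L2}"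
      using C(1)[OF circle_power_L2(1)] by (simp add: hardy_def circle_power_L2)
  qed
  then show ?thesis using g by blast
qed

text \<open>The space is an intersection of \<open>H\<^sup>2\<close> with the kernels of the bounded operators
  \<open>f \<mapsto> f \<circ> \<gamma> - \<sigma> \<gamma> f\<close>.\<close>

lemma L2_subspace_character_space:
  assumes "fuchsian \<Gamma>"
  shows "L2_subspace (character_space (hardy L2) \<Gamma> \<sigma>)"
proof -
  define N where "N = {f \<in> L2. AE z in circle_measure. f z = 0}"
  define K where "K \<gamma> = {f \<in> L2. (\<lambda>z. f (\<gamma> z) - \<sigma> \<gamma> * f z) \<in> N}" for \<gamma>
  have L: "(\<lambda>z. f (\<gamma> z) - \<sigma> \<gamma> * f z) \<in> L2" if "\<gamma> \<in> \<Gamma>" "f \<in> L2" for f \<gamma>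
  proof -
    have "(\<lambda>z. f (\<gamma> z)) \<in> L2" using L2_inner_map[OF fuchsian_inner_map[OF assms that(1)]] that(2) by metis
    then show ?thesis using that(2) by (intro L2_diff L2_scale)
  qed
  have K: "L2_subspace (K \<gamma>)" if g: "\<gamma> \<in> \<Gamma>" for \<gamma>
  proof -
    obtain C where C: "\<And>f. f \<in> L2 \<Longrightarrow> (\<lambda>z. f (\<gamma> z)) \<in> L2"
      "\<And>f. f \<in> L2 \<Longrightarrow> L2_norm (\<lambda>z. f (\<gamma> z)) \<le> C * L2_norm f"
      using L2_inner_map[OF fuchsian_inner_map[OF assms g]] by metis
    have "L2_norm (\<lambda>z. f (\<gamma> z) - \<sigma> \<gamma> * f z) \<le> (C + cmod (\<sigma> \<gamma>)) * L2_norm f" if f: "f \<in> L2" for f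
      using L2_norm_triangle[OF C(1)[OF f] L2_scale[OF f, of "- \<sigma> \<gamma>"]] C(2)[OF f]
        L2_norm_scale[of "- \<sigma> \<gamma>" f] by (simp add: algebra_simps)
    then show ?thesis
      unfolding K_def N_def using L[OF g]
      by (intro L2_subspace_preimage[OF L2_subspace_null, where C = "C + cmod (\<sigma> \<gamma>)"]) (auto simp: algebra_simps)
  qed
  have "character_space (hardy L2) \<Gamma> \<sigma>
      = {f \<in> L2. \<forall>i\<in>insert None (Some ` \<Gamma>). f \<in> (case i of None \<Rightarrow> hardy L2 | Some \<gamma> \<Rightarrow> K \<gamma>)}"
    using L by (auto simp: character_space_def hardy_def K_def N_def)
  also have "L2_subspace \<dots>"
    using K L2_subspace_hardy by (intro L2_subspace_inter) auto
  finally show ?thesis .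
qed

section \<open>Factorization of weights and characters\<close>

text \<open>Szego's extremal problem. Let \<open>G\<close> minimise \<open>\<integral> \<bar>G\<bar>\<^sup>2 W\<close> among the functions in \<open>H\<^sup>2\<close> with mean \<open>1\<close>,
  so that \<open>W G\<close> is orthogonal to \<open>H = {k \<in> H\<^sup>2. \<integral> k = 0}\<close>. Orthogonality to \<open>z ^ n * G\<close> makes all
  Fourier coefficients of \<open>W \<bar>G\<bar>\<^sup>2\<close> vanish except the mean \<open>c\<close>, whence \<open>W \<bar>G\<bar>\<^sup>2 = c\<close>. Orthogonality
  to \<open>z ^ n\<close> says that \<open>1 / G = W cnj G / c\<close> is analytic as well. Take \<open>q = sqrt c / G\<close>.\<close>

lemma szego_factorization:
  fixes W :: "complex \<Rightarrow> real"
  assumes Wm: "W \<in> borel_measurable circle_measure" and \<epsilon>: "0 < \<epsilon>" and W: "\<And>z. \<epsilon> \<le> W z" "\<And>z. W z \<le> B"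
  obtains q q' where "q \<in> hardy Linf" "q' \<in> hardy Linf" "AE z in circle_measure. q z * q' z = 1"
    "AE z in circle_measure. (cmod (q z))\<^sup>2 = W z"
proof -
  note [measurable] = Wm
  \<comment> \<open>Multiplication by \<open>u\<close> turns the weighted minimisation into an unweighted projection onto \<open>M = u H\<close>.\<close>
  define u where "u z = complex_of_real (sqrt (W z))" for z
  have Wpos: "0 < W z" for z using W(1)[of z] \<epsilon> by simp
  have u_ne: "u z \<noteq> 0" and u_sq: "u z * cnj (u z) = of_real (W z)" for z
    using Wpos[of z] by (simp_all add: u_def flip: of_real_mult)
  have um [measurable]: "u \<in> borel_measurable circle_measure" unfolding u_def by measurable
  have uB: "cmod (u z) \<le> sqrt B" for z using W(2)[of z] Wpos[of z] by (simp add: u_def)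
  have uL: "u \<in> L2" by (rule L2_bounded[OF um]) (use uB in auto)
  have iu: "(\<lambda>z. 1 / u z) \<in> Linf"
    unfolding Linf_iff
  proof (intro conjI exI)
    show "(\<lambda>z. 1 / u z) \<in> borel_measurable circle_measure" by measurable
    show "AE z in circle_measure. cmod (1 / u z) \<le> 1 / sqrt \<epsilon>"
      using W(1) \<epsilon> Wpos less_imp_le[OF Wpos] by (intro AE_I2) (simp add: u_def norm_divide frac_le)
  qed
  define H where "H = {f \<in> L2. \<forall>i\<in>UNIV. f \<in> (if i then hardy L2 else {f \<in> L2. L2_inner f (\<lambda>z. 1) = 0})}"
  have H: "L2_subspace H"
    unfolding H_def using L2_subspace_hardy L2_subspace_orthogonal[of "\<lambda>z. 1"]
    by (intro L2_subspace_inter) auto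
  have H_iff: "f \<in> H \<longleftrightarrow> f \<in> hardy L2 \<and> (LINT z|circle_measure. f z) = 0" for f
    by (auto simp: H_def UNIV_bool hardy_def L2_inner_def)
  define M where "M = {y \<in> L2. (\<lambda>z. (1 / u z) * y z) \<in> H}"
  have M: "L2_subspace M" unfolding M_def by (rule L2_subspace_mult_preimage[OF H iu])
  define y where "y = orth_proj M u"
  have y: "y \<in> M" unfolding y_def by (rule orth_proj_mem[OF M uL])
  define p where "p z = 1 / u z * y z" for z
  have p: "p \<in> H" using y by (simp add: M_def p_def[abs_def])
  define G where "G z = 1 - p z" for z
  have uG: "u z * G z = u z - y z" for z using u_ne[of z] by (simp add: G_def p_def field_simps)
  have one: "(\<lambda>z. 1) \<in> hardy L2" using hardy_L2_power[of 0] by simp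
  have G: "G \<in> hardy L2"
    using L2_subspaceD(6)[OF L2_subspace_hardy one] p by (simp add: G_def[abs_def] H_iff)
  have GL: "G \<in> L2" using G by (simp add: hardy_def)
  note [measurable] = L2_measurable[OF GL]
  have pi: "integrable circle_measure p" using p by (intro L2_integrable) (simp add: H_iff hardy_def)
  have intG: "(LINT z|circle_measure. G z) = 1"
    using p pi circle.prob_space by (simp add: G_def[abs_def] H_iff)
  have orth: "(LINT z|circle_measure. of_real (W z) * G z * cnj (k z)) = 0" if k: "k \<in> H" for k
  proof -
    have kL: "k \<in> L2" using k by (simp add: H_iff hardy_def)
    have "(\<lambda>z. u z * k z) \<in> L2" by (rule L2_bounded_mult[OF um _ kL]) (use uB in auto)
    moreover have "(\<lambda>z. (1 / u z) * (u z * k z)) = k" using u_ne by (simp add: fun_eq_iff)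
    ultimately have "(\<lambda>z. u z * k z) \<in> M" using k by (simp add: M_def)
    from orth_proj_orth[OF M uL this]
    have "(LINT z|circle_measure. (u z * G z) * cnj (u z * k z)) = 0"
      by (simp add: L2_inner_def uG y_def[symmetric])
    moreover have "(u z * G z) * cnj (u z * k z) = of_real (W z) * G z * cnj (k z)" for z
    proof -
      have "(u z * G z) * cnj (u z * k z) = (u z * cnj (u z)) * G z * cnj (k z)" by (simp add: mult_ac)
      then show ?thesis by (simp only: u_sq)
    qed
    ultimately show ?thesis by (simp only:)
  qed
  have power_in_H: "(\<lambda>z. z ^ n) \<in> H" if "n \<ge> 1" for n
    using that by (simp add: H_iff hardy_L2_power circle_power_integral)
  have power_G_in_H: "(\<lambda>z. z ^ n * G z) \<in> H" if "n \<ge> 1" for n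
  proof -
    have "(\<lambda>z. z ^ n * G z) \<in> L2"
      by (rule L2_bounded_mult[where B = 1, OF _ _ GL]) (auto intro!: AE_I2 simp: norm_power)
    then show ?thesis using G that by (auto simp: H_iff hardy_def mult_ac simp flip: power_add)
  qed
  define V where "V z = W z * (cmod (G z))\<^sup>2" for z
  have V_sq: "V z = (cmod (u z * G z))\<^sup>2" for z
    using Wpos[of z] by (simp add: V_def u_def norm_mult power_mult_distrib)
  have uGL: "(\<lambda>z. u z * G z) \<in> L2" by (rule L2_bounded_mult[OF um _ GL]) (use uB in auto)
  have iV: "integrable circle_measure V" unfolding V_sq[abs_def] by (rule L2_sq_integrable[OF uGL])
  have V_mom: "(LINT z|circle_measure. of_real (V z) * z ^ n) = 0" if "n \<ge> 1" for n
  proof -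
    have "cnj (of_real (W z) * G z * cnj (z ^ n * G z)) = of_real (V z) * z ^ n" for z
      by (simp add: V_def complex_norm_square mult_ac del: of_real_power)
    then have "(LINT z|circle_measure. of_real (V z) * z ^ n)
        = (LINT z|circle_measure. cnj (of_real (W z) * G z * cnj (z ^ n * G z)))" by (simp only:)
    also have "\<dots> = cnj (LINT z|circle_measure. of_real (W z) * G z * cnj (z ^ n * G z))"
      by (rule Bochner_Integration.integral_cnj)
    finally show ?thesis using orth[OF power_G_in_H[OF that]] by simp
  qed
  define c where "c = (LINT z|circle_measure. V z)"
  have V_const: "AE z in circle_measure. V z - c = 0"
  proof (rule real_fourier_unique)
    show "integrable circle_measure (\<lambda>z. V z - c)" using iV by simp
    fix n
    show "(LINT z|circle_measure. of_real (V z - c) * z ^ n) = 0"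
    proof (cases "n = 0")
      case True
      have "(LINT z|circle_measure. complex_of_real (V z - c)) = of_real (LINT z|circle_measure. V z - c)"
        by (rule integral_complex_of_real)
      also have "(LINT z|circle_measure. V z - c) = 0"
        using iV circle.prob_space by (simp add: c_def)
      finally show ?thesis using True by simp
    next
      case False
      have "integrable circle_measure (\<lambda>z. of_real (V z) * z ^ n)"
        by (rule Bochner_Integration.integrable_bound[OF iV])
           (use iV in \<open>auto intro!: AE_I2 simp: norm_mult norm_power\<close>)
      moreover have "integrable circle_measure (\<lambda>z. of_real c * z ^ n)"
        by (intro integrable_mult_right L2_integrable circle_power_L2)
      ultimately show ?thesis
        using V_mom[of n] circle_power_integral[of n] False
        by (simp add: left_diff_distrib)
    qed
  qed
  have "0 \<le> c" unfolding c_def using Wpos by (intro Bochner_Integration.integral_nonneg) (simp add: V_def less_imp_le)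
  moreover have "c \<noteq> 0"
  proof
    assume "c = 0"
    have "AE z in circle_measure. G z = 0"
      using V_const by eventually_elim (use \<open>c = 0\<close> Wpos in \<open>auto simp: V_def less_le\<close>)
    then have "(LINT z|circle_measure. G z) = (LINT z|circle_measure. 0)"
      by (intro integral_cong_AE) auto
    then show False using intG by simp
  qed
  ultimately have c: "c > 0" by simp
  define q q' where "q z = of_real (1 / sqrt c) * (of_real (W z) * cnj (G z))"
    and "q' z = of_real (1 / sqrt c) * G z" for z
  have cG: "AE z in circle_measure. W z * (cmod (G z))\<^sup>2 = c"
    using V_const by (simp add: V_def)
  have [measurable]: "(\<lambda>z. cnj (G z)) \<in> borel_measurable circle_measure"
    by (rule L2_measurable[OF L2_cnj[OF GL]])
  have qm: "q \<in> borel_measurable circle_measure" "q' \<in> borel_measurable circle_measure"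
    unfolding q_def q'_def by measurable
  have q_sq: "AE z in circle_measure. (cmod (q z))\<^sup>2 = W z"
    using cG
  proof eventually_elim
    case (elim z)
    have m: "cmod (q z) = W z * cmod (G z) / sqrt c"
      using c Wpos[of z] by (simp add: q_def norm_mult norm_divide)
    have "(cmod (q z))\<^sup>2 = W z * (W z * (cmod (G z))\<^sup>2) / c"
      using c unfolding m by (simp add: power_divide power_mult_distrib power2_eq_square[of "W z"])
    then show ?case using c unfolding elim by simp
  qed
  have q'_sq: "AE z in circle_measure. (cmod (q' z))\<^sup>2 = 1 / W z"
    using cG
  proof eventually_elim
    case (elim z)
    have m: "cmod (q' z) = cmod (G z) / sqrt c"
      using c by (simp add: q'_def norm_divide)
    have "(cmod (q' z))\<^sup>2 = (cmod (G z))\<^sup>2 / c"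
      using c unfolding m by (simp add: power_divide)
    also have "(cmod (G z))\<^sup>2 = c / W z"
      using elim nonzero_mult_div_cancel_left[of "W z" "(cmod (G z))\<^sup>2"] Wpos[of z] by simp
    finally show ?case using c by simp
  qed
  have qq: "AE z in circle_measure. q z * q' z = 1"
    using cG
  proof eventually_elim
    case (elim z)
    have "q z * q' z = (of_real (1 / sqrt c) * of_real (1 / sqrt c)) * (of_real (W z) * (G z * cnj (G z)))"
      unfolding q_def q'_def by (simp only: mult_ac)
    also have "\<dots> = of_real ((1 / sqrt c * (1 / sqrt c)) * (W z * (cmod (G z))\<^sup>2))"
      by (simp only: complex_norm_square[symmetric] of_real_mult)
    also have "(1 / sqrt c * (1 / sqrt c)) * (W z * (cmod (G z))\<^sup>2) = 1"
      using c unfolding elim by simp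
    finally show ?case by simp
  qed
  have "q \<in> Linf"
    unfolding Linf_iff
  proof (intro conjI exI)
    show "AE z in circle_measure. cmod (q z) \<le> sqrt B"
      using q_sq by eventually_elim (use W(2) in \<open>simp add: real_le_rsqrt\<close>)
  qed (rule qm)
  moreover have "(LINT z|circle_measure. q z * z ^ n) = 0" if "n \<ge> 1" for n
  proof -
    have "q z * z ^ n = of_real (1 / sqrt c) * cnj (of_real (W z) * G z * cnj (z ^ n))" for z
      by (simp add: q_def)
    then have "(LINT z|circle_measure. q z * z ^ n)
        = of_real (1 / sqrt c) * (LINT z|circle_measure. cnj (of_real (W z) * G z * cnj (z ^ n)))"
      by (simp only: integral_mult_right_zero)
    also have "\<dots> = of_real (1 / sqrt c) * cnj (LINT z|circle_measure. of_real (W z) * G z * cnj (z ^ n))"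
      by (simp only: Bochner_Integration.integral_cnj)
    finally show ?thesis using orth[OF power_in_H[OF that]] by simp
  qed
  ultimately have 1: "q \<in> hardy Linf" by (simp add: hardy_def)
  have "q' \<in> Linf"
    unfolding Linf_iff
  proof (intro conjI exI)
    show "AE z in circle_measure. cmod (q' z) \<le> sqrt (1 / \<epsilon>)"
      using q'_sq
    proof eventually_elim
      case (elim z)
      have "1 / W z \<le> 1 / \<epsilon>" using W(1)[of z] \<epsilon> by (intro divide_left_mono) (auto simp: Wpos)
      then show ?case by (intro real_le_rsqrt) (simp only: elim)
    qed
  qed (rule qm)
  moreover have "q' \<in> hardy L2" unfolding q'_def[abs_def] by (rule L2_subspaceD(5)[OF L2_subspace_hardy G])
  ultimately have 2: "q' \<in> hardy Linf" by (simp add: hardy_Linf_eq)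
  show thesis by (rule that[OF 1 2 qq q_sq])
qed

lemma hardy_Linf_mult:
  "f \<in> hardy Linf \<Longrightarrow> g \<in> hardy Linf \<Longrightarrow> (\<lambda>z. f z * g z) \<in> hardy Linf"
  using hardy_mult[of f g] Linf_mult[of f g] by (simp add: hardy_Linf_eq)

lemma hardy_Linf_inner_map:
  "inner_map \<gamma> \<Longrightarrow> f \<in> hardy Linf \<Longrightarrow> (\<lambda>z. f (\<gamma> z)) \<in> hardy Linf"
  using hardy_inner_map[of \<gamma> f] Linf_inner_map[of \<gamma> f] by (simp add: hardy_Linf_eq)

lemma AE_circle_witness: "AE z in circle_measure. P z \<Longrightarrow> \<exists>z. P z"
proof (rule ccontr)
  assume "AE z in circle_measure. P z" "\<nexists>z. P z"
  then show False by simp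
qed

text \<open>The Fourier coefficients of negative index vanish because \<open>s\<close> is in \<open>H\<^sup>\<infinity>\<close>, those of positive index
  because \<open>cnj s\<close> is.\<close>

lemma hardy_const_if_cnj_hardy:
  assumes s: "s \<in> hardy Linf" and t: "t \<in> hardy Linf" and ts: "AE z in circle_measure. t z = cnj (s z)"
  obtains c where "AE z in circle_measure. s z = c"
proof
  define c where "c = (LINT z|circle_measure. s z)"
  have sL: "s \<in> L2" "t \<in> L2" using s t Linf_subset_L2 by (auto simp: hardy_def)
  have sub: "(LINT z|circle_measure. (s z - c) * g z) = (LINT z|circle_measure. s z * g z) - c * (LINT z|circle_measure. g z)"
    if "g \<in> L2" for g
    using L2_mult_integrable[OF sL(1) that] L2_integrable[OF that] by (simp add: left_diff_distrib)
  have "AE z in circle_measure. s z - c = 0"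
  proof (rule fourier_unique)
    show "integrable circle_measure (\<lambda>z. s z - c)" using L2_integrable[OF sL(1)] by simp
    fix n :: nat
    have zero: "(LINT z|circle_measure. (s z - c) * z ^ 0) = 0"
      using sub[OF L2_const[of 1]] circle.prob_space by (simp add: c_def)
    show "(LINT z|circle_measure. (s z - c) * z ^ n) = 0"
    proof (cases "n = 0")
      case False
      then show ?thesis
        using sub[OF circle_power_L2(1)[of n]] circle_power_integral[of n] s by (simp add: hardy_def)
    qed (use zero in simp)
    show "(LINT z|circle_measure. (s z - c) * cnj z ^ n) = 0"
    proof (cases "n = 0")
      case False
      have "(LINT z|circle_measure. s z * cnj z ^ n) = (LINT z|circle_measure. cnj (t z * z ^ n))"
      proof (rule integral_cong_AE)
        show "(\<lambda>z. s z * cnj z ^ n) \<in> borel_measurable circle_measure"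
          using L2_mult_integrable[OF sL(1) circle_power_L2(2)] by simp
        show "(\<lambda>z. cnj (t z * z ^ n)) \<in> borel_measurable circle_measure"
          using L2_mult_integrable[OF L2_cnj[OF sL(2)] circle_power_L2(2)] by simp
        show "AE z in circle_measure. s z * cnj z ^ n = cnj (t z * z ^ n)"
          using ts by eventually_elim simp
      qed
      also have "\<dots> = cnj (LINT z|circle_measure. t z * z ^ n)" by (rule Bochner_Integration.integral_cnj)
      also have "\<dots> = 0" using t False by (simp add: hardy_def)
      finally have "(LINT z|circle_measure. s z * cnj z ^ n) = 0" .
      moreover have "(LINT z|circle_measure. cnj z ^ n) = 0"
        using Bochner_Integration.integral_cnj[of circle_measure "\<lambda>z. z ^ n"] circle_power_integral[of n] False by simp
      ultimately show ?thesis using sub[OF circle_power_L2(2)[of n]] by simp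
    qed (use zero in simp)
  qed
  then show "AE z in circle_measure. s z = c" by simp
qed

text \<open>The quotient \<open>(q \<circ> \<gamma>) / q\<close> is unimodular, so its conjugate is its inverse \<open>q / (q \<circ> \<gamma>)\<close>. Both are
  in \<open>H\<^sup>\<infinity>\<close> since \<open>q\<close> is invertible there, and hence they are constant.\<close>

lemma character_of_invariant_modulus:
  assumes \<Gamma>: "fuchsian \<Gamma>" and q: "q \<in> hardy Linf" "q' \<in> hardy Linf"
    and qq: "AE z in circle_measure. q z * q' z = 1"
    and inv: "\<And>\<gamma>. \<gamma> \<in> \<Gamma> \<Longrightarrow> AE z in circle_measure. cmod (q (\<gamma> z)) = cmod (q z)"
  obtains \<sigma> where "\<sigma> \<in> characters \<Gamma>" "\<And>\<gamma>. \<gamma> \<in> \<Gamma> \<Longrightarrow> AE z in circle_measure. q (\<gamma> z) = \<sigma> \<gamma> * q z"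
proof -
  have ex: "\<exists>c. cmod c = 1 \<and> (AE z in circle_measure. q (\<gamma> z) = c * q z)" if g: "\<gamma> \<in> \<Gamma>" for \<gamma>
  proof -
    note \<gamma> = fuchsian_inner_map[OF \<Gamma> g]
    note qq\<gamma> = AE_inner_map[OF \<gamma> qq]
    have s: "(\<lambda>z. q (\<gamma> z) * q' z) \<in> hardy Linf" "(\<lambda>z. q z * q' (\<gamma> z)) \<in> hardy Linf"
      by (rule hardy_Linf_mult[OF hardy_Linf_inner_map[OF \<gamma> q(1)] q(2)]
          hardy_Linf_mult[OF q(1) hardy_Linf_inner_map[OF \<gamma> q(2)]])+
    have mod: "AE z in circle_measure. cmod (q (\<gamma> z) * q' z) = 1"
      using inv[OF g] qq by eventually_elim (metis norm_mult norm_one)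
    have "AE z in circle_measure. q z * q' (\<gamma> z) = cnj (q (\<gamma> z) * q' z)"
      using mod qq qq\<gamma>
    proof eventually_elim
      case (elim z)
      let ?s = "q (\<gamma> z) * q' z"
      have "?s * cnj ?s = 1" by (metis complex_norm_square elim(1) of_real_1 power_one)
      moreover have "?s * (q z * q' (\<gamma> z)) = (q z * q' z) * (q (\<gamma> z) * q' (\<gamma> z))" by (simp only: mult_ac)
      ultimately have "?s * (q z * q' (\<gamma> z)) = ?s * cnj ?s" by (simp only: elim mult_1)
      moreover have "?s \<noteq> 0" using elim(1) by auto
      ultimately show ?case by (metis mult_left_cancel)
    qed
    then obtain c where c: "AE z in circle_measure. q (\<gamma> z) * q' z = c"
      using hardy_const_if_cnj_hardy[OF s] by blast
    have "AE z in circle_measure. cmod c = 1" using c mod by eventually_elim simp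
    then have "cmod c = 1" using AE_circle_witness by blast
    moreover have "AE z in circle_measure. q (\<gamma> z) = c * q z"
      using c qq
    proof eventually_elim
      case (elim z)
      have "q (\<gamma> z) = q (\<gamma> z) * (q z * q' z)" using elim by simp
      also have "\<dots> = (q (\<gamma> z) * q' z) * q z" by (simp only: mult_ac)
      finally show ?case unfolding elim .
    qed
    ultimately show ?thesis by blast
  qed
  then have "\<forall>\<gamma>\<in>\<Gamma>. \<exists>c. cmod c = 1 \<and> (AE z in circle_measure. q (\<gamma> z) = c * q z)" by blast
  from bchoice[OF this] obtain \<sigma> where \<sigma>: "\<And>\<gamma>. \<gamma> \<in> \<Gamma> \<Longrightarrow> cmod (\<sigma> \<gamma>) = 1"
    "\<And>\<gamma>. \<gamma> \<in> \<Gamma> \<Longrightarrow> AE z in circle_measure. q (\<gamma> z) = \<sigma> \<gamma> * q z" by blast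
  have sub: "subgroup \<Gamma> (BijGroup (cball 0 1))" using \<Gamma> by (simp add: fuchsian_def)
  have "\<sigma> (\<gamma> \<otimes>\<^bsub>BijGroup (cball 0 1)\<^esub> \<delta>) = \<sigma> \<gamma> * \<sigma> \<delta>" if gd: "\<gamma> \<in> \<Gamma>" "\<delta> \<in> \<Gamma>" for \<gamma> \<delta>
  proof -
    let ?g = "\<gamma> \<otimes>\<^bsub>BijGroup (cball 0 1)\<^esub> \<delta>"
    have "?g \<in> \<Gamma>" by (rule subgroup.m_closed[OF sub gd])
    from \<sigma>(2)[OF this] have 1: "AE z in circle_measure. q (?g z) = \<sigma> ?g * q z" .
    have "\<gamma> \<in> Bij (cball 0 1)" "\<delta> \<in> Bij (cball 0 1)"
      using gd subgroup.subset[OF sub] by (auto simp: BijGroup_def)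
    then have "?g = compose (cball 0 1) \<gamma> \<delta>" by (simp add: BijGroup_def)
    then have g: "?g z = \<gamma> (\<delta> z)" if "z \<in> sphere 0 1" for z using that by (simp add: compose_def)
    have 2: "AE z in circle_measure. q (\<gamma> (\<delta> z)) = \<sigma> \<gamma> * q (\<delta> z)"
      by (rule AE_inner_map[OF fuchsian_inner_map[OF \<Gamma> gd(2)] \<sigma>(2)[OF gd(1)]])
    have "AE z in circle_measure. z \<in> sphere 0 1" by (rule AE_I2) simp
    then have "AE z in circle_measure. \<sigma> ?g = \<sigma> \<gamma> * \<sigma> \<delta>"
      using 1 2 \<sigma>(2)[OF gd(2)] qq
    proof eventually_elim
      case (elim z)
      have "q z \<noteq> 0" using elim(5) by auto
      moreover have "\<sigma> ?g * q z = \<sigma> \<gamma> * \<sigma> \<delta> * q z"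
        using elim(2,3,4) g[OF elim(1)] by (metis mult.assoc)
      ultimately show ?case by simp
    qed
    then show ?thesis using AE_circle_witness by blast
  qed
  then have "\<sigma> \<in> characters \<Gamma>"
    using \<sigma>(1) by (auto simp: characters_def hom_def circle_group_def)
  then show thesis using that \<sigma>(2) by blast
qed

section \<open>Norms of the Hankel-type operators\<close>

text \<open>If \<open>p\<close> is the projection of \<open>g\<close> onto \<open>H\<^sup>2\<^sub>\<sigma>\<close>, then \<open>h p\<close> is in \<open>H\<^sup>2\<^sub>\<sigma>\<close>, so that the distance of
  \<open>f p\<close> from this space is at most \<open>\<parallel>(f + h) p\<parallel>\<close>.\<close>

lemma opnorm_le_Linf_norm:
  assumes \<Gamma>: "fuchsian \<Gamma>" and f: "f \<in> Linf" and h: "h \<in> invariant_space (hardy Linf) \<Gamma>"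
    and \<sigma>: "\<sigma> \<in> characters \<Gamma>"
  shows "L2_opnorm (compl_proj (character_space (hardy L2) \<Gamma> \<sigma>) \<circ> mult_op f \<circ>
         orth_proj (character_space (hardy L2) \<Gamma> \<sigma>)) \<le> Linf_norm (\<lambda>z. f z + h z)"
proof (rule ereal_le_real)
  fix B :: real assume "Linf_norm (\<lambda>z. f z + h z) \<le> ereal B"
  then have B: "AE z in circle_measure. cmod (f z + h z) \<le> B" by (rule Linf_norm_AE_bound)
  define M where "M = character_space (hardy L2) \<Gamma> \<sigma>"
  have M: "L2_subspace M" unfolding M_def by (rule L2_subspace_character_space[OF \<Gamma>])
  have hH: "h \<in> hardy Linf" and h_inv: "\<And>\<gamma>. \<gamma> \<in> \<Gamma> \<Longrightarrow> AE z in circle_measure. h (\<gamma> z) = h z"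
    using h by (auto simp: invariant_space_def)
  obtain A where A: "AE z in circle_measure. cmod (f z) \<le> A" using f by (auto simp: Linf_iff)
  have [measurable]: "f \<in> borel_measurable circle_measure" "h \<in> borel_measurable circle_measure"
    using f hH by (auto simp: Linf_iff hardy_def)
  obtain z0 where "cmod (f z0 + h z0) \<le> B" using AE_circle_witness[OF B] by blast
  then have B0: "0 \<le> B" using norm_ge_zero order_trans by blast
  have "L2_norm ((compl_proj M \<circ> mult_op f \<circ> orth_proj M) g) \<le> B" if g: "g \<in> L2" "L2_norm g \<le> 1" for g
  proof -
    define p where "p = orth_proj M g"
    have pM: "p \<in> M" unfolding p_def by (rule orth_proj_mem[OF M g(1)])
    then have pL: "p \<in> L2" and pH: "p \<in> hardy L2"
      and p_inv: "\<And>\<gamma>. \<gamma> \<in> \<Gamma> \<Longrightarrow> AE z in circle_measure. p (\<gamma> z) = \<sigma> \<gamma> * p z"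
      by (auto simp: M_def character_space_def hardy_def)
    have p1: "L2_norm p \<le> 1" using orth_proj_norm_le[OF M g(1)] g(2) by (simp add: p_def)
    have hp: "(\<lambda>z. h z * p z) \<in> M"
      unfolding M_def character_space_def
    proof (intro CollectI conjI ballI)
      show "(\<lambda>z. h z * p z) \<in> hardy L2" by (rule hardy_mult[OF hH pH])
      fix \<gamma> assume "\<gamma> \<in> \<Gamma>"
      from h_inv[OF this] p_inv[OF this]
      show "AE z in circle_measure. h (\<gamma> z) * p (\<gamma> z) = \<sigma> \<gamma> * (h z * p z)"
        by eventually_elim simp
    qed
    have mhp: "(\<lambda>z. - (h z * p z)) \<in> M" using L2_subspaceD(5)[OF M hp, of "-1"] by simp
    have fp: "(\<lambda>z. f z * p z) \<in> L2" by (rule L2_bounded_mult[OF _ A pL]) measurable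
    have "L2_norm (compl_proj M (\<lambda>z. f z * p z)) \<le> L2_norm (\<lambda>z. f z * p z - - (h z * p z))"
      by (rule compl_proj_le[OF M fp mhp])
    also have "\<dots> \<le> L2_norm (\<lambda>z. complex_of_real B * p z)"
    proof (rule L2_norm_mono(2)[OF _ L2_scale[OF pL]])
      show "(\<lambda>z. f z * p z - - (h z * p z)) \<in> borel_measurable circle_measure"
        using L2_measurable[OF pL] by measurable
      show "AE z in circle_measure. cmod (f z * p z - - (h z * p z)) \<le> cmod (complex_of_real B * p z)"
        using B
      proof eventually_elim
        case (elim z)
        have "f z * p z - - (h z * p z) = (f z + h z) * p z" by (simp add: algebra_simps)
        then show ?case using elim B0 by (simp add: norm_mult mult_right_mono)
      qed
    qed
    also have "\<dots> \<le> B" using B0 p1 mult_left_mono[of "L2_norm p" 1 B] by (simp add: L2_norm_scale)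
    finally show ?thesis by (simp add: mult_op_def p_def)
  qed
  then show "L2_opnorm (compl_proj (character_space (hardy L2) \<Gamma> \<sigma>) \<circ> mult_op f \<circ>
         orth_proj (character_space (hardy L2) \<Gamma> \<sigma>)) \<le> ereal B"
    unfolding L2_opnorm_def M_def[symmetric] by (intro SUP_least) simp
qed

text \<open>A function in \<open>M\<close> is its own projection, up to a null set. That null set is harmless since
  \<open>compl_proj M\<close> realises the distance from \<open>M\<close>.\<close>

lemma compl_proj_le_opnorm:
  assumes M: "L2_subspace M" and f: "f \<in> Linf" and q: "q \<in> M"
    and op: "L2_opnorm (compl_proj M \<circ> mult_op f \<circ> orth_proj M) \<le> ereal D"
  shows "L2_norm (compl_proj M (\<lambda>z. f z * q z)) \<le> D * L2_norm q"
proof -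
  obtain A where A: "f \<in> borel_measurable circle_measure" "AE z in circle_measure. cmod (f z) \<le> A"
    using f by (auto simp: Linf_iff)
  have ML2: "x \<in> M \<Longrightarrow> x \<in> L2" for x using L2_subspaceD(2)[OF M] by blast
  have fx: "(\<lambda>z. f z * x z) \<in> L2" if "x \<in> L2" for x by (rule L2_bounded_mult[OF A that])
  show ?thesis
  proof (cases "L2_norm q = 0")
    case True
    then have q0: "AE z in circle_measure. q z = 0" using L2_norm_eq_0_iff[OF ML2[OF q]] by simp
    have "L2_norm (compl_proj M (\<lambda>z. f z * q z)) \<le> L2_norm (\<lambda>z. f z * q z - 0)"
      by (rule compl_proj_le[OF M fx[OF ML2[OF q]] L2_subspaceD(3)[OF M]])
    also have "AE z in circle_measure. f z * q z = 0" using q0 by eventually_elim simp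
    then have "L2_norm (\<lambda>z. f z * q z - 0) = 0"
      using L2_norm_eq_0_iff[OF fx[OF ML2[OF q]]] by (simp only: diff_zero)
    finally show ?thesis using True by simp
  next
    case False
    define c where "c = L2_norm q"
    have c: "c > 0" using False by (simp add: c_def less_le)
    define g where "g z = of_real (1 / c) * q z" for z
    have gM: "g \<in> M" unfolding g_def by (rule L2_subspaceD(5)[OF M q])
    have gL: "g \<in> L2" by (rule ML2[OF gM])
    have g1: "L2_norm g = 1" unfolding g_def L2_norm_scale norm_of_real using c by (simp add: c_def)
    define p where "p = orth_proj M g"
    have pg: "AE z in circle_measure. p z = g z" unfolding p_def by (rule orth_proj_of_mem[OF M gM])
    have pL: "p \<in> L2" unfolding p_def by (rule ML2[OF orth_proj_mem[OF M gL]])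
    \<comment> \<open>After scaling, \<open>k\<close> competes with the projection of \<open>f q\<close>.\<close>
    define k where "k = orth_proj M (\<lambda>z. f z * p z)"
    have kM: "k \<in> M" unfolding k_def by (rule orth_proj_mem[OF M fx[OF pL]])
    have ck: "(\<lambda>z. of_real c * k z) \<in> M" by (rule L2_subspaceD(5)[OF M kM])
    have "ereal (L2_norm ((compl_proj M \<circ> mult_op f \<circ> orth_proj M) g))
        \<le> L2_opnorm (compl_proj M \<circ> mult_op f \<circ> orth_proj M)"
      unfolding L2_opnorm_def by (rule SUP_upper) (use gL g1 in simp)
    from order_trans[OF this op]
    have "ereal (L2_norm ((compl_proj M \<circ> mult_op f \<circ> orth_proj M) g)) \<le> ereal D" .
    then have D: "L2_norm (\<lambda>z. f z * p z - k z) \<le> D"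
      by (simp add: mult_op_def compl_proj_def p_def k_def)
    have "L2_norm (compl_proj M (\<lambda>z. f z * q z)) \<le> L2_norm (\<lambda>z. f z * q z - of_real c * k z)"
      by (rule compl_proj_le[OF M fx[OF ML2[OF q]] ck])
    also have "\<dots> = L2_norm (\<lambda>z. of_real c * (f z * p z - k z))"
    proof (rule L2_norm_cong)
      show "(\<lambda>z. f z * q z - of_real c * k z) \<in> borel_measurable circle_measure"
        by (intro L2_measurable L2_diff fx ML2 q ck)
      show "(\<lambda>z. of_real c * (f z * p z - k z)) \<in> borel_measurable circle_measure"
        by (intro L2_measurable L2_scale L2_diff fx pL ML2 kM)
      show "AE z in circle_measure. cmod (f z * q z - of_real c * k z) = cmod (of_real c * (f z * p z - k z))"
        using pg
      proof eventually_elim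
        case (elim z)
        have "of_real c * p z = q z" unfolding elim g_def using c by simp
        then have "f z * q z - of_real c * k z = of_real c * (f z * p z - k z)"
          by (simp add: right_diff_distrib)
        then show ?case by simp
      qed
    qed
    also have "\<dots> = c * L2_norm (\<lambda>z. f z * p z - k z)"
      unfolding L2_norm_scale using c by simp
    also have "\<dots> \<le> c * D" using D c by (intro mult_left_mono) auto
    finally show ?thesis by (simp add: c_def mult.commute)
  qed
qed

section \<open>Minimising the distance from a disk\<close>

text \<open>The distance from a disk is a convex Lipschitz function, so its \<open>L\<^sup>2\<close> norm along \<open>f + H\<close> is a convex
  Lipschitz functional of the kind treated in \<open>L2_minimiser_exists\<close>.\<close>

lemma excess_minimiser_exists:
  assumes H: "L2_subspace H" and f: "f \<in> L2" and D: "0 \<le> D"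
  obtains h where "h \<in> H"
    "\<And>k. k \<in> H \<Longrightarrow> L2_norm (\<lambda>z. complex_of_real (max 0 (cmod (f z + h z) - D)))
        \<le> L2_norm (\<lambda>z. complex_of_real (max 0 (cmod (f z + k z) - D)))"
proof -
  define e where "e x = complex_of_real (max 0 (cmod x - D))" for x
  define \<Phi> where "\<Phi> x = L2_norm (\<lambda>z. e (f z + x z))" for x
  have HL: "x \<in> H \<Longrightarrow> x \<in> L2" for x using L2_subspaceD(2)[OF H] by blast
  have em [measurable]: "e \<in> borel_measurable borel" unfolding e_def by measurable
  have e_le: "cmod (e x) \<le> cmod x" for x using D by (simp add: e_def)
  have e_tri: "cmod (e x) \<le> cmod (e y) + cmod (x - y)" for x y
    using norm_triangle_ineq2[of x y] by (simp add: e_def max_def)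
  have eL: "(\<lambda>z. e (x z)) \<in> L2" if "x \<in> L2" for x
    using that e_le by (intro L2_norm_mono(1)[OF _ that]) (auto intro: measurable_compose[OF L2_measurable em])
  have lip: "\<Phi> x - \<Phi> y \<le> 1 * L2_norm (\<lambda>z. x z - y z)" if xy: "x \<in> L2" "y \<in> L2" for x y
  proof -
    have fx: "(\<lambda>z. f z + x z) \<in> L2" "(\<lambda>z. f z + y z) \<in> L2" "(\<lambda>z. x z - y z) \<in> L2"
      using f xy by (auto intro: L2_add L2_diff)
    have n: "(\<lambda>z. complex_of_real (cmod (x z - y z))) \<in> L2"
      "(\<lambda>z. complex_of_real (cmod (e (f z + y z)))) \<in> L2"
      using fx(3) eL[OF fx(2)] by (auto simp: L2_def)
    have "\<Phi> x \<le> L2_norm (\<lambda>z. complex_of_real (cmod (e (f z + y z))) + complex_of_real (cmod (x z - y z)))"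
      unfolding \<Phi>_def
    proof (rule L2_norm_mono(2)[OF L2_measurable[OF eL[OF fx(1)]] L2_add[OF n(2,1)]], rule AE_I2)
      fix z
      have "cmod (complex_of_real (cmod (e (f z + y z))) + complex_of_real (cmod (x z - y z)))
          = cmod (e (f z + y z)) + cmod (x z - y z)"
        by (simp flip: of_real_add)
      then show "cmod (e (f z + x z)) \<le> cmod (complex_of_real (cmod (e (f z + y z))) + complex_of_real (cmod (x z - y z)))"
        using e_tri[of "f z + x z" "f z + y z"] by simp
    qed
    also have "\<dots> \<le> L2_norm (\<lambda>z. complex_of_real (cmod (e (f z + y z)))) + L2_norm (\<lambda>z. complex_of_real (cmod (x z - y z)))"
      by (rule L2_norm_triangle[OF n(2,1)])
    also have "\<dots> = \<Phi> y + L2_norm (\<lambda>z. x z - y z)" by (simp add: \<Phi>_def L2_norm_def)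
    finally show ?thesis by simp
  qed
  have mid: "\<Phi> (\<lambda>z. (x z + y z) / 2) \<le> (\<Phi> x + \<Phi> y) / 2" if xy: "x \<in> H" "y \<in> H" for x y
  proof -
    have fx: "(\<lambda>z. e (f z + x z)) \<in> L2" "(\<lambda>z. e (f z + y z)) \<in> L2"
      using f xy[THEN HL] by (auto intro!: eL L2_add)
    have m: "(\<lambda>z. f z + (x z + y z) / 2) \<in> L2"
      using L2_scale[OF L2_add[OF xy[THEN HL]], of "1/2"] f by (intro L2_add) auto
    have "\<Phi> (\<lambda>z. (x z + y z) / 2) \<le> L2_norm (\<lambda>z. 1/2 * (e (f z + x z) + e (f z + y z)))"
      unfolding \<Phi>_def
    proof (rule L2_norm_mono(2)[OF L2_measurable[OF eL[OF m]] L2_scale[OF L2_add[OF fx]]], rule AE_I2)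
      fix z
      let ?a = "f z + x z" and ?b = "f z + y z"
      have 1: "f z + (x z + y z) / 2 = (?a + ?b) / 2" by (simp add: field_simps)
      have 2: "cmod ((?a + ?b) / 2) \<le> (cmod ?a + cmod ?b) / 2"
        using norm_triangle_ineq[of ?a ?b] by (simp add: norm_divide)
      have "1/2 * (e ?a + e ?b) = complex_of_real ((max 0 (cmod ?a - D) + max 0 (cmod ?b - D)) / 2)"
        by (simp add: e_def)
      then have 3: "cmod (1/2 * (e ?a + e ?b)) = (max 0 (cmod ?a - D) + max 0 (cmod ?b - D)) / 2"
        by (simp only: norm_of_real) simp
      have "max 0 (c - D) \<le> (max 0 (a - D) + max 0 (b - D)) / 2" if "c \<le> (a + b) / 2" for a b c
        using that by (auto simp: max_def field_simps)
      from this[OF 2] show "cmod (e (f z + (x z + y z) / 2)) \<le> cmod (1/2 * (e ?a + e ?b))"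
        unfolding 1 3 by (simp add: e_def)
    qed
    also have "\<dots> = L2_norm (\<lambda>z. e (f z + x z) + e (f z + y z)) / 2"
      using L2_norm_scale[of "1/2"] by simp
    also have "\<dots> \<le> (\<Phi> x + \<Phi> y) / 2"
      using L2_norm_triangle[OF fx] by (simp add: \<Phi>_def)
    finally show ?thesis .
  qed
  have coer: "L2_norm x \<le> (D + L2_norm f) + 1 * \<Phi> x" if "x \<in> H" for x
  proof -
    have fx: "(\<lambda>z. f z + x z) \<in> L2" using f HL[OF that] by (rule L2_add)
    have "L2_norm (\<lambda>z. f z + x z) \<le> L2_norm (\<lambda>z. complex_of_real D + e (f z + x z))"
    proof (rule L2_norm_mono(2)[OF L2_measurable[OF fx] L2_add[OF L2_const eL[OF fx]]], rule AE_I2)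
      fix z
      have "cmod (complex_of_real D + e (f z + x z)) = D + max 0 (cmod (f z + x z) - D)"
        using D unfolding e_def by (simp flip: of_real_add)
      then show "cmod (f z + x z) \<le> cmod (complex_of_real D + e (f z + x z))" by simp
    qed
    also have "\<dots> \<le> L2_norm (\<lambda>z. complex_of_real D) + \<Phi> x"
      unfolding \<Phi>_def by (rule L2_norm_triangle[OF L2_const eL[OF fx]])
    also have "L2_norm (\<lambda>z. complex_of_real D) = D"
      using D circle.prob_space by (simp add: L2_norm_def)
    finally show ?thesis
      using L2_norm_triangle[OF fx L2_scale[OF f, of "-1"]] L2_norm_scale[of "-1" f] by simp
  qed
  have nonempty: "H \<noteq> {}" using L2_subspaceD(3)[OF H] by blast
  have nonneg: "0 \<le> \<Phi> x" for x by (simp add: \<Phi>_def)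
  obtain h where "h \<in> H" "\<And>y. y \<in> H \<Longrightarrow> \<Phi> h \<le> \<Phi> y"
    using L2_minimiser_exists[OF L2_subspaceD(1)[OF H] L2_subspace_midpoint_convex[OF H]
        nonempty nonneg mid lip coer zero_le_one] by blast
  then show thesis using that[of h] unfolding \<Phi>_def e_def by simp
qed

text \<open>Chosen such that \<open>clip_weight D x * x\<close> is the vector from the nearest point of the disk of radius
  \<open>D\<close> to \<open>x\<close>, which is half the gradient of the squared distance from that disk.\<close>

definition clip_weight :: "real \<Rightarrow> complex \<Rightarrow> real" where
  "clip_weight D x = (if cmod x \<le> D then 0 else 1 - D / cmod x)"

lemma clip_weight_bounds: "0 \<le> D \<Longrightarrow> 0 \<le> clip_weight D x" "0 \<le> D \<Longrightarrow> clip_weight D x \<le> 1"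
  by (auto simp: clip_weight_def divide_le_eq)

lemma clip_weight_norm:
  assumes "0 \<le> D" shows "cmod (of_real (clip_weight D x) * x) = max 0 (cmod x - D)"
proof (cases "cmod x \<le> D")
  case False
  then have "x \<noteq> 0" using assms by auto
  then have "clip_weight D x * cmod x = cmod x - D" using False by (simp add: clip_weight_def field_simps)
  then show ?thesis using False clip_weight_bounds(1)[OF assms, of x] by (simp add: norm_mult)
qed (simp add: clip_weight_def)

text \<open>If \<open>p\<close> is the point of the disk nearest to \<open>x\<close>, then \<open>x + y\<close> has distance at most \<open>\<bar>x + y - p\<bar>\<close>
  from the disk. This smooth upper bound, exact at \<open>y = 0\<close>, allows differentiation of the distance
  functional without differentiating the distance.\<close>

lemma excess_le:
  assumes "0 \<le> D"
  shows "max 0 (cmod (x + y) - D) \<le> cmod (of_real (clip_weight D x) * x + y)"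
proof -
  have "cmod ((1 - of_real (clip_weight D x)) * x) \<le> D"
  proof (cases "cmod x \<le> D")
    case False
    then have "x \<noteq> 0" using assms by auto
    have "(1 - of_real (clip_weight D x)) * x = of_real (D / cmod x) * x"
      using False by (simp add: clip_weight_def)
    then show ?thesis using \<open>x \<noteq> 0\<close> assms by (simp add: norm_mult norm_divide)
  qed (simp add: clip_weight_def)
  moreover have "x + y = (of_real (clip_weight D x) * x + y) + (1 - of_real (clip_weight D x)) * x"
    by (simp add: algebra_simps)
  then have "cmod (x + y) \<le> cmod (of_real (clip_weight D x) * x + y)
      + cmod ((1 - of_real (clip_weight D x)) * x)"
    by (metis norm_triangle_ineq)
  ultimately show ?thesis by simp
qed

lemma invariant_space_eq_character_space:
  "invariant_space X \<Gamma> = character_space X \<Gamma> (\<lambda>_. 1)"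
  by (simp add: invariant_space_def character_space_def)

text \<open>Compare \<open>h\<close> with \<open>h + t k\<close> through the quadratic upper bound of \<open>excess_le\<close>.\<close>

lemma excess_first_variation:
  assumes H: "L2_subspace H" and f: "f \<in> L2" and D: "0 \<le> D" and h: "h \<in> H"
    and min: "\<And>k. k \<in> H \<Longrightarrow> L2_norm (\<lambda>z. complex_of_real (max 0 (cmod (f z + h z) - D)))
        \<le> L2_norm (\<lambda>z. complex_of_real (max 0 (cmod (f z + k z) - D)))"
    and k: "k \<in> H"
  shows "L2_inner (\<lambda>z. of_real (clip_weight D (f z + h z)) * (f z + h z)) k = 0"
proof (rule linear_part_eq_0)
  fix t :: complex
  define g where "g z = of_real (clip_weight D (f z + h z)) * (f z + h z)" for z
  have L: "h \<in> L2" "k \<in> L2" using h k L2_subspaceD(2)[OF H] by auto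
  have F: "(\<lambda>z. f z + h z) \<in> L2" by (rule L2_add[OF f L(1)])
  note [measurable] = L2_measurable[OF F] L2_measurable[OF L(2)] L2_measurable[OF f] L2_measurable[OF L(1)]
  have wm: "(\<lambda>z. complex_of_real (clip_weight D (f z + h z))) \<in> borel_measurable circle_measure"
    unfolding clip_weight_def by measurable
  have g: "g \<in> L2"
    unfolding g_def by (rule L2_bounded_mult[OF wm _ F, where B = 1])
      (use clip_weight_bounds[OF D] in simp)
  have tk: "(\<lambda>z. t * k z) \<in> L2" by (rule L2_scale[OF L(2)])
  have htk: "(\<lambda>z. h z + t * k z) \<in> H" using L2_subspaceD(4,5)[OF H] h k by blast
  have "L2_norm g = L2_norm (\<lambda>z. complex_of_real (max 0 (cmod (f z + h z) - D)))"
    using clip_weight_norm[OF D] by (simp add: L2_norm_def g_def)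
  also have "\<dots> \<le> L2_norm (\<lambda>z. complex_of_real (max 0 (cmod (f z + (h z + t * k z)) - D)))"
    by (rule min[OF htk])
  also have "\<dots> \<le> L2_norm (\<lambda>z. g z + t * k z)"
  proof (rule L2_norm_mono(2)[OF _ L2_add[OF g tk]])
    show "(\<lambda>z. complex_of_real (max 0 (cmod (f z + (h z + t * k z)) - D))) \<in> borel_measurable circle_measure"
      by measurable
    show "AE z in circle_measure. cmod (complex_of_real (max 0 (cmod (f z + (h z + t * k z)) - D)))
        \<le> cmod (g z + t * k z)"
      using excess_le[OF D, of "f z + h z" "t * k z" for z] by (intro AE_I2) (simp add: g_def add.assoc)
  qed
  finally have "(L2_norm g)\<^sup>2 \<le> (L2_norm (\<lambda>z. g z + t * k z))\<^sup>2" by (intro power_mono) auto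
  then show "0 \<le> 2 * Re (cnj t * L2_inner (\<lambda>z. of_real (clip_weight D (f z + h z)) * (f z + h z)) k)
      + (cmod t)\<^sup>2 * (L2_norm k)\<^sup>2"
    unfolding L2_norm_add_sq[OF g tk]
    by (simp add: L2_inner_scale_right L2_norm_scale power_mult_distrib g_def[abs_def])
qed

section \<open>The distance formula\<close>

text \<open>For the minimiser \<open>h\<close> of the distance of \<open>F = f + h\<close> from the disk of radius \<open>D\<close> with weight \<open>w\<close>, the
  core is the estimate \<open>\<integral> \<bar>F\<bar>\<^sup>2 w \<le> D\<^sup>2 \<integral> (w + \<epsilon>)\<close>. With \<open>\<bar>q\<bar>\<^sup>2 = w + \<epsilon>\<close> and \<open>q\<close> of character \<open>\<sigma>\<close>,
  the projection of \<open>f q\<close> onto \<open>H\<^sup>2\<^sub>\<sigma>\<close> is \<open>- q g\<close> for some \<open>g \<in> H\<^sup>2\<^sub>\<Gamma>\<close>; then \<open>h\<close> does better than \<open>g\<close> for the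
  weight \<open>w\<close>, and \<open>g\<close> is bounded by the hypothesis for the larger weight \<open>w + \<epsilon>\<close>.\<close>

lemma bounded_representative_if_opnorms_bounded:
  assumes \<Gamma>: "fuchsian \<Gamma>" and f: "f \<in> invariant_space Linf \<Gamma>" and D: "0 \<le> D"
    and bound: "\<And>\<sigma> q. \<sigma> \<in> characters \<Gamma> \<Longrightarrow> q \<in> character_space (hardy L2) \<Gamma> \<sigma> \<Longrightarrow>
      L2_norm (compl_proj (character_space (hardy L2) \<Gamma> \<sigma>) (\<lambda>z. f z * q z)) \<le> D * L2_norm q"
  obtains h where "h \<in> invariant_space (hardy Linf) \<Gamma>" "AE z in circle_measure. cmod (f z + h z) \<le> D"
proof -
  define H where "H = invariant_space (hardy L2) \<Gamma>"
  have H: "L2_subspace H"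
    unfolding H_def invariant_space_eq_character_space by (rule L2_subspace_character_space[OF \<Gamma>])
  have HL: "x \<in> H \<Longrightarrow> x \<in> L2" for x using L2_subspaceD(2)[OF H] by blast
  have fi: "f \<in> Linf" and f_inv: "\<And>\<gamma>. \<gamma> \<in> \<Gamma> \<Longrightarrow> AE z in circle_measure. f (\<gamma> z) = f z"
    using f by (auto simp: invariant_space_def)
  have fL: "f \<in> L2" by (rule Linf_subset_L2[OF fi])
  obtain A where A: "AE z in circle_measure. cmod (f z) \<le> A" using fi by (auto simp: Linf_iff)
  have fm [measurable]: "f \<in> borel_measurable circle_measure" using fi by (simp add: Linf_iff)
  obtain h where h: "h \<in> H"
    and min: "\<And>k. k \<in> H \<Longrightarrow> L2_norm (\<lambda>z. complex_of_real (max 0 (cmod (f z + h z) - D)))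
        \<le> L2_norm (\<lambda>z. complex_of_real (max 0 (cmod (f z + k z) - D)))"
    using excess_minimiser_exists[OF H fL D] by blast
  define F where "F z = f z + h z" for z
  define w where "w z = clip_weight D (F z)" for z
  have FL: "F \<in> L2" unfolding F_def by (rule L2_add[OF fL HL[OF h]])
  note [measurable] = L2_measurable[OF FL]
  have wm [measurable]: "w \<in> borel_measurable circle_measure"
    unfolding w_def clip_weight_def by measurable
  have w: "0 \<le> w z" "w z \<le> 1" for z using clip_weight_bounds[OF D] by (auto simp: w_def)
  have h_inv: "AE z in circle_measure. h (\<gamma> z) = h z" if "\<gamma> \<in> \<Gamma>" for \<gamma>
    using h that by (auto simp: H_def invariant_space_def)
  have w_inv: "AE z in circle_measure. w (\<gamma> z) = w z" if "\<gamma> \<in> \<Gamma>" for \<gamma>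
    using f_inv[OF that] h_inv[OF that] by eventually_elim (simp add: w_def F_def)
  have orth: "L2_inner (\<lambda>z. of_real (w z) * F z) k = 0" if "k \<in> H" for k
    using excess_first_variation[OF H fL D h min that] by (simp add: w_def F_def)
  define s where "s z = complex_of_real (sqrt (w z))" for z
  have sm [measurable]: "s \<in> borel_measurable circle_measure" unfolding s_def by measurable
  have s1: "cmod (s z) \<le> 1" for z using w[of z] by (simp add: s_def)
  have sL: "(\<lambda>z. s z * x z) \<in> L2" if "x \<in> L2" for x
    by (rule L2_bounded_mult[OF sm _ that]) (use s1 in auto)
  have sL2: "s \<in> L2" using sL[OF L2_const[of 1]] by simp
  have main: "(L2_norm (\<lambda>z. s z * F z))\<^sup>2 \<le> D\<^sup>2 * (L2_norm s)\<^sup>2 + D\<^sup>2 * \<epsilon>" if \<epsilon>: "\<epsilon> > 0" for \<epsilon>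
  proof -
    obtain q q' where q: "q \<in> hardy Linf" "q' \<in> hardy Linf" "AE z in circle_measure. q z * q' z = 1"
      and q_sq: "AE z in circle_measure. (cmod (q z))\<^sup>2 = w z + \<epsilon>"
      by (rule szego_factorization[of "\<lambda>z. w z + \<epsilon>" \<epsilon> "1 + \<epsilon>"]) (use w \<epsilon> in auto)
    have "AE z in circle_measure. cmod (q (\<gamma> z)) = cmod (q z)" if g: "\<gamma> \<in> \<Gamma>" for \<gamma>
      using q_sq AE_inner_map[OF fuchsian_inner_map[OF \<Gamma> g] q_sq] w_inv[OF g]
    proof eventually_elim
      case (elim z)
      then have "(cmod (q (\<gamma> z)))\<^sup>2 = (cmod (q z))\<^sup>2" by simp
      then show ?case by (simp add: power2_eq_iff_nonneg)
    qed
    then obtain \<sigma> where \<sigma>: "\<sigma> \<in> characters \<Gamma>"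
      "\<And>\<gamma>. \<gamma> \<in> \<Gamma> \<Longrightarrow> AE z in circle_measure. q (\<gamma> z) = \<sigma> \<gamma> * q z"
      using character_of_invariant_modulus[OF \<Gamma> q] by blast
    define M where "M = character_space (hardy L2) \<Gamma> \<sigma>"
    have M: "L2_subspace M" unfolding M_def by (rule L2_subspace_character_space[OF \<Gamma>])
    have qH: "q \<in> hardy L2" and qL: "q \<in> L2"
      using q(1) Linf_subset_L2 by (auto simp: hardy_Linf_eq)
    note [measurable] = L2_measurable[OF qL]
    have qM: "q \<in> M" using qH \<sigma>(2) by (simp add: M_def character_space_def)
    have fq: "(\<lambda>z. f z * q z) \<in> L2" by (rule L2_bounded_mult[OF fm A qL])
    define v where "v z = - orth_proj M (\<lambda>z. f z * q z) z" for z
    have vM: "v \<in> M"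
      using L2_subspaceD(5)[OF M orth_proj_mem[OF M fq], of "-1"] by (simp add: v_def[abs_def])
    define g where "g z = q' z * v z" for z
    have gH: "g \<in> H"
      unfolding H_def invariant_space_def
    proof (intro CollectI conjI ballI)
      have vH: "v \<in> hardy L2" using vM by (simp add: M_def character_space_def)
      show "g \<in> hardy L2" unfolding g_def by (rule hardy_mult[OF q(2) vH])
      fix \<gamma> assume \<gamma>: "\<gamma> \<in> \<Gamma>"
      have "AE z in circle_measure. v (\<gamma> z) = \<sigma> \<gamma> * v z" using vM \<gamma> by (simp add: M_def character_space_def)
      then show "AE z in circle_measure. g (\<gamma> z) = g z"
        using \<sigma>(2)[OF \<gamma>] q(3) AE_inner_map[OF fuchsian_inner_map[OF \<Gamma> \<gamma>] q(3)]
      proof eventually_elim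
        case (elim z)
        have "\<sigma> \<gamma> * q' (\<gamma> z) = (q z * q' z) * (\<sigma> \<gamma> * q' (\<gamma> z))" using elim(3) by simp
        also have "\<dots> = q' z * (\<sigma> \<gamma> * q z * q' (\<gamma> z))" by (simp only: mult_ac)
        also have "\<dots> = q' z" using elim(2,4) by simp
        finally have "\<sigma> \<gamma> * q' (\<gamma> z) = q' z" .
        moreover have "g (\<gamma> z) = (\<sigma> \<gamma> * q' (\<gamma> z)) * v z" unfolding g_def elim(1) by (simp only: mult_ac)
        ultimately show ?case by (simp only: g_def)
      qed
    qed
    \<comment> \<open>\<open>F + k = f + g\<close>, and \<open>w F\<close> is orthogonal to \<open>k\<close>: Pythagoras for the weight \<open>w\<close>.\<close>
    define k where "k z = g z - h z" for z
    have kH: "k \<in> H" unfolding k_def by (rule L2_subspaceD(6)[OF H gH h])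
    have kL: "k \<in> L2" by (rule HL[OF kH])
    have Fk: "(\<lambda>z. F z + k z) \<in> L2" by (rule L2_add[OF FL kL])
    have "L2_inner (\<lambda>z. s z * F z) (\<lambda>z. s z * k z) = L2_inner (\<lambda>z. of_real (w z) * F z) k"
    proof -
      have "s z * F z * cnj (s z * k z) = of_real (w z) * F z * cnj (k z)" for z
      proof -
        have "s z * cnj (s z) = of_real (w z)" using w(1)[of z] by (simp add: s_def flip: of_real_mult)
        moreover have "s z * F z * cnj (s z * k z) = (s z * cnj (s z)) * F z * cnj (k z)" by (simp add: mult_ac)
        ultimately show ?thesis by (simp only:)
      qed
      then show ?thesis unfolding L2_inner_def by (simp only:)
    qed
    then have "(L2_norm (\<lambda>z. s z * F z + s z * k z))\<^sup>2 = (L2_norm (\<lambda>z. s z * F z))\<^sup>2 + (L2_norm (\<lambda>z. s z * k z))\<^sup>2"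
      using L2_norm_add_sq[OF sL[OF FL] sL[OF kL]] orth[OF kH] by simp
    then have less: "(L2_norm (\<lambda>z. s z * F z))\<^sup>2 \<le> (L2_norm (\<lambda>z. s z * (F z + k z)))\<^sup>2"
      by (simp add: distrib_left)
    have "L2_norm (\<lambda>z. s z * (F z + k z)) \<le> L2_norm (compl_proj M (\<lambda>z. f z * q z))"
    proof (rule L2_norm_mono(2)[OF L2_measurable[OF sL[OF Fk]]])
      show "compl_proj M (\<lambda>z. f z * q z) \<in> L2"
        using L2_diff[OF fq] orth_proj_mem[OF M fq] L2_subspaceD(2)[OF M] by (auto simp: compl_proj_def)
      show "AE z in circle_measure. cmod (s z * (F z + k z)) \<le> cmod (compl_proj M (\<lambda>z. f z * q z) z)"
        using q(3) q_sq
      proof eventually_elim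
        case (elim z)
        have "compl_proj M (\<lambda>z. f z * q z) z = f z * q z + (q z * q' z) * v z"
          unfolding elim(1) by (simp add: compl_proj_def v_def)
        also have "\<dots> = q z * (F z + k z)" by (simp add: F_def k_def g_def algebra_simps)
        finally have *: "compl_proj M (\<lambda>z. f z * q z) z = q z * (F z + k z)" .
        have "(cmod (s z))\<^sup>2 \<le> (cmod (q z))\<^sup>2" unfolding elim(2) using w(1)[of z] \<epsilon> by (simp add: s_def)
        then have "cmod (s z) \<le> cmod (q z)" by (rule power2_le_imp_le) simp
        then show ?case unfolding * norm_mult by (intro mult_right_mono) auto
      qed
    qed
    also have "\<dots> \<le> D * L2_norm q" unfolding M_def by (rule bound[OF \<sigma>(1) qM[unfolded M_def]])
    finally have "(L2_norm (\<lambda>z. s z * (F z + k z)))\<^sup>2 \<le> (D * L2_norm q)\<^sup>2"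
      by (rule power_mono) simp
    with less have le_q: "(L2_norm (\<lambda>z. s z * F z))\<^sup>2 \<le> (D * L2_norm q)\<^sup>2" by (rule order_trans)
    have "(L2_norm q)\<^sup>2 = (L2_norm s)\<^sup>2 + \<epsilon>"
    proof -
      have "(L2_norm q)\<^sup>2 = (LINT z|circle_measure. w z + \<epsilon>)"
        unfolding L2_norm_sq using q_sq by (intro integral_cong_AE) auto
      also have "integrable circle_measure w"
        using L2_sq_integrable[OF sL2] w by (simp add: s_def)
      then have "(LINT z|circle_measure. w z + \<epsilon>) = (LINT z|circle_measure. w z) + \<epsilon>"
        using circle.prob_space by simp
      also have "(LINT z|circle_measure. w z) = (L2_norm s)\<^sup>2"
        unfolding L2_norm_sq using w by (simp add: s_def)
      finally show ?thesis .
    qed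
    then have "(D * L2_norm q)\<^sup>2 = D\<^sup>2 * (L2_norm s)\<^sup>2 + D\<^sup>2 * \<epsilon>"
      by (simp add: power_mult_distrib distrib_left)
    with le_q show ?thesis by simp
  qed
  have le: "(L2_norm (\<lambda>z. s z * F z))\<^sup>2 \<le> D\<^sup>2 * (L2_norm s)\<^sup>2"
  proof (rule field_le_epsilon)
    fix e :: real assume "e > 0"
    have pos: "D\<^sup>2 + 1 > 0" by (simp add: add_nonneg_pos)
    then have "D\<^sup>2 / (D\<^sup>2 + 1) \<le> 1" by (subst divide_le_eq_1_pos) simp_all
    then have "D\<^sup>2 * (e / (D\<^sup>2 + 1)) \<le> e"
      using mult_left_mono[of "D\<^sup>2 / (D\<^sup>2 + 1)" 1 e] \<open>e > 0\<close> by (simp add: mult.commute)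
    then show "(L2_norm (\<lambda>z. s z * F z))\<^sup>2 \<le> D\<^sup>2 * (L2_norm s)\<^sup>2 + e"
      using main[OF divide_pos_pos[OF \<open>e > 0\<close> pos]] by (meson add_left_mono order_trans)
  qed
  define U where "U z = w z * ((cmod (F z))\<^sup>2 - D\<^sup>2)" for z
  have U_nonneg: "0 \<le> U z" for z
    using w(1)[of z] D power_mono[of D "cmod (F z)" 2]
    by (cases "cmod (F z) \<le> D") (auto simp: U_def w_def clip_weight_def)
  have U_eq: "U z = (cmod (s z * F z))\<^sup>2 - D\<^sup>2 * (cmod (s z))\<^sup>2" for z
    using w(1)[of z] by (simp add: U_def s_def norm_mult power_mult_distrib algebra_simps)
  have iU: "integrable circle_measure U"
    unfolding U_eq[abs_def] using L2_sq_integrable[OF sL[OF FL]] L2_sq_integrable[OF sL2] by simp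
  have "(LINT z|circle_measure. U z) = (L2_norm (\<lambda>z. s z * F z))\<^sup>2 - D\<^sup>2 * (L2_norm s)\<^sup>2"
    unfolding U_eq L2_norm_sq using L2_sq_integrable[OF sL[OF FL]] L2_sq_integrable[OF sL2] by simp
  then have "(LINT z|circle_measure. U z) = 0"
    using le Bochner_Integration.integral_nonneg[of circle_measure U] U_nonneg by simp
  then have "AE z in circle_measure. U z = 0"
    using integral_nonneg_eq_0_iff_AE[OF iU] U_nonneg by simp
  then have FD: "AE z in circle_measure. cmod (F z) \<le> D"
  proof eventually_elim
    case (elim z)
    show ?case
    proof (rule ccontr)
      assume n: "\<not> cmod (F z) \<le> D"
      then have "D\<^sup>2 < (cmod (F z))\<^sup>2" using D by (intro power_strict_mono) auto
      moreover have "w z > 0" using n D by (simp add: w_def clip_weight_def divide_less_eq)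
      ultimately show False using elim by (simp add: U_def)
    qed
  qed
  have "AE z in circle_measure. cmod (h z) \<le> D + A"
    using FD A
  proof eventually_elim
    case (elim z)
    have "cmod (h z) \<le> cmod (F z) + cmod (f z)"
      using norm_triangle_ineq4[of "F z" "f z"] by (simp add: F_def)
    then show ?case using elim by simp
  qed
  then have "h \<in> Linf" using L2_measurable[OF HL[OF h]] by (auto simp: Linf_iff)
  then have "h \<in> invariant_space (hardy Linf) \<Gamma>"
    using h by (simp add: H_def invariant_space_def hardy_Linf_eq)
  then show thesis by (rule that) (use FD in \<open>simp add: F_def\<close>)
qed

theorem theorem1p2:
  fixes \<Gamma> :: "(complex \<Rightarrow> complex) set" and f :: "complex \<Rightarrow> complex"
  assumes "admissible \<Gamma>"
    and "f \<in> invariant_space Linf \<Gamma>"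
  shows "(INF h \<in> invariant_space (hardy Linf) \<Gamma>. Linf_norm (\<lambda>z. f z + h z)) =
    (SUP \<sigma> \<in> characters \<Gamma>.
       L2_opnorm (compl_proj (character_space (hardy L2) \<Gamma> \<sigma>) \<circ> mult_op f \<circ>
         orth_proj (character_space (hardy L2) \<Gamma> \<sigma>)))"
    (is "?dist = ?sup")
proof (rule antisym)
  have \<Gamma>: "fuchsian \<Gamma>" using assms(1) by (simp add: admissible_def)
  have f: "f \<in> Linf" using assms(2) by (simp add: invariant_space_def)
  show le: "?sup \<le> ?dist"
    by (intro INF_greatest SUP_least opnorm_le_Linf_norm[OF \<Gamma> f])
  have zero: "(\<lambda>z. 0) \<in> invariant_space (hardy Linf) \<Gamma>"
    by (auto simp: invariant_space_def hardy_def Linf_iff intro!: exI[of _ 0])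
  have "?dist \<le> Linf_norm (\<lambda>z. f z + 0)" by (rule INF_lower[OF zero])
  also have "\<dots> < \<infinity>" using f by (simp add: Linf_def)
  finally have "?sup < \<infinity>" using le by (rule le_less_trans[rotated])
  moreover have "0 \<le> ?sup"
  proof -
    have "(\<lambda>_. 1) \<in> characters \<Gamma>" by (simp add: characters_def hom_def circle_group_def)
    moreover have "0 \<le> L2_opnorm T" for T
    proof -
      have "ereal (L2_norm (T (\<lambda>z. 0))) \<le> L2_opnorm T"
        unfolding L2_opnorm_def by (rule SUP_upper) simp
      moreover have "0 \<le> ereal (L2_norm (T (\<lambda>z. 0)))" by simp
      ultimately show ?thesis by (rule order_trans[rotated])
    qed
    ultimately show ?thesis by (rule SUP_upper2)
  qed
  ultimately obtain D where D: "?sup = ereal D" "0 \<le> D" by (cases ?sup) auto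
  have "L2_norm (compl_proj (character_space (hardy L2) \<Gamma> \<sigma>) (\<lambda>z. f z * q z)) \<le> D * L2_norm q"
    if "\<sigma> \<in> characters \<Gamma>" "q \<in> character_space (hardy L2) \<Gamma> \<sigma>" for \<sigma> q
    using SUP_upper[OF that(1), of "\<lambda>\<sigma>. L2_opnorm (compl_proj (character_space (hardy L2) \<Gamma> \<sigma>)
        \<circ> mult_op f \<circ> orth_proj (character_space (hardy L2) \<Gamma> \<sigma>))"]
    unfolding D(1) by (rule compl_proj_le_opnorm[OF L2_subspace_character_space[OF \<Gamma>] f that(2)])
  from bounded_representative_if_opnorms_bounded[OF \<Gamma> assms(2) D(2) this]
  obtain h where h: "h \<in> invariant_space (hardy Linf) \<Gamma>" "AE z in circle_measure. cmod (f z + h z) \<le> D"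
    by blast
  have "h \<in> borel_measurable circle_measure" using h(1) by (simp add: invariant_space_def hardy_def Linf_def)
  then have "Linf_norm (\<lambda>z. f z + h z) \<le> ereal D"
    using f h(2) by (intro Linf_norm_leI) (auto simp: Linf_def)
  then show "?dist \<le> ?sup" unfolding D(1) by (intro INF_lower2[OF h(1)])
qed

end
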